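(* Let $p,q$ be constants with $1\le p<d$ and $p\le q<\frac{dp}{d-p}$. There exists a constant $S(\Omega,\eta)>0$, depending only on $\Omega$ and $\eta$, such that the following holds. Assume: (i) for some $K\le S(\Omega,\eta)$ (with $K>0$) there is a sequence of Borel maps $T_n:\Omega\to V_n$ with $T_n\#\mu=\mu_n$ and $\sup_{x\in\Omega}|T_n(x)-x|\le K\varepsilon_n$ for every $n\in\mathbb N$; (ii) $\eta$ is continuous at $0$, non-increasing, and $\eta(0)>0$; (iii) there is $D>0$ with $\frac1D\le\rho(x)\le D$ for all $x\in\Omega$. Additionally assume there exists $t>q$ such that $\aleph_\eta^t<+\infty$, and $$\frac{\varepsilon_n(\Lambda_n^+)^{1/q+1/p}}{(\Lambda_n^-)^{2/p}}\to0\quad\text{as }n\to\infty.$$ Let $(u_n)_{n\in\mathbb N}$ be a sequence of functions $u_n:V_n\to\mathbb R$ such that $(\|u_n\|_{L^p(V_n;\mu_n)})_{n\in\mathbb N}$ and $(\mathcal{GE}_n^p(u_n))_{n\in\mathbb N}$ are bounded. Then the sequence $\big((u_n,\mu_n)\big)_{n\in\mathbb N}$ is relatively compact in $TL^q(\Omega)$.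
   Context: $\mathbb N=\{1,2,\dots\}$; $d\in\mathbb N$; $\Omega\subset\mathbb R^d$ is open and bounded with Lipschitz boundary (near each boundary point, in suitable orthonormal coordinates, $\Omega$ is the region on one side of the graph of a Lipschitz function). $\mu$ is a probability measure on $\Omega$ with continuous density $\rho:\Omega\to\mathbb R$ with respect to Lebesgue measure. For $n\in\mathbb N$, $V_n\subset\Omega$ is a finite set, $\mu_n$ is a probability measure on $V_n$ (also regarded as a measure on $\Omega$, so that functions on $V_n$ are elements of $L^q(\Omega;\mu_n)$), $\mu_n(x):=\mu_n(\{x\})$, $\Lambda_n^-:=\min_{x\in V_n}\mu_n(x)$, $\Lambda_n^+:=\max_{x\in V_n}\mu_n(x)$. $(\varepsilon_n)_{n\in\mathbb N}$ is a sequence of positive reals with $\varepsilon_n\to0$. The kernel is a function $\eta:[0,\infty)\to[0,\infty)$, and $\eta_\varepsilon(r):=\varepsilon^{-d}\eta(r/\varepsilon)$ for $\varepsilon>0$. For $t\ge0$, $\aleph_\eta^t:=\int_0^\infty\eta(r)r^{d+t-1}\,dr$. The push-forward is $T\#\mu(A):=\mu(T^{-1}(A))$. For $u:V_n\to\mathbb R$ and $p\ge1$, $$\|u\|_{L^p(V_n;\mu_n)}:=\Big(\sum_{x\in V_n}|u(x)|^p\mu_n(x)\Big)^{1/p},\qquad \mathcal{GE}_n^p(u):=\frac1{\varepsilon_n^p}\sum_{x\in V_n}\sum_{y\in V_n}\eta_{\varepsilon_n}(|x-y|)|u(x)-u(y)|^p\mu_n(x)\mu_n(y).$$ For $q\ge1$,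 $TL^q(\Omega)$ is the set of pairs $(f,\nu)$ with $\nu$ a Borel probability measure on $\Omega$ with finite $q$-th moment and $f\in L^q(\Omega;\nu)$, with the metric $$d_{TL^q(\Omega)}\big((f,\nu),(g,\lambda)\big):=\inf_{\gamma\in\Gamma(\nu,\lambda)}\Big(\int_{\Omega\times\Omega}|x-y|^q+|f(x)-g(y)|^q\,d\gamma(x,y)\Big)^{1/q},$$ where $\Gamma(\nu,\lambda)$ is the set of couplings of $\nu$ and $\lambda$. A sequence is relatively compact if every subsequence has a further subsequence converging in $TL^q(\Omega)$. *)

theory Defs
  imports "HOL-Probability.Probability"
begin

(* Orthonormal coordinates at x are encoded by a unit vector e: the last coordinate of y is
   y \<bullet> e, the remaining ones are the projection of y to the hyperplane orthogonal to e. *)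
definition lipschitz_boundary :: "'a::euclidean_space set \<Rightarrow> bool" where
  "lipschitz_boundary \<Omega> \<longleftrightarrow>
     (\<forall>x\<in>frontier \<Omega>. \<exists>U e g L. open U \<and> x \<in> U \<and> norm e = 1 \<and>
        L-lipschitz_on {y. y \<bullet> e = 0} (g :: 'a \<Rightarrow> real) \<and>
        \<Omega> \<inter> U = {y \<in> U. g (y - (y \<bullet> e) *\<^sub>R e) < y \<bullet> e})"

definition prob_measures_on :: "'a::euclidean_space set \<Rightarrow> 'a measure set" where
  "prob_measures_on \<Omega> = {\<nu>. prob_space \<nu> \<and> sets \<nu> = sets (restrict_space borel \<Omega>)}"

definition scaled_kernel :: "nat \<Rightarrow> (real \<Rightarrow> real) \<Rightarrow> real \<Rightarrow> real \<Rightarrow> real" where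
  "scaled_kernel d \<eta> \<epsilon> r = \<eta> (r / \<epsilon>) / \<epsilon> ^ d"

definition kernel_moment :: "nat \<Rightarrow> (real \<Rightarrow> real) \<Rightarrow> real \<Rightarrow> ennreal" where
  "kernel_moment d \<eta> t = (\<integral>\<^sup>+ r\<in>{0..}. ennreal (\<eta> r * r powr (real d + t - 1)) \<partial>lborel)"

definition Lp_norm_on :: "real \<Rightarrow> 'a set \<Rightarrow> 'a measure \<Rightarrow> ('a \<Rightarrow> real) \<Rightarrow> real" where
  "Lp_norm_on p V \<nu> u = (\<Sum>x\<in>V. \<bar>u x\<bar> powr p * measure \<nu> {x}) powr (1 / p)"

definition graph_energy ::
    "(real \<Rightarrow> real) \<Rightarrow> real \<Rightarrow> real \<Rightarrow> 'a::euclidean_space set \<Rightarrow> 'a measure \<Rightarrow> ('a \<Rightarrow> real) \<Rightarrow> real"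
  where
  "graph_energy \<eta> p \<epsilon> V \<nu> u =
     1 / \<epsilon> powr p *
     (\<Sum>x\<in>V. \<Sum>y\<in>V. scaled_kernel DIM('a) \<eta> \<epsilon> (norm (x - y)) * \<bar>u x - u y\<bar> powr p *
                   measure \<nu> {x} * measure \<nu> {y})"

definition min_weight :: "'a set \<Rightarrow> 'a measure \<Rightarrow> real" where
  "min_weight V \<nu> = Min ((\<lambda>x. measure \<nu> {x}) ` V)"

definition max_weight :: "'a set \<Rightarrow> 'a measure \<Rightarrow> real" where
  "max_weight V \<nu> = Max ((\<lambda>x. measure \<nu> {x}) ` V)"

definition couplings :: "'a measure \<Rightarrow> 'b measure \<Rightarrow> ('a \<times> 'b) measure set" where
  "couplings \<nu> \<kappa> =
     {\<gamma>. sets \<gamma> = sets (\<nu> \<Otimes>\<^sub>M \<kappa>) \<and> distr \<gamma> \<nu> fst = \<nu> \<and> distr \<gamma> \<kappa> snd = \<kappa>}"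

(* Functions stand for their a.e. classes: TL_dist does not distinguish a.e. equal functions. *)
definition TL :: "real \<Rightarrow> 'a::euclidean_space set \<Rightarrow> (('a \<Rightarrow> real) \<times> 'a measure) set" where
  "TL q \<Omega> = {(f, \<nu>). \<nu> \<in> prob_measures_on \<Omega> \<and> integrable \<nu> (\<lambda>x. norm x powr q) \<and>
                    f \<in> borel_measurable \<nu> \<and> integrable \<nu> (\<lambda>x. \<bar>f x\<bar> powr q)}"

(* Meant for arguments in TL q \<Omega>; there the integrand is integrable for every coupling and
   the product measure is a coupling, so the Bochner integral and the infimum are proper. *)
definition TL_dist ::
    "real \<Rightarrow> ('a::euclidean_space \<Rightarrow> real) \<times> 'a measure \<Rightarrow> ('a \<Rightarrow> real) \<times> 'a measure \<Rightarrow> real"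
  where
  "TL_dist q = (\<lambda>(f, \<nu>) (g, \<kappa>). INF \<gamma>\<in>couplings \<nu> \<kappa>.
     (\<integral>(x, y). norm (x - y) powr q + \<bar>f x - g y\<bar> powr q \<partial>\<gamma>) powr (1 / q))"

definition TL_relatively_compact ::
    "real \<Rightarrow> 'a::euclidean_space set \<Rightarrow> (nat \<Rightarrow> ('a \<Rightarrow> real) \<times> 'a measure) \<Rightarrow> bool" where
  "TL_relatively_compact q \<Omega> X \<longleftrightarrow>
     (\<forall>n. X n \<in> TL q \<Omega>) \<and>
     (\<forall>r. strict_mono r \<longrightarrow>
        (\<exists>s. strict_mono (s :: nat \<Rightarrow> nat) \<and>
             (\<exists>l\<in>TL q \<Omega>. (\<lambda>k. TL_dist q (X (r (s k))) l) \<longlonglongrightarrow> 0)))"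

definition extend_by_zero :: "'a set \<Rightarrow> ('a \<Rightarrow> real) \<Rightarrow> 'a \<Rightarrow> real" where
  "extend_by_zero V u x = (if x \<in> V then u x else 0)"

end

theory Submission
  imports Defs "HOL-Complex_Analysis.Great_Picard"
begin

text \<open>
Write $d$ for the dimension, $\Lambda_n$ for the smallest weight of $\mu_n$, and
$v_n = u_n \circ T_n$ on $\Omega$. Since $T_n$ pushes $\mu$ forward to $\mu_n$, the map
$x \mapsto (T_n(x), x)$ couples $\mu_n$ with $\mu$, and the $TL^q$ distance from $(u_n,\mu_n)$ to
$(f,\mu)$ is at most $\int |T_n(x)-x|^q + |v_n(x)-f(x)|^q \, d\mu(x)$ to the power $1/q$. So
everything reduces to finding a subsequence of $(v_n)$ that converges in $L^q(\Omega)$.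

\<^bold>\<open>What the graph energy controls.\<close> Choose $R$ with $\eta \ge \eta(0)/2$ on $[0,R]$ and put
$S = R/4$, $\delta_n = R\varepsilon_n/2$. If $|x-y| \le \delta_n$ then
$|T_n(x)-T_n(y)| \le R\varepsilon_n$, so that pairs at distance at most $\delta_n$ are seen by the
kernel. With $e_n(x)$ the integral of $|v_n(x)-v_n(y)|^p$ over the $y \in \Omega$ within distance
$\delta_n$ of $x$, this gives
$\int_\Omega e_n \le A\,\delta_n^{p+d}$; dropping all terms of the graph energy but those of
one vertex also gives the pointwise bound $e_n \le A\,\delta_n^{p+d}/\Lambda_n$.

\<^bold>\<open>Compactness from averages over cones.\<close> A Lipschitz boundary yields a finite open cover of
$\Omega$ in which each piece $W$ comes with an open convex cone segment $B$ such that
$x + B \subseteq \Omega$ for $x \in W$. Let $A_s v(x)$ be a weighted average of $v$ over $x + sB$.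
The set $x+sB$ is convex, so a difference $v(y)-v(z)$ of two of its points can be
split along the segment into steps of length at most $\delta$; after integration this gives
$|A_s v - A_{s/2} v|^p(x) \le C s^{p-d} \delta^{-(p+d)} \int_{x+sB} e$
as long as $s \ge \delta/2$. This one estimate bounds both the supremum and the $L^p$ norm
of the difference, and interpolation between them bounds its $L^q$ norm by $C s^\theta$ with
$\theta = 1 - d/p + d/q$. The assumption $q < dp/(d-p)$ says exactly that $\theta > 0$, so the
dyadic differences form a geometric series and can be summed from any scale $2^{-j}$ down to
$\delta$. Below $\delta$ the energy sees nothing, and the pointwise bound on $e$ takes over:
$\|v - A_s v\|_{L^q(W)} \le C \delta \Lambda^{1/q - 1/p}$ for $s$ comparable to $\delta$, which tends
to zero by the assumption on the weights. Hence $v_n$ is close in $L^q$, uniformly for large $n$,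
to its averages at a fixed scale. Those are bounded and equi-Lipschitz, so a diagonal
subsequence makes them converge at all dyadic scales; along it $(v_n)$ is Cauchy in $L^q$.
This is nonlocal_compactness_Lq, the analytic core; its main ingredients are
nonlocal_poincare_convex, avg_scale_difference_Lq and minus_avg_Lq.
\<close>

section \<open>Power means and Jensen\<close>

lemma convex_on_abs_powr:
  fixes p :: real
  assumes "1 \<le> p"
  shows "convex_on UNIV (\<lambda>x::real. \<bar>x\<bar> powr p)"
proof -
  have scale: "(t * a) powr p \<le> t * a powr p" if "0 \<le> t" "t \<le> 1" "0 \<le> a" for t a :: real
  proof -
    have "t powr p \<le> t"
      using that assms powr_mono'[of 1 p t] by (cases "t = 0") auto
    with that show ?thesis by (simp add: powr_mult mult_right_mono)
  qed
  have half: "((1 - t) * a + t * b) powr p \<le> (1 - t) * a powr p + t * b powr p"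
    if "0 \<le> t" "t \<le> 1" "0 \<le> a" "0 \<le> b" for t a b :: real
  proof (cases "a = 0 \<or> b = 0")
    case True
    with scale[of "1 - t" a] scale[of t b] that show ?thesis by auto
  next
    case False
    with that convex_onD[OF powr_convex[OF assms], of t a b] show ?thesis by simp
  qed
  show ?thesis
  proof (rule convex_onI)
    fix t x y :: real
    assume t: "0 < t" "t < 1"
    have "\<bar>(1 - t) *\<^sub>R x + t *\<^sub>R y\<bar> \<le> (1 - t) * \<bar>x\<bar> + t * \<bar>y\<bar>"
      using t by (intro order_trans[OF abs_triangle_ineq]) (simp add: abs_mult)
    then have "\<bar>(1 - t) *\<^sub>R x + t *\<^sub>R y\<bar> powr p \<le> ((1 - t) * \<bar>x\<bar> + t * \<bar>y\<bar>) powr p"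
      using assms by (intro powr_mono2) auto
    also have "\<dots> \<le> (1 - t) * \<bar>x\<bar> powr p + t * \<bar>y\<bar> powr p"
      using t by (intro half) auto
    finally show "\<bar>(1 - t) *\<^sub>R x + t *\<^sub>R y\<bar> powr p \<le> (1 - t) * \<bar>x\<bar> powr p + t * \<bar>y\<bar> powr p" .
  qed simp
qed

lemma abs_sum_powr_le:
  fixes a :: "nat \<Rightarrow> real"
  assumes "1 \<le> p" "0 < m"
  shows "\<bar>\<Sum>i<m. a i\<bar> powr p \<le> real m powr (p - 1) * (\<Sum>i<m. \<bar>a i\<bar> powr p)"
proof -
  have "\<bar>\<Sum>i<m. (1 / real m) *\<^sub>R a i\<bar> powr p \<le> (\<Sum>i<m. (1 / real m) * \<bar>a i\<bar> powr p)"
    using assms by (intro convex_on_sum[OF _ _ convex_on_abs_powr]) auto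
  also have "(\<Sum>i<m. (1 / real m) *\<^sub>R a i) = (\<Sum>i<m. a i) / m"
    by (simp add: sum_divide_distrib[symmetric])
  finally have "\<bar>\<Sum>i<m. a i\<bar> powr p / real m powr p \<le> (\<Sum>i<m. \<bar>a i\<bar> powr p) / m"
    by (simp add: powr_divide sum_divide_distrib[symmetric])
  with assms show ?thesis
    by (simp add: powr_diff field_simps)
qed

text \<open>
Convexity of $|x|^q$ at $a/(1-l)$ and $b/l$. The weight $l$ is kept free so that a telescoping sum can
balance the loss on its two parts against the decay of its terms.
\<close>

lemma abs_add_powr_le:
  fixes a b :: real
  assumes "1 \<le> q" "0 < l" "l < 1"
  shows "\<bar>a + b\<bar> powr q \<le> (1 - l) powr (1 - q) * \<bar>a\<bar> powr q + l powr (1 - q) * \<bar>b\<bar> powr q"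
proof -
  have "\<bar>(1 - l) *\<^sub>R (a / (1 - l)) + l *\<^sub>R (b / l)\<bar> powr q
      \<le> (1 - l) * \<bar>a / (1 - l)\<bar> powr q + l * \<bar>b / l\<bar> powr q"
    using assms by (intro convex_onD[OF convex_on_abs_powr]) auto
  moreover have "(1 - l) *\<^sub>R (a / (1 - l)) + l *\<^sub>R (b / l) = a + b"
    using assms by simp
  moreover have "(1 - l) * \<bar>a / (1 - l)\<bar> powr q = (1 - l) powr (1 - q) * \<bar>a\<bar> powr q"
    "l * \<bar>b / l\<bar> powr q = l powr (1 - q) * \<bar>b\<bar> powr q"
    using assms by (auto simp: abs_divide powr_divide powr_diff)
  ultimately show ?thesis by metis
qed

lemma (in prob_space) abs_expectation_powr_le:
  fixes X :: "'a \<Rightarrow> real"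
  assumes [measurable]: "X \<in> borel_measurable M" and bd: "\<And>x. \<bar>X x\<bar> \<le> c" and p: "1 \<le> p"
  shows "ennreal (\<bar>expectation X\<bar> powr p) \<le> (\<integral>\<^sup>+ x. ennreal (\<bar>X x\<bar> powr p) \<partial>M)"
proof -
  have i1: "integrable M X"
    by (rule integrable_const_bound[where B = c]) (use bd in auto)
  have "\<bar>\<bar>X x\<bar> powr p\<bar> \<le> c powr p" for x
    using bd[of x] p by (auto intro!: powr_mono2)
  then have i2: "integrable M (\<lambda>x. \<bar>X x\<bar> powr p)"
    by (intro integrable_const_bound[where B = "c powr p"]) auto
  have "\<bar>expectation X\<bar> powr p \<le> expectation (\<lambda>x. \<bar>X x\<bar> powr p)"
    by (rule jensens_inequality[where I = UNIV]) (use i1 i2 convex_on_abs_powr[OF p] in auto)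
  then show ?thesis
    using i2 by (subst nn_integral_eq_integral) (auto intro!: ennreal_leI)
qed

section \<open>A nonlocal Poincare inequality on convex sets\<close>

lemma nn_integral_lborel_affine:
  fixes f :: "'a::euclidean_space \<Rightarrow> ennreal"
  assumes [measurable]: "f \<in> borel_measurable borel" and "0 < c"
  shows "(\<integral>\<^sup>+ x. f x \<partial>lborel) = ennreal (c ^ DIM('a)) * (\<integral>\<^sup>+ x. f (t + c *\<^sub>R x) \<partial>lborel)"
proof -
  have "(\<integral>\<^sup>+ x. f x \<partial>lborel)
      = (\<integral>\<^sup>+ x. f x \<partial>density (distr lborel borel (\<lambda>x. t + c *\<^sub>R x)) (\<lambda>_. \<bar>c\<bar> ^ DIM('a)))"
    using assms(2) lborel_affine[of c t] by simp
  also have "\<dots> = ennreal (c ^ DIM('a)) * (\<integral>\<^sup>+ x. f (t + c *\<^sub>R x) \<partial>lborel)"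
    using assms(2) by (simp add: nn_integral_density nn_integral_distr nn_integral_cmult)
  finally show ?thesis .
qed

lemma nn_integral_lborel_translate:
  fixes f :: "'a::euclidean_space \<Rightarrow> ennreal"
  assumes [measurable]: "f \<in> borel_measurable borel"
  shows "(\<integral>\<^sup>+ x. f (t + x) \<partial>lborel) = (\<integral>\<^sup>+ x. f x \<partial>lborel)"
  using nn_integral_lborel_affine[OF assms, of 1 t] by simp

text \<open>
Join $y$ and $z = y + mh$ by the points $y + ih$, which stay in $G$ by convexity. The power mean
inequality bounds $|v(y)-v(z)|^p$ by $m^{p-1}$ times the sum over the $m$ steps, and every
step contributes the same integral after translation. Passing from $z$ to $h$ costs the
Jacobian $m^d$, for a total of $m^d \cdot m^{p-1} \cdot m$.
\<close>

lemma nonlocal_poincare_convex: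
  fixes G :: "'a::euclidean_space set" and v :: "'a \<Rightarrow> real"
  assumes "convex G" and [measurable]: "G \<in> sets borel" "v \<in> borel_measurable borel"
    and p: "1 \<le> p" and m: "0 < m" and diam: "\<And>y z. y \<in> G \<Longrightarrow> z \<in> G \<Longrightarrow> norm (y - z) \<le> real m * \<delta>"
  shows "(\<integral>\<^sup>+ y. \<integral>\<^sup>+ z. ennreal (\<bar>v y - v z\<bar> powr p) * indicator G y * indicator G z \<partial>lborel \<partial>lborel)
    \<le> ennreal (real m powr (p + DIM('a))) *
      (\<integral>\<^sup>+ y. \<integral>\<^sup>+ z. ennreal (\<bar>v y - v z\<bar> powr p) * indicator {0..\<delta>} (norm (y - z)) *
                   indicator G y * indicator G z \<partial>lborel \<partial>lborel)"
proof -
  define F where "F y z = ennreal (\<bar>v y - v z\<bar> powr p) * indicator G y * indicator G z" for y z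
  define K where "K y z = ennreal (\<bar>v y - v z\<bar> powr p) * indicator {0..\<delta>} (norm (y - z)) *
                   indicator G y * indicator G z" for y z
  have [measurable]: "case_prod F \<in> borel_measurable (borel \<Otimes>\<^sub>M borel)"
    "case_prod K \<in> borel_measurable (borel \<Otimes>\<^sub>M borel)"
    unfolding F_def K_def by measurable
  define k where "k = ennreal (real m powr (p - 1))"
  have pt: "F y (y + real m *\<^sub>R h) \<le> (\<Sum>i<m. k * K (y + real i *\<^sub>R h) (y + real (Suc i) *\<^sub>R h))" for y h
  proof (cases "y \<in> G \<and> y + real m *\<^sub>R h \<in> G")
    case True
    have inG: "y + real i *\<^sub>R h \<in> G" if "i \<le> m" for i
    proof -
      have "(1 - real i / real m) *\<^sub>R y + (real i / real m) *\<^sub>R (y + real m *\<^sub>R h) \<in> G"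
        using that m True by (intro convexD_alt[OF \<open>convex G\<close>]) auto
      moreover have "(1 - real i / real m) *\<^sub>R y + (real i / real m) *\<^sub>R (y + real m *\<^sub>R h) = y + real i *\<^sub>R h"
        using m by (simp add: algebra_simps)
      ultimately show ?thesis by simp
    qed
    have "real m * norm h \<le> real m * \<delta>"
      using diam[of "y + real m *\<^sub>R h" y] True by simp
    then have h: "norm h \<le> \<delta>" using m by simp
    have "\<bar>v (y + real m *\<^sub>R h) - v (y + real 0 *\<^sub>R h)\<bar> powr p
      = \<bar>\<Sum>i<m. v (y + real (Suc i) *\<^sub>R h) - v (y + real i *\<^sub>R h)\<bar> powr p"
      by (subst sum_lessThan_telescope) simp
    also have "\<dots> \<le> real m powr (p - 1) *
        (\<Sum>i<m. \<bar>v (y + real (Suc i) *\<^sub>R h) - v (y + real i *\<^sub>R h)\<bar> powr p)"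
      by (rule abs_sum_powr_le[OF p m])
    finally have "ennreal (\<bar>v y - v (y + real m *\<^sub>R h)\<bar> powr p) \<le> ennreal (real m powr (p - 1) *
        (\<Sum>i<m. \<bar>v (y + real i *\<^sub>R h) - v (y + real (Suc i) *\<^sub>R h)\<bar> powr p))"
      by (intro ennreal_leI) (simp add: abs_minus_commute)
    also have "\<dots> = (\<Sum>i<m. k * ennreal (\<bar>v (y + real i *\<^sub>R h) - v (y + real (Suc i) *\<^sub>R h)\<bar> powr p))"
      by (simp add: k_def ennreal_mult' sum_distrib_left[symmetric] sum_ennreal sum_nonneg)
    also have "\<dots> = (\<Sum>i<m. k * K (y + real i *\<^sub>R h) (y + real (Suc i) *\<^sub>R h))"
    proof (intro sum.cong refl arg_cong[where f = "(*) k"])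
      fix i assume "i \<in> {..<m}"
      then have "y + real i *\<^sub>R h \<in> G" "y + real (Suc i) *\<^sub>R h \<in> G"
        using inG[of i] inG[of "Suc i"] by auto
      moreover have "norm ((y + real i *\<^sub>R h) - (y + real (Suc i) *\<^sub>R h)) = norm h"
        by (simp add: algebra_simps)
      ultimately show "ennreal (\<bar>v (y + real i *\<^sub>R h) - v (y + real (Suc i) *\<^sub>R h)\<bar> powr p)
          = K (y + real i *\<^sub>R h) (y + real (Suc i) *\<^sub>R h)"
        using h unfolding K_def by simp
    qed
    finally show ?thesis using True by (simp add: F_def)
  qed (auto simp: F_def)
  have shift: "(\<integral>\<^sup>+ y. \<integral>\<^sup>+ h. K (y + real i *\<^sub>R h) (y + real (Suc i) *\<^sub>R h) \<partial>lborel \<partial>lborel)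
      = (\<integral>\<^sup>+ y. \<integral>\<^sup>+ z. K y z \<partial>lborel \<partial>lborel)" for i
  proof -
    have "(\<integral>\<^sup>+ y. \<integral>\<^sup>+ h. K (y + real i *\<^sub>R h) (y + real (Suc i) *\<^sub>R h) \<partial>lborel \<partial>lborel)
      = (\<integral>\<^sup>+ h. \<integral>\<^sup>+ y. K (y + real i *\<^sub>R h) (y + real (Suc i) *\<^sub>R h) \<partial>lborel \<partial>lborel)"
      by (rule lborel_pair.Fubini') measurable
    also have "\<dots> = (\<integral>\<^sup>+ h. \<integral>\<^sup>+ y. K y (y + h) \<partial>lborel \<partial>lborel)"
    proof (rule nn_integral_cong)
      fix h :: 'a
      show "(\<integral>\<^sup>+ y. K (y + real i *\<^sub>R h) (y + real (Suc i) *\<^sub>R h) \<partial>lborel) = (\<integral>\<^sup>+ y. K y (y + h) \<partial>lborel)"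
        by (subst (2) nn_integral_lborel_translate[symmetric, where t = "real i *\<^sub>R h"])
           (auto simp: algebra_simps)
    qed
    also have "\<dots> = (\<integral>\<^sup>+ y. \<integral>\<^sup>+ h. K y (y + h) \<partial>lborel \<partial>lborel)"
      by (rule lborel_pair.Fubini') measurable
    also have "\<dots> = (\<integral>\<^sup>+ y. \<integral>\<^sup>+ z. K y z \<partial>lborel \<partial>lborel)"
      by (rule nn_integral_cong, rule nn_integral_lborel_translate) measurable
    finally show ?thesis .
  qed
  have "(\<integral>\<^sup>+ y. \<integral>\<^sup>+ z. F y z \<partial>lborel \<partial>lborel)
      = (\<integral>\<^sup>+ y. ennreal (real m ^ DIM('a)) * (\<integral>\<^sup>+ h. F y (y + real m *\<^sub>R h) \<partial>lborel) \<partial>lborel)"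
    using m by (intro nn_integral_cong nn_integral_lborel_affine) auto
  also have "\<dots> \<le> (\<integral>\<^sup>+ y. ennreal (real m ^ DIM('a)) *
      (\<integral>\<^sup>+ h. (\<Sum>i<m. k * K (y + real i *\<^sub>R h) (y + real (Suc i) *\<^sub>R h)) \<partial>lborel) \<partial>lborel)"
    by (intro nn_integral_mono mult_left_mono pt) auto
  also have "\<dots> = ennreal (real m ^ DIM('a)) * (\<Sum>i<m. k *
      (\<integral>\<^sup>+ y. \<integral>\<^sup>+ h. K (y + real i *\<^sub>R h) (y + real (Suc i) *\<^sub>R h) \<partial>lborel \<partial>lborel))"
    by (simp add: nn_integral_cmult nn_integral_sum del: of_nat_Suc)
  also have "\<dots> = ennreal (real m ^ DIM('a)) * (real m * k) * (\<integral>\<^sup>+ y. \<integral>\<^sup>+ z. K y z \<partial>lborel \<partial>lborel)"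
    by (subst shift) (simp add: mult.assoc ennreal_of_nat_eq_real_of_nat)
  also have "ennreal (real m ^ DIM('a)) * (real m * k) = ennreal (real m powr (p + DIM('a)))"
    using m unfolding k_def
    by (simp add: ennreal_mult'[symmetric] powr_add powr_diff powr_realpow mult.commute)
  finally show ?thesis by (simp add: F_def K_def)
qed

section \<open>Averages over cones\<close>

text \<open>
Interpolation between a supremum and an $L^p$ bound: $f^q = (f^p)^{(q-p)/p} f^p$.
\<close>

lemma nn_integral_powr_interpolate:
  fixes f :: "'a \<Rightarrow> real"
  assumes [measurable]: "f \<in> borel_measurable M" "W \<in> sets M"
    and pq: "0 < p" "p \<le> q" and f: "\<And>x. 0 \<le> f x"
    and K: "\<And>x. x \<in> W \<Longrightarrow> f x powr p \<le> K"
    and J: "(\<integral>\<^sup>+ x. ennreal (f x powr p) * indicator W x \<partial>M) \<le> ennreal J" "0 \<le> J"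
  shows "(\<integral>\<^sup>+ x. ennreal (f x powr q) * indicator W x \<partial>M) \<le> ennreal (K powr ((q - p) / p) * J)"
proof -
  have "f x powr q \<le> K powr ((q - p) / p) * f x powr p" if "x \<in> W" for x
  proof -
    have "f x powr q = (f x powr p) powr ((q - p) / p) * f x powr p"
      using pq by (simp add: powr_powr powr_add[symmetric])
    also have "\<dots> \<le> K powr ((q - p) / p) * f x powr p"
      using K[OF that] pq by (intro mult_right_mono powr_mono2) auto
    finally show ?thesis .
  qed
  then have "(\<integral>\<^sup>+ x. ennreal (f x powr q) * indicator W x \<partial>M)
      \<le> (\<integral>\<^sup>+ x. ennreal (K powr ((q - p) / p)) * (ennreal (f x powr p) * indicator W x) \<partial>M)"
    by (intro nn_integral_mono) (auto simp: indicator_def ennreal_mult'[symmetric] intro!: ennreal_leI)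
  also have "\<dots> = ennreal (K powr ((q - p) / p)) * (\<integral>\<^sup>+ x. ennreal (f x powr p) * indicator W x \<partial>M)"
    by (rule nn_integral_cmult) measurable
  also have "\<dots> \<le> ennreal (K powr ((q - p) / p)) * ennreal J"
    by (intro mult_left_mono J) auto
  finally show ?thesis using J by (simp add: ennreal_mult')
qed

text \<open>
Integrated over $\Omega$ and divided by $\delta^{p+d}$, this is the usual nonlocal Dirichlet
energy at range $\delta$. It is left unnormalised and kept as a function of $x$ because both its
integral and its supremum are used.
\<close>

definition local_energy ::
    "real \<Rightarrow> real \<Rightarrow> 'a::euclidean_space set \<Rightarrow> ('a \<Rightarrow> real) \<Rightarrow> 'a \<Rightarrow> ennreal" where
  "local_energy p \<delta> \<Omega> v x =
     (\<integral>\<^sup>+ y. ennreal (\<bar>v x - v y\<bar> powr p) * indicator {0..\<delta>} (norm (x - y)) * indicator \<Omega> y \<partial>lborel)"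

lemma borel_measurable_local_energy [measurable]:
  fixes v :: "'a::euclidean_space \<Rightarrow> real"
  assumes [measurable]: "v \<in> borel_measurable borel" "\<Omega> \<in> sets borel"
  shows "local_energy p \<delta> \<Omega> v \<in> borel_measurable borel"
  unfolding local_energy_def by measurable

text \<open>
A probability density on a convex set whose dilates by smaller factors are nested. The density is
taken Lipschitz so that averages of functions that are only bounded in $L^1$ are equi-Lipschitz;
with the normalised indicator of $B$ they need not even be equicontinuous.
\<close>

locale cone_kernel =
  fixes B :: "'a::euclidean_space set" and \<phi> :: "'a \<Rightarrow> real" and C L :: real
  assumes open_B: "open B" and convex_B: "convex B" and B_ball: "B \<subseteq> ball 0 1"
    and star_B: "\<And>t b. 0 < t \<Longrightarrow> t \<le> 1 \<Longrightarrow> b \<in> B \<Longrightarrow> t *\<^sub>R b \<in> B"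
    and \<phi>_nonneg: "\<And>b. 0 \<le> \<phi> b" and \<phi>_le: "\<And>b. \<phi> b \<le> C * indicator B b"
    and \<phi>_lipschitz: "L-lipschitz_on UNIV \<phi>"
    and \<phi>_integral: "(\<integral>\<^sup>+ b. ennreal (\<phi> b) \<partial>lborel) = 1"
    and C_nonneg: "0 \<le> C"
begin

definition M :: "'a measure" where "M = density lborel (\<lambda>b. ennreal (\<phi> b))"

definition avg :: "('a \<Rightarrow> real) \<Rightarrow> real \<Rightarrow> 'a \<Rightarrow> real" where
  "avg v s x = (\<integral>b. v (x + s *\<^sub>R b) \<partial>M)"

definition piece :: "'a \<Rightarrow> real \<Rightarrow> 'a set" where
  "piece x s = {y. (1 / s) *\<^sub>R (y - x) \<in> B}"

lemma measurable_B [measurable]: "B \<in> sets borel"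
  using open_B by auto

lemma measurable_\<phi> [measurable]: "\<phi> \<in> borel_measurable borel"
  using lipschitz_on_continuous_on[OF \<phi>_lipschitz] by (rule borel_measurable_continuous_onI)

lemma sets_M [measurable_cong, simp]: "sets M = sets borel"
  by (simp add: M_def)

lemma space_M [simp]: "space M = UNIV"
  by (simp add: M_def)

sublocale M: prob_space M
  by (rule prob_spaceI) (simp add: M_def emeasure_density \<phi>_integral)

lemma nn_integral_M_le:
  assumes [measurable]: "f \<in> borel_measurable borel"
  shows "(\<integral>\<^sup>+ b. f b \<partial>M) \<le> ennreal C * (\<integral>\<^sup>+ b. f b * indicator B b \<partial>lborel)"
proof -
  have "(\<integral>\<^sup>+ b. f b \<partial>M) = (\<integral>\<^sup>+ b. ennreal (\<phi> b) * f b \<partial>lborel)"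
    by (simp add: M_def nn_integral_density)
  also have "\<dots> \<le> (\<integral>\<^sup>+ b. ennreal C * (f b * indicator B b) \<partial>lborel)"
  proof (rule nn_integral_mono)
    fix b
    have "ennreal (\<phi> b) \<le> ennreal C * indicator B b"
      using ennreal_leI[OF \<phi>_le[of b]] by (cases "b \<in> B") auto
    then show "ennreal (\<phi> b) * f b \<le> ennreal C * (f b * indicator B b)"
      by (metis mult.assoc mult.commute mult_right_mono zero_le)
  qed
  finally show ?thesis by (simp add: nn_integral_cmult)
qed

lemma measurable_piece [measurable]: "Measurable.pred (borel \<Otimes>\<^sub>M borel) (\<lambda>(x, y). y \<in> piece x s)"
  unfolding piece_def by simp

lemma measurable_piece_set [measurable]: "piece x s \<in> sets borel"
  unfolding piece_def by simp

lemma convex_piece: "convex (piece x s)"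
proof (rule convexI)
  fix y z and a b :: real
  assume yz: "y \<in> piece x s" "z \<in> piece x s" and ab: "0 \<le> a" "0 \<le> b" "a + b = 1"
  have "a *\<^sub>R ((1 / s) *\<^sub>R (y - x)) + b *\<^sub>R ((1 / s) *\<^sub>R (z - x)) \<in> B"
    using yz ab by (intro convexD[OF convex_B]) (auto simp: piece_def)
  also have "a *\<^sub>R ((1 / s) *\<^sub>R (y - x)) + b *\<^sub>R ((1 / s) *\<^sub>R (z - x))
      = (1 / s) *\<^sub>R (a *\<^sub>R y + b *\<^sub>R z - (a + b) *\<^sub>R x)"
    by (simp add: algebra_simps)
  finally show "a *\<^sub>R y + b *\<^sub>R z \<in> piece x s"
    using ab by (simp add: piece_def)
qed

lemma piece_subset_ball: "0 < s \<Longrightarrow> piece x s \<subseteq> ball x s"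
  using B_ball by (fastforce simp: piece_def dist_norm norm_minus_commute divide_simps)

lemma piece_mono:
  assumes "0 < t" "t \<le> s"
  shows "piece x t \<subseteq> piece x s"
proof
  fix y assume "y \<in> piece x t"
  then have "(t / s) *\<^sub>R ((1 / t) *\<^sub>R (y - x)) \<in> B"
    using assms by (auto simp: piece_def simp del: scaleR_scaleR intro!: star_B[of "t / s"])
  moreover have "(t / s) *\<^sub>R ((1 / t) *\<^sub>R (y - x)) = (1 / s) *\<^sub>R (y - x)"
    using assms by simp
  ultimately show "y \<in> piece x s" unfolding piece_def by (metis mem_Collect_eq)
qed

lemma nn_integral_piece_centres_le:
  assumes "0 < s"
  shows "(\<integral>\<^sup>+ x. indicator (piece x s) y \<partial>lborel)
      \<le> ennreal (s ^ DIM('a) * measure lborel (ball (0::'a) 1))"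
proof -
  have "(\<integral>\<^sup>+ x. indicator (piece x s) y \<partial>lborel)
      = ennreal (s ^ DIM('a)) * (\<integral>\<^sup>+ x. indicator (piece (y + s *\<^sub>R x) s) y \<partial>lborel)"
    by (rule nn_integral_lborel_affine) (use assms in measurable)
  also have "\<dots> \<le> ennreal (s ^ DIM('a)) * (\<integral>\<^sup>+ x. indicator (ball 0 1) (x::'a) \<partial>lborel)"
    using B_ball assms
    by (intro mult_left_mono nn_integral_mono) (auto simp: piece_def indicator_def)
  also have "\<dots> = ennreal (s ^ DIM('a)) * ennreal (measure lborel (ball (0::'a) 1))"
    using emeasure_lborel_ball_finite[of "0::'a" 1] by (simp add: emeasure_eq_ennreal_measure)
  finally show ?thesis using assms by (simp add: ennreal_mult')
qed

lemma measurable_avg [measurable]: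
  assumes [measurable]: "v \<in> borel_measurable borel"
  shows "avg v s \<in> borel_measurable borel"
  unfolding avg_def by measurable

text \<open>
Jensen's inequality, followed by the substitution $y = x + sb$. The constant $c$ is arbitrary so
that the bound can be used with $c = v(x)$ and also twice in succession, with the average at another
scale in place of $c$.
\<close>

lemma abs_minus_avg_powr_le:
  assumes [measurable]: "v \<in> borel_measurable borel" and bd: "\<And>y. \<bar>v y\<bar> \<le> m"
    and p: "1 \<le> p" and s: "0 < s"
  shows "ennreal (\<bar>c - avg v s x\<bar> powr p)
    \<le> ennreal (C / s ^ DIM('a)) * (\<integral>\<^sup>+ y. ennreal (\<bar>c - v y\<bar> powr p) * indicator (piece x s) y \<partial>lborel)"
proof -
  have "integrable M (\<lambda>b. v (x + s *\<^sub>R b))"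
    by (rule M.integrable_const_bound[where B = m]) (use bd in auto)
  then have "c - avg v s x = (\<integral>b. c - v (x + s *\<^sub>R b) \<partial>M)"
    using M.prob_space by (simp add: avg_def)
  moreover have "\<bar>c - v y\<bar> \<le> \<bar>c\<bar> + m" for y
    using bd[of y] by linarith
  ultimately have "ennreal (\<bar>c - avg v s x\<bar> powr p)
      \<le> (\<integral>\<^sup>+ b. ennreal (\<bar>c - v (x + s *\<^sub>R b)\<bar> powr p) \<partial>M)"
    using p by (simp only:) (rule M.abs_expectation_powr_le, auto)
  also have "\<dots> \<le> ennreal C * (\<integral>\<^sup>+ b. ennreal (\<bar>c - v (x + s *\<^sub>R b)\<bar> powr p) * indicator B b \<partial>lborel)"
    by (rule nn_integral_M_le) measurable
  also have "\<dots> = ennreal (C / s ^ DIM('a)) * (ennreal (s ^ DIM('a)) *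
      (\<integral>\<^sup>+ b. ennreal (\<bar>c - v (x + s *\<^sub>R b)\<bar> powr p) * indicator B b \<partial>lborel))"
    using s C_nonneg by (simp add: ennreal_mult'[symmetric] mult.assoc[symmetric])
  also have "\<dots> = ennreal (C / s ^ DIM('a)) *
      (\<integral>\<^sup>+ y. ennreal (\<bar>c - v y\<bar> powr p) * indicator (piece x s) y \<partial>lborel)"
  proof -
    have "(\<integral>\<^sup>+ y. ennreal (\<bar>c - v y\<bar> powr p) * indicator (piece x s) y \<partial>lborel) = ennreal (s ^ DIM('a)) *
      (\<integral>\<^sup>+ b. ennreal (\<bar>c - v (x + s *\<^sub>R b)\<bar> powr p) * indicator (piece x s) (x + s *\<^sub>R b) \<partial>lborel)"
      by (rule nn_integral_lborel_affine) (use s in measurable)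
    moreover have "indicator (piece x s) (x + s *\<^sub>R b) = (indicator B b :: ennreal)" for b
      using s by (simp add: piece_def indicator_def)
    ultimately show ?thesis by simp
  qed
  finally show ?thesis .
qed

text \<open>
Both averages live on the convex set $x + sB$, which contains $x + (s/2)B$. Two applications of Jensen's
inequality bound the left-hand side by a double average of $|v(y)-v(z)|^p$ over this set, at
the price of a factor $s^{-2d}$, and the Poincare inequality with about $2s/\delta$ steps turns
it into the local energy.
\<close>

lemma avg_scale_difference_pointwise:
  assumes [measurable]: "v \<in> borel_measurable borel" "\<Omega> \<in> sets borel" and bd: "\<And>y. \<bar>v y\<bar> \<le> m"
    and p: "1 \<le> p" and s: "0 < s" "0 < \<delta>" "\<delta> \<le> 2 * s" and \<Omega>: "piece x s \<subseteq> \<Omega>"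
  shows "ennreal (\<bar>avg v s x - avg v (s / 2) x\<bar> powr p)
    \<le> ennreal (C\<^sup>2 * 2 ^ DIM('a) * 4 powr (p + DIM('a)) * s powr (p - DIM('a)) / \<delta> powr (p + DIM('a))) *
      (\<integral>\<^sup>+ y. local_energy p \<delta> \<Omega> v y * indicator (piece x s) y \<partial>lborel)"
proof -
  define n where "n = nat \<lceil>2 * s / \<delta>\<rceil>"
  have n: "0 < n" "2 * s / \<delta> \<le> n" "n \<le> 4 * s / \<delta>"
  proof -
    \<comment> \<open>rounding up at most doubles a number that is at least one\<close>
    have "1 \<le> 2 * s / \<delta>" using s by simp
    then show "0 < n" "2 * s / \<delta> \<le> n" "n \<le> 4 * s / \<delta>"
      unfolding n_def by linarith+
  qed
  let ?d = "DIM('a)" and ?G = "piece x s"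
  have sub: "piece x (s / 2) \<subseteq> ?G" using s by (intro piece_mono) auto
  have "ennreal (\<bar>avg v s x - avg v (s / 2) x\<bar> powr p)
      = ennreal (\<bar>avg v (s / 2) x - avg v s x\<bar> powr p)"
    by (simp add: abs_minus_commute)
  also have "\<dots> \<le> ennreal (C / s ^ ?d) *
      (\<integral>\<^sup>+ y. ennreal (\<bar>avg v (s / 2) x - v y\<bar> powr p) * indicator ?G y \<partial>lborel)"
    using bd p s by (intro abs_minus_avg_powr_le) auto
  also have "\<dots> \<le> ennreal (C / s ^ ?d) * (\<integral>\<^sup>+ y. ennreal (C / (s / 2) ^ ?d) *
      (\<integral>\<^sup>+ z. ennreal (\<bar>v y - v z\<bar> powr p) * indicator ?G y * indicator ?G z \<partial>lborel) \<partial>lborel)"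
  proof (intro mult_left_mono nn_integral_mono)
    fix y
    have "ennreal (\<bar>v y - avg v (s / 2) x\<bar> powr p) \<le> ennreal (C / (s / 2) ^ ?d) *
        (\<integral>\<^sup>+ z. ennreal (\<bar>v y - v z\<bar> powr p) * indicator (piece x (s / 2)) z \<partial>lborel)"
      using bd p s by (intro abs_minus_avg_powr_le) auto
    also have "\<dots> \<le> ennreal (C / (s / 2) ^ ?d) *
        (\<integral>\<^sup>+ z. ennreal (\<bar>v y - v z\<bar> powr p) * indicator ?G z \<partial>lborel)"
      using sub by (intro mult_left_mono nn_integral_mono) (auto simp: indicator_def)
    finally show "ennreal (\<bar>avg v (s / 2) x - v y\<bar> powr p) * indicator ?G y \<le> ennreal (C / (s / 2) ^ ?d) *
        (\<integral>\<^sup>+ z. ennreal (\<bar>v y - v z\<bar> powr p) * indicator ?G y * indicator ?G z \<partial>lborel)"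
      by (cases "y \<in> ?G") (auto simp: abs_minus_commute)
  qed auto
  also have "\<dots> = ennreal (C / s ^ ?d * (C / (s / 2) ^ ?d)) *
      (\<integral>\<^sup>+ y. \<integral>\<^sup>+ z. ennreal (\<bar>v y - v z\<bar> powr p) * indicator ?G y * indicator ?G z \<partial>lborel \<partial>lborel)"
    using C_nonneg s by (subst nn_integral_cmult, measurable) (subst ennreal_mult, auto simp only: mult.assoc, auto)
  also have "\<dots> \<le> ennreal (C / s ^ ?d * (C / (s / 2) ^ ?d)) * (ennreal (real n powr (p + ?d)) *
      (\<integral>\<^sup>+ y. \<integral>\<^sup>+ z. ennreal (\<bar>v y - v z\<bar> powr p) * indicator {0..\<delta>} (norm (y - z)) *
                   indicator ?G y * indicator ?G z \<partial>lborel \<partial>lborel))"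
  proof (intro mult_left_mono nonlocal_poincare_convex convex_piece p n)
    fix y z assume "y \<in> ?G" "z \<in> ?G"
    then have "norm (y - x) < s" "norm (z - x) < s"
      using piece_subset_ball[of s x] s by (auto simp: dist_norm norm_minus_commute)
    then have "norm (y - z) \<le> 2 * s"
      using norm_triangle_ineq4[of "y - x" "z - x"] by simp
    also have "2 * s \<le> real n * \<delta>" using n s by (simp add: field_simps)
    finally show "norm (y - z) \<le> real n * \<delta>" .
  qed auto
  also have "\<dots> \<le> ennreal (C / s ^ ?d * (C / (s / 2) ^ ?d)) * (ennreal ((4 * s / \<delta>) powr (p + ?d)) *
      (\<integral>\<^sup>+ y. local_energy p \<delta> \<Omega> v y * indicator ?G y \<partial>lborel))"
  proof (intro mult_left_mono mult_mono nn_integral_mono ennreal_leI powr_mono2)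
    fix y
    show "(\<integral>\<^sup>+ z. ennreal (\<bar>v y - v z\<bar> powr p) * indicator {0..\<delta>} (norm (y - z)) *
                   indicator ?G y * indicator ?G z \<partial>lborel) \<le> local_energy p \<delta> \<Omega> v y * indicator ?G y"
    proof (cases "y \<in> ?G")
      case True
      have "ennreal (\<bar>v y - v z\<bar> powr p) * indicator {0..\<delta>} (norm (y - z)) * indicator ?G z
          \<le> ennreal (\<bar>v y - v z\<bar> powr p) * indicator {0..\<delta>} (norm (y - z)) * indicator \<Omega> z" for z
        using \<Omega> by (intro mult_left_mono) (auto simp: indicator_def)
      then show ?thesis
        using True by (simp add: local_energy_def nn_integral_mono)
    qed simp
  qed (use n p in auto)
  also have "\<dots> = ennreal (C / s ^ ?d * (C / (s / 2) ^ ?d) * (4 * s / \<delta>) powr (p + ?d)) *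
      (\<integral>\<^sup>+ y. local_energy p \<delta> \<Omega> v y * indicator ?G y \<partial>lborel)"
    using C_nonneg s by (subst ennreal_mult) (auto simp only: mult.assoc, auto)
  also have "C / s ^ ?d * (C / (s / 2) ^ ?d) * (4 * s / \<delta>) powr (p + ?d)
      = C\<^sup>2 * 2 ^ ?d * 4 powr (p + ?d) * s powr (p - ?d) / \<delta> powr (p + ?d)"
    using s by (simp add: powr_divide powr_mult powr_add powr_diff powr_realpow power_divide power2_eq_square)
  finally show ?thesis .
qed

end

lemma nn_integral_abs_diff_powr_triangle:
  fixes f g h :: "'a \<Rightarrow> real"
  assumes [measurable]: "f \<in> borel_measurable N" "g \<in> borel_measurable N" "h \<in> borel_measurable N"
      "W \<in> sets N"
    and q: "1 \<le> q" and l: "0 < l" "l < 1"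
  shows "(\<integral>\<^sup>+ x. ennreal (\<bar>f x - h x\<bar> powr q) * indicator W x \<partial>N)
    \<le> ennreal ((1 - l) powr (1 - q)) * (\<integral>\<^sup>+ x. ennreal (\<bar>f x - g x\<bar> powr q) * indicator W x \<partial>N)
      + ennreal (l powr (1 - q)) * (\<integral>\<^sup>+ x. ennreal (\<bar>g x - h x\<bar> powr q) * indicator W x \<partial>N)"
proof -
  have "(\<integral>\<^sup>+ x. ennreal (\<bar>f x - h x\<bar> powr q) * indicator W x \<partial>N)
    \<le> (\<integral>\<^sup>+ x. ennreal ((1 - l) powr (1 - q)) * (ennreal (\<bar>f x - g x\<bar> powr q) * indicator W x)
      + ennreal (l powr (1 - q)) * (ennreal (\<bar>g x - h x\<bar> powr q) * indicator W x) \<partial>N)"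
  proof (rule nn_integral_mono)
    fix x
    have "\<bar>f x - h x\<bar> powr q
        \<le> (1 - l) powr (1 - q) * \<bar>f x - g x\<bar> powr q + l powr (1 - q) * \<bar>g x - h x\<bar> powr q"
      using abs_add_powr_le[OF q l, of "f x - g x" "g x - h x"] by simp
    then show "ennreal (\<bar>f x - h x\<bar> powr q) * indicator W x
      \<le> ennreal ((1 - l) powr (1 - q)) * (ennreal (\<bar>f x - g x\<bar> powr q) * indicator W x)
      + ennreal (l powr (1 - q)) * (ennreal (\<bar>g x - h x\<bar> powr q) * indicator W x)"
      by (cases "x \<in> W")
         (auto simp: ennreal_mult'[symmetric] ennreal_plus[symmetric] intro!: ennreal_leI simp del: ennreal_plus)
  qed
  then show ?thesis
    by (subst (asm) nn_integral_add, measurable) (simp add: nn_integral_cmult)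
qed

text \<open>
Backward induction on $j$, splitting off one difference at a time with the weight $l$ equal
to the rate at which the $L^q$ norms of the differences decay. The step then reads $(1-l) + l = 1$: the factor $l^{1-q}$ lost
on the tail is beaten by the factor $l^q$ gained from the smaller scale.
\<close>

lemma geometric_telescope_Lq:
  fixes f :: "nat \<Rightarrow> 'a \<Rightarrow> real"
  assumes [measurable]: "\<And>i. f i \<in> borel_measurable N" "W \<in> sets N"
    and q: "1 \<le> q" and l: "0 < l" "l < 1" and c: "0 \<le> c"
    and step: "\<And>i. i < J \<Longrightarrow>
      (\<integral>\<^sup>+ x. ennreal (\<bar>f i x - f (Suc i) x\<bar> powr q) * indicator W x \<partial>N) \<le> ennreal (c * l powr (q * i))"
    and "j \<le> J"
  shows "(\<integral>\<^sup>+ x. ennreal (\<bar>f j x - f J x\<bar> powr q) * indicator W x \<partial>N)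
    \<le> ennreal (c * (1 - l) powr (- q) * l powr (q * j))"
  using \<open>j \<le> J\<close>
proof (induction rule: inc_induct)
  case base
  show ?case by simp
next
  case (step j)
  have "(\<integral>\<^sup>+ x. ennreal (\<bar>f j x - f J x\<bar> powr q) * indicator W x \<partial>N)
    \<le> ennreal ((1 - l) powr (1 - q)) * (\<integral>\<^sup>+ x. ennreal (\<bar>f j x - f (Suc j) x\<bar> powr q) * indicator W x \<partial>N)
      + ennreal (l powr (1 - q)) * (\<integral>\<^sup>+ x. ennreal (\<bar>f (Suc j) x - f J x\<bar> powr q) * indicator W x \<partial>N)"
    using q l by (intro nn_integral_abs_diff_powr_triangle) auto
  also have "\<dots> \<le> ennreal ((1 - l) powr (1 - q)) * ennreal (c * l powr (q * j))
      + ennreal (l powr (1 - q)) * ennreal (c * (1 - l) powr (- q) * l powr (q * Suc j))"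
    using step assms(7)[of j] by (intro add_mono mult_left_mono) auto
  also have "\<dots> = ennreal ((1 - l) powr (1 - q) * (c * l powr (q * j))
      + l powr (1 - q) * (c * (1 - l) powr (- q) * l powr (q * Suc j)))"
    using c by (simp add: ennreal_mult)
  also have "(1 - l) powr (1 - q) * (c * l powr (q * j))
      + l powr (1 - q) * (c * (1 - l) powr (- q) * l powr (q * Suc j))
      = c * (1 - l) powr (- q) * l powr (q * j)"
  proof -
    have "(1 - l) powr (1 - q) = (1 - l) * (1 - l) powr (- q)"
      using l by (simp add: powr_diff powr_minus divide_inverse)
    moreover have "l powr (1 - q) * l powr (q * Suc j) = l * l powr (q * j)"
    proof -
      have "l powr (1 - q) * l powr (q * Suc j) = l powr (1 + q * j)"
        by (simp add: powr_add[symmetric] algebra_simps)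
      then show ?thesis using l by (simp add: powr_add)
    qed
    ultimately have "(1 - l) powr (1 - q) * (c * l powr (q * j))
        + l powr (1 - q) * (c * (1 - l) powr (- q) * l powr (q * Suc j))
      = (1 - l) * (1 - l) powr (- q) * (c * l powr (q * j)) + c * (1 - l) powr (- q) * (l * l powr (q * j))"
      by (simp only: mult.assoc mult.left_commute[of c] mult.left_commute[of "l powr (1 - q)"])
    then show ?thesis
      by (simp add: algebra_simps)
  qed
  finally show ?case .
qed

context cone_kernel
begin

text \<open>
The pointwise bound is used twice. Enlarging $x + sB$ to $\Omega$ gives a supremum bound of order
$s^{p-d}$; integrating over $x$ and exchanging the integrals, where each $y$ lies in $x + sB$ only for a
set of $x$ of measure at most of order $s^d$, gives an $L^p$ bound of order $s^p$. Interpolation yields the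
exponent $(p-d)(q-p)/p + p = q(1 - d/p + d/q)$.
\<close>

lemma avg_scale_difference_Lq:
  fixes p q :: real
  assumes [measurable]: "v \<in> borel_measurable borel" "\<Omega> \<in> sets borel" "W \<in> sets borel"
    and bd: "\<And>y. \<bar>v y\<bar> \<le> m"
    and p: "1 \<le> p" "p \<le> q" and s: "0 < s" "0 < \<delta>" "\<delta> \<le> 2 * s" and "0 \<le> A"
    and W: "\<And>x. x \<in> W \<Longrightarrow> piece x s \<subseteq> \<Omega>"
    and energy: "(\<integral>\<^sup>+ y. local_energy p \<delta> \<Omega> v y * indicator \<Omega> y \<partial>lborel) \<le> ennreal (A * \<delta> powr (p + DIM('a)))"
  defines "K \<equiv> C\<^sup>2 * 2 ^ DIM('a) * 4 powr (p + DIM('a)) * A"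
  shows "(\<integral>\<^sup>+ x. ennreal (\<bar>avg v s x - avg v (s / 2) x\<bar> powr q) * indicator W x \<partial>lborel)
    \<le> ennreal (K powr ((q - p) / p) * (K * measure lborel (ball (0::'a) 1)) *
        s powr (q * (1 - DIM('a) / p + DIM('a) / q)))"
proof -
  let ?d = "real DIM('a)" and ?e = "local_energy p \<delta> \<Omega> v" and ?\<beta> = "measure lborel (ball (0::'a) 1)"
  define c where "c = C\<^sup>2 * 2 ^ DIM('a) * 4 powr (p + ?d) * s powr (p - ?d) / \<delta> powr (p + ?d)"
  have c0: "0 \<le> c" unfolding c_def by simp
  have cA: "c * (A * \<delta> powr (p + ?d)) = K * s powr (p - ?d)"
    using s by (simp add: c_def K_def)
  have K0: "0 \<le> K" using \<open>0 \<le> A\<close> by (simp add: K_def)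
  have pt: "ennreal (\<bar>avg v s x - avg v (s / 2) x\<bar> powr p)
      \<le> ennreal c * (\<integral>\<^sup>+ y. ?e y * indicator (piece x s) y \<partial>lborel)" if "x \<in> W" for x
    unfolding c_def using bd p s W[OF that] by (intro avg_scale_difference_pointwise) auto
  have sup: "\<bar>avg v s x - avg v (s / 2) x\<bar> powr p \<le> K * s powr (p - ?d)" if "x \<in> W" for x
  proof -
    have "(\<integral>\<^sup>+ y. ?e y * indicator (piece x s) y \<partial>lborel) \<le> (\<integral>\<^sup>+ y. ?e y * indicator \<Omega> y \<partial>lborel)"
      using W[OF that] by (intro nn_integral_mono mult_left_mono) (auto simp: indicator_def)
    also note energy
    finally have "ennreal (\<bar>avg v s x - avg v (s / 2) x\<bar> powr p) \<le> ennreal c * ennreal (A * \<delta> powr (p + ?d))"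
      by (intro order_trans[OF pt[OF that]] mult_left_mono) auto
    also have "\<dots> = ennreal (K * s powr (p - ?d))"
      using c0 cA \<open>0 \<le> A\<close> by (simp flip: ennreal_mult)
    finally show ?thesis using K0 by simp
  qed
  have "(\<integral>\<^sup>+ x. ennreal (\<bar>avg v s x - avg v (s / 2) x\<bar> powr p) * indicator W x \<partial>lborel)
      \<le> (\<integral>\<^sup>+ x. ennreal c * (\<integral>\<^sup>+ y. ?e y * indicator \<Omega> y * indicator (piece x s) y \<partial>lborel) \<partial>lborel)"
  proof (rule nn_integral_mono)
    fix x
    have "?e y * indicator (piece x s) y = ?e y * indicator \<Omega> y * indicator (piece x s) y" if "x \<in> W" for y
      using W[OF that] by (auto simp: indicator_def)
    with pt[of x] show "ennreal (\<bar>avg v s x - avg v (s / 2) x\<bar> powr p) * indicator W x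
        \<le> ennreal c * (\<integral>\<^sup>+ y. ?e y * indicator \<Omega> y * indicator (piece x s) y \<partial>lborel)"
      by (cases "x \<in> W") auto
  qed
  also have "\<dots> = ennreal c * (\<integral>\<^sup>+ x. \<integral>\<^sup>+ y. ?e y * indicator \<Omega> y * indicator (piece x s) y \<partial>lborel \<partial>lborel)"
    by (rule nn_integral_cmult) measurable
  also have "(\<integral>\<^sup>+ x. \<integral>\<^sup>+ y. ?e y * indicator \<Omega> y * indicator (piece x s) y \<partial>lborel \<partial>lborel)
      = (\<integral>\<^sup>+ y. \<integral>\<^sup>+ x. ?e y * indicator \<Omega> y * indicator (piece x s) y \<partial>lborel \<partial>lborel)"
    by (rule lborel_pair.Fubini') measurable
  also have "\<dots> \<le> (\<integral>\<^sup>+ y. ?e y * indicator \<Omega> y * ennreal (s ^ DIM('a) * ?\<beta>) \<partial>lborel)"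
    using s by (intro nn_integral_mono)
      (subst nn_integral_cmult, measurable, intro mult_left_mono nn_integral_piece_centres_le, auto)
  also have "\<dots> = (\<integral>\<^sup>+ y. ?e y * indicator \<Omega> y \<partial>lborel) * ennreal (s ^ DIM('a) * ?\<beta>)"
    by (rule nn_integral_multc) measurable
  also have "\<dots> \<le> ennreal (A * \<delta> powr (p + ?d)) * ennreal (s ^ DIM('a) * ?\<beta>)"
    by (intro mult_right_mono energy) auto
  also have "ennreal c * (ennreal (A * \<delta> powr (p + ?d)) * ennreal (s ^ DIM('a) * ?\<beta>))
      = ennreal (c * (A * \<delta> powr (p + ?d)) * (s ^ DIM('a) * ?\<beta>))"
    using c0 \<open>0 \<le> A\<close> s by (simp add: ennreal_mult mult.assoc)
  also have "c * (A * \<delta> powr (p + ?d)) * (s ^ DIM('a) * ?\<beta>) = K * ?\<beta> * s powr p"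
    using s unfolding cA by (simp add: powr_diff powr_realpow)
  finally have Lp: "(\<integral>\<^sup>+ x. ennreal (\<bar>avg v s x - avg v (s / 2) x\<bar> powr p) * indicator W x \<partial>lborel)
      \<le> ennreal (K * ?\<beta> * s powr p)"
    by (simp add: mult_left_mono)
  have "(\<integral>\<^sup>+ x. ennreal (\<bar>avg v s x - avg v (s / 2) x\<bar> powr q) * indicator W x \<partial>lborel)
      \<le> ennreal ((K * s powr (p - ?d)) powr ((q - p) / p) * (K * ?\<beta> * s powr p))"
    using p K0 sup Lp by (intro nn_integral_powr_interpolate) auto
  also have "(K * s powr (p - ?d)) powr ((q - p) / p) * (K * ?\<beta> * s powr p)
      = K powr ((q - p) / p) * (K * ?\<beta>) * s powr ((p - ?d) * ((q - p) / p) + p)"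
    using K0 s by (simp add: powr_mult powr_powr powr_add)
  also have "(p - ?d) * ((q - p) / p) + p = q * (1 - ?d / p + ?d / q)"
    using p by (simp add: field_simps)
  finally show ?thesis .
qed

text \<open>
At scale $s$ comparable to $\delta$ there is no finer scale to telescope to, and the average is compared with
the function itself. The supremum now comes from the bound on the local energy, which
involves $\Lambda$; the $L^p$ bound is of order $\delta^p$ as before.
\<close>

lemma minus_avg_Lq:
  fixes p q :: real
  assumes [measurable]: "v \<in> borel_measurable borel" "\<Omega> \<in> sets borel" "W \<in> sets borel"
    and bd: "\<And>y. \<bar>v y\<bar> \<le> m"
    and p: "1 \<le> p" "p \<le> q" and s: "0 < \<delta>" "s \<le> \<delta>" "\<delta> \<le> 2 * s" and "0 \<le> A" "0 < \<Lambda>"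
    and W: "W \<subseteq> \<Omega>" "\<And>x. x \<in> W \<Longrightarrow> piece x s \<subseteq> \<Omega>"
    and energy: "(\<integral>\<^sup>+ y. local_energy p \<delta> \<Omega> v y * indicator \<Omega> y \<partial>lborel) \<le> ennreal (A * \<delta> powr (p + DIM('a)))"
    and sup_energy: "\<And>x. x \<in> \<Omega> \<Longrightarrow> local_energy p \<delta> \<Omega> v x \<le> ennreal (A * \<delta> powr (p + DIM('a)) / \<Lambda>)"
  shows "(\<integral>\<^sup>+ x. ennreal (\<bar>v x - avg v s x\<bar> powr q) * indicator W x \<partial>lborel)
    \<le> ennreal ((C * 2 ^ DIM('a) * A) powr (q / p) * (\<delta> powr q * \<Lambda> powr ((p - q) / p)))"
proof -
  let ?d = "real DIM('a)" and ?e = "local_energy p \<delta> \<Omega> v" and ?K = "C * 2 ^ DIM('a) * A"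
  have s0: "0 < s" using s by simp
  have K0: "0 \<le> ?K" using \<open>0 \<le> A\<close> C_nonneg by simp
  have c: "C / s ^ DIM('a) \<le> C * 2 ^ DIM('a) * \<delta> powr (- ?d)"
  proof -
    have "\<delta> ^ DIM('a) \<le> (2 * s) ^ DIM('a)" using s by (intro power_mono) auto
    then have "1 / s ^ DIM('a) \<le> 2 ^ DIM('a) / \<delta> ^ DIM('a)"
      using s s0 by (simp add: field_simps power_mult_distrib)
    from mult_left_mono[OF this C_nonneg] show ?thesis
      using s by (simp add: powr_minus powr_realpow divide_inverse mult.assoc)
  qed
  define k where "k = C * 2 ^ DIM('a) * \<delta> powr (- ?d)"
  have k0: "0 \<le> k" using C_nonneg by (simp add: k_def)
  have kA: "k * (A * \<delta> powr (p + ?d)) = ?K * \<delta> powr p"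
    using s by (simp add: k_def powr_add powr_minus)
  have pt: "ennreal (\<bar>v x - avg v s x\<bar> powr p) \<le> ennreal k * ?e x" if "x \<in> W" for x
  proof -
    have "ennreal (\<bar>v x - avg v s x\<bar> powr p) \<le> ennreal (C / s ^ DIM('a)) *
        (\<integral>\<^sup>+ y. ennreal (\<bar>v x - v y\<bar> powr p) * indicator (piece x s) y \<partial>lborel)"
      using bd p s0 by (intro abs_minus_avg_powr_le) auto
    also have "\<dots> \<le> ennreal k * ?e x"
      unfolding local_energy_def
    proof (rule mult_mono[OF _ nn_integral_mono])
      fix y
      have "norm (x - y) \<le> \<delta>" "y \<in> \<Omega>" if "y \<in> piece x s"
        using piece_subset_ball[OF s0, of x] W(2)[OF \<open>x \<in> W\<close>] that s by (auto simp: dist_norm subset_eq)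
      then show "ennreal (\<bar>v x - v y\<bar> powr p) * indicator (piece x s) y
          \<le> ennreal (\<bar>v x - v y\<bar> powr p) * indicator {0..\<delta>} (norm (x - y)) * indicator \<Omega> y"
        by (auto simp: indicator_def)
    qed (use c in \<open>auto simp: k_def intro!: ennreal_leI\<close>)
    finally show ?thesis .
  qed
  have sup: "\<bar>v x - avg v s x\<bar> powr p \<le> ?K * \<delta> powr p / \<Lambda>" if "x \<in> W" for x
  proof -
    have "ennreal (\<bar>v x - avg v s x\<bar> powr p) \<le> ennreal k * ennreal (A * \<delta> powr (p + ?d) / \<Lambda>)"
      using that W by (intro order_trans[OF pt] mult_left_mono sup_energy) auto
    also have "\<dots> = ennreal (k * (A * \<delta> powr (p + ?d)) / \<Lambda>)"
      using k0 \<open>0 \<le> A\<close> \<open>0 < \<Lambda>\<close> by (simp flip: ennreal_mult)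
    finally show ?thesis using K0 \<open>0 < \<Lambda>\<close> unfolding kA by simp
  qed
  have "(\<integral>\<^sup>+ x. ennreal (\<bar>v x - avg v s x\<bar> powr p) * indicator W x \<partial>lborel)
      \<le> (\<integral>\<^sup>+ x. ennreal k * (?e x * indicator \<Omega> x) \<partial>lborel)"
  proof (rule nn_integral_mono)
    fix x
    show "ennreal (\<bar>v x - avg v s x\<bar> powr p) * indicator W x \<le> ennreal k * (?e x * indicator \<Omega> x)"
      using pt[of x] W(1) by (cases "x \<in> W") auto
  qed
  also have "\<dots> = ennreal k * (\<integral>\<^sup>+ x. ?e x * indicator \<Omega> x \<partial>lborel)"
    by (rule nn_integral_cmult) measurable
  also have "\<dots> \<le> ennreal k * ennreal (A * \<delta> powr (p + ?d))"
    by (intro mult_left_mono energy) auto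
  also have "\<dots> = ennreal (?K * \<delta> powr p)"
    unfolding kA[symmetric] using k0 by (simp add: ennreal_mult')
  finally have Lp: "(\<integral>\<^sup>+ x. ennreal (\<bar>v x - avg v s x\<bar> powr p) * indicator W x \<partial>lborel)
      \<le> ennreal (?K * \<delta> powr p)" .
  have "(\<integral>\<^sup>+ x. ennreal (\<bar>v x - avg v s x\<bar> powr q) * indicator W x \<partial>lborel)
      \<le> ennreal ((?K * \<delta> powr p / \<Lambda>) powr ((q - p) / p) * (?K * \<delta> powr p))"
    using p K0 sup Lp by (intro nn_integral_powr_interpolate) auto
  also have "(?K * \<delta> powr p / \<Lambda>) powr ((q - p) / p) * (?K * \<delta> powr p)
      = ?K powr (q / p) * (\<delta> powr q * \<Lambda> powr ((p - q) / p))"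
  proof -
    have "(?K * \<delta> powr p / \<Lambda>) powr ((q - p) / p) * (?K * \<delta> powr p)
        = (?K powr ((q - p) / p) * ?K) * (\<delta> powr (q - p) * \<delta> powr p) * \<Lambda> powr (- ((q - p) / p))"
      using K0 p \<open>0 < \<Lambda>\<close> s by (simp add: powr_mult powr_divide powr_powr powr_minus_divide)
    also have "?K powr ((q - p) / p) * ?K = ?K powr (q / p)"
    proof -
      have e: "(q - p) / p + 1 = q / p" using p by (simp add: field_simps)
      have "k powr ((q - p) / p) * k = k powr (q / p)" if "0 \<le> k" for k
        using that powr_add[of k "(q - p) / p" 1] unfolding e by simp
      then show ?thesis using K0 by blast
    qed
    also have "\<delta> powr (q - p) * \<delta> powr p = \<delta> powr q"
      by (simp add: powr_add[symmetric])
    also have "- ((q - p) / p) = (p - q) / p"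
      by (metis minus_diff_eq minus_divide_left)
    finally show ?thesis by simp
  qed
  finally show ?thesis .
qed

text \<open>
The two preceding estimates combined: telescope from scale $2^{-j}$ to a dyadic scale comparable to
$\delta$, then pass to $v$. The constant must not depend on $v$, $\delta$, $\Lambda$ and $j$, since
all of these vary along the sequence; this is why it is quantified before them.
\<close>

lemma minus_avg_Lq_multiscale:
  fixes p q :: real
  assumes p: "1 \<le> p" "p \<le> q" and \<theta>: "0 < 1 - DIM('a) / p + DIM('a) / q" and "0 \<le> A"
  obtains K where "0 \<le> K"
    "\<And>v \<Omega> W m \<delta> \<Lambda> j. v \<in> borel_measurable borel \<Longrightarrow> \<Omega> \<in> sets borel \<Longrightarrow> W \<in> sets borel \<Longrightarrow> (\<And>y. \<bar>v y\<bar> \<le> m) \<Longrightarrow>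
      0 < \<delta> \<Longrightarrow> \<delta> \<le> (1 / 2) ^ j \<Longrightarrow> 0 < \<Lambda> \<Longrightarrow> W \<subseteq> \<Omega> \<Longrightarrow> (\<And>x. x \<in> W \<Longrightarrow> piece x 1 \<subseteq> \<Omega>) \<Longrightarrow>
      (\<integral>\<^sup>+ y. local_energy p \<delta> \<Omega> v y * indicator \<Omega> y \<partial>lborel) \<le> ennreal (A * \<delta> powr (p + DIM('a))) \<Longrightarrow>
      (\<And>x. x \<in> \<Omega> \<Longrightarrow> local_energy p \<delta> \<Omega> v x \<le> ennreal (A * \<delta> powr (p + DIM('a)) / \<Lambda>)) \<Longrightarrow>
      (\<integral>\<^sup>+ x. ennreal (\<bar>v x - avg v ((1 / 2) ^ j) x\<bar> powr q) * indicator W x \<partial>lborel)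
        \<le> ennreal (K * (\<delta> powr q * \<Lambda> powr ((p - q) / p) +
              2 powr (- (q * (1 - DIM('a) / p + DIM('a) / q) * j))))"
proof -
  define \<theta> where "\<theta> = 1 - DIM('a) / p + DIM('a) / q"
  define l where "l = 2 powr (- \<theta>)"
  have l: "0 < l" "l < 1" using \<theta> by (auto simp: l_def \<theta>_def powr_less_one)
  define k where "k = C\<^sup>2 * 2 ^ DIM('a) * 4 powr (p + DIM('a)) * A"
  define c where "c = k powr ((q - p) / p) * (k * measure lborel (ball (0::'a) 1))"
  have c0: "0 \<le> c" using \<open>0 \<le> A\<close> by (simp add: c_def k_def)
  define K where "K = (1 / 2) powr (1 - q) * ((C * 2 ^ DIM('a) * A) powr (q / p) + c * (1 - l) powr (- q))"
  show thesis
  proof (rule that[of K])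
    show "0 \<le> K" using c0 by (simp add: K_def)
    fix v \<Omega> W m \<delta> \<Lambda> and j :: nat
    assume [measurable]: "v \<in> borel_measurable borel" "\<Omega> \<in> sets borel" "W \<in> sets borel"
      and bd: "\<And>y. \<bar>v y\<bar> \<le> m" and \<delta>: "0 < \<delta>" "\<delta> \<le> (1 / 2) ^ j" and \<Lambda>: "0 < \<Lambda>"
      and W: "W \<subseteq> \<Omega>" "\<And>x. x \<in> W \<Longrightarrow> piece x 1 \<subseteq> \<Omega>"
      and energy: "(\<integral>\<^sup>+ y. local_energy p \<delta> \<Omega> v y * indicator \<Omega> y \<partial>lborel) \<le> ennreal (A * \<delta> powr (p + DIM('a)))"
      and sup_energy: "\<And>x. x \<in> \<Omega> \<Longrightarrow> local_energy p \<delta> \<Omega> v x \<le> ennreal (A * \<delta> powr (p + DIM('a)) / \<Lambda>)"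
    have piece: "piece x ((1 / 2) ^ i) \<subseteq> \<Omega>" if "x \<in> W" for x i
      using W(2)[OF that] piece_mono[of "(1 / 2) ^ i" 1 x] by (auto simp: power_le_one)
    define J where "J = (LEAST J. (1 / 2) ^ J \<le> \<delta>)"
    have ex: "\<exists>J. (1 / 2) ^ J \<le> \<delta>"
      using real_arch_pow_inv[of \<delta> "1 / 2"] \<delta> by (auto intro: less_imp_le)
    then have J: "(1 / 2) ^ J \<le> \<delta>" unfolding J_def by (rule LeastI_ex)
    have J': "\<delta> < (1 / 2) ^ i" if "i < J" for i
      using not_less_Least[OF that[unfolded J_def]] by simp
    have J2: "\<delta> \<le> 2 * (1 / 2) ^ J"
    proof (cases J)
      case 0
      have "\<delta> \<le> 1" using \<delta>(2) power_le_one[of "1 / 2 :: real" j] by linarith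
      with 0 show ?thesis by simp
    next
      case (Suc i)
      with J'[of i] show ?thesis by simp
    qed
    have fine: "(\<integral>\<^sup>+ x. ennreal (\<bar>v x - avg v ((1 / 2) ^ i) x\<bar> powr q) * indicator W x \<partial>lborel)
        \<le> ennreal ((C * 2 ^ DIM('a) * A) powr (q / p) * (\<delta> powr q * \<Lambda> powr ((p - q) / p)))"
      if "(1 / 2) ^ i \<le> \<delta>" "\<delta> \<le> 2 * (1 / 2) ^ i" for i
      using bd p \<delta> that \<open>0 \<le> A\<close> \<Lambda> W(1) piece energy sup_energy by (intro minus_avg_Lq[where m = m]) auto
    \<comment> \<open>a scale that is both comparable to the range of the energy and not coarser than the one asked for\<close>
    define I where "I = max j J"
    have I: "(1 / 2) ^ I \<le> \<delta>" "\<delta> \<le> 2 * (1 / 2) ^ I" "j \<le> I"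
    proof -
      have "(1 / 2 :: real) ^ I \<le> (1 / 2) ^ J" by (rule power_decreasing) (auto simp: I_def)
      with J show "(1 / 2) ^ I \<le> \<delta>" by linarith
      show "\<delta> \<le> 2 * (1 / 2) ^ I" using J2 \<delta> by (auto simp: I_def max_def intro: order_trans)
    qed (simp add: I_def)
    have pw: "((1 / 2) ^ i) powr (q * \<theta>) = l powr (q * i)" for i :: nat
    proof -
      have "(1 / 2 :: real) ^ i = 2 powr (- real i)"
        by (simp add: powr_minus powr_realpow power_one_over inverse_eq_divide)
      then have "((1 / 2) ^ i) powr (q * \<theta>) = (2 powr (- real i)) powr (q * \<theta>)"
        by (simp only:)
      then show ?thesis by (simp add: l_def powr_powr mult_ac)
    qed
    have coarse: "(\<integral>\<^sup>+ x. ennreal (\<bar>avg v ((1 / 2) ^ j) x - avg v ((1 / 2) ^ I) x\<bar> powr q) * indicator W x \<partial>lborel)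
        \<le> ennreal (c * (1 - l) powr (- q) * l powr (q * j))"
    proof (rule geometric_telescope_Lq[where f = "\<lambda>i. avg v ((1 / 2) ^ i)"])
      fix i assume "i < I"
      have \<delta>i: "\<delta> \<le> 2 * (1 / 2) ^ i"
      proof -
        have "(1 / 2 :: real) ^ I \<le> (1 / 2) ^ i" using \<open>i < I\<close> by (intro power_decreasing) auto
        with I(2) show ?thesis by linarith
      qed
      have "(\<integral>\<^sup>+ x. ennreal (\<bar>avg v ((1 / 2) ^ i) x - avg v ((1 / 2) ^ i / 2) x\<bar> powr q) * indicator W x \<partial>lborel)
        \<le> ennreal (c * ((1 / 2) ^ i) powr (q * \<theta>))"
        unfolding c_def k_def \<theta>_def
        using bd p \<delta> \<delta>i \<open>0 \<le> A\<close> piece energy by (intro avg_scale_difference_Lq) auto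
      then show "(\<integral>\<^sup>+ x. ennreal (\<bar>avg v ((1 / 2) ^ i) x - avg v ((1 / 2) ^ Suc i) x\<bar> powr q) * indicator W x \<partial>lborel)
        \<le> ennreal (c * l powr (q * i))"
        by (simp add: pw)
    qed (use p l c0 I in auto)
    have "(\<integral>\<^sup>+ x. ennreal (\<bar>v x - avg v ((1 / 2) ^ j) x\<bar> powr q) * indicator W x \<partial>lborel)
      \<le> ennreal ((1 - 1 / 2) powr (1 - q)) * (\<integral>\<^sup>+ x. ennreal (\<bar>v x - avg v ((1 / 2) ^ I) x\<bar> powr q) * indicator W x \<partial>lborel)
      + ennreal ((1 / 2) powr (1 - q)) *
        (\<integral>\<^sup>+ x. ennreal (\<bar>avg v ((1 / 2) ^ I) x - avg v ((1 / 2) ^ j) x\<bar> powr q) * indicator W x \<partial>lborel)"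
      using p by (intro nn_integral_abs_diff_powr_triangle) auto
    also have "\<dots> \<le> ennreal ((1 / 2) powr (1 - q)) *
          ennreal ((C * 2 ^ DIM('a) * A) powr (q / p) * (\<delta> powr q * \<Lambda> powr ((p - q) / p)))
      + ennreal ((1 / 2) powr (1 - q)) * ennreal (c * (1 - l) powr (- q) * l powr (q * j))"
      using fine[OF I(1,2)] coarse
      by (intro add_mono mult_mono) (auto simp: abs_minus_commute)
    also have "\<dots> = ennreal ((1 / 2) powr (1 - q) *
        ((C * 2 ^ DIM('a) * A) powr (q / p) * (\<delta> powr q * \<Lambda> powr ((p - q) / p))
         + c * (1 - l) powr (- q) * l powr (q * j)))"
      using c0 by (simp add: ennreal_mult distrib_left)
    also have "\<dots> \<le> ennreal (K * (\<delta> powr q * \<Lambda> powr ((p - q) / p) + l powr (q * j)))"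
      using c0 unfolding K_def mult.assoc
      by (intro ennreal_leI mult_left_mono) (auto simp: distrib_left distrib_right)
    also have "l powr (q * j) = 2 powr (- (q * \<theta> * j))"
      by (simp add: l_def powr_powr algebra_simps)
    finally show "(\<integral>\<^sup>+ x. ennreal (\<bar>v x - avg v ((1 / 2) ^ j) x\<bar> powr q) * indicator W x \<partial>lborel)
        \<le> ennreal (K * (\<delta> powr q * \<Lambda> powr ((p - q) / p) +
              2 powr (- (q * (1 - DIM('a) / p + DIM('a) / q) * j))))"
      by (simp add: \<theta>_def)
  qed
qed

end

section \<open>Cones inside Lipschitz domains\<close>

text \<open>
The origin need not belong to $B$: for a truncated open cone it is the apex, on the boundary.
\<close>

definition cone_at_0 :: "'a::euclidean_space set \<Rightarrow> bool" where
  "cone_at_0 B \<longleftrightarrow> open B \<and> convex B \<and> B \<noteq> {} \<and> B \<subseteq> ball 0 1 \<and>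
     (\<forall>t b. 0 < t \<and> t \<le> 1 \<and> b \<in> B \<longrightarrow> t *\<^sub>R b \<in> B)"

lemma norm_scaleR_less:
  assumes "0 < t" "t \<le> 1" "norm b < r"
  shows "norm (t *\<^sub>R b) < r"
  using assms mult_left_le_one_le[of "norm b" t] by simp

lemma cone_at_0_ball: "0 < r \<Longrightarrow> r \<le> 1 \<Longrightarrow> cone_at_0 (ball (0::'a::euclidean_space) r)"
  by (auto simp: cone_at_0_def norm_scaleR_less simp del: norm_scaleR)

lemma cone_at_0_aperture:
  fixes e :: "'a::euclidean_space"
  assumes e: "norm e = 1" and r: "0 < r" "r \<le> 1" and L: "0 \<le> L"
  shows "cone_at_0 (ball 0 r \<inter> {z. L * norm (z - (z \<bullet> e) *\<^sub>R e) < z \<bullet> e})" (is "cone_at_0 (_ \<inter> ?S)")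
proof -
  define P where "P z = z - (z \<bullet> e) *\<^sub>R e" for z
  have P: "P (a *\<^sub>R y + b *\<^sub>R z) = a *\<^sub>R P y + b *\<^sub>R P z" "P (a *\<^sub>R y) = a *\<^sub>R P y" for a b y z
    by (auto simp: P_def algebra_simps inner_add_left scaleR_add_left)
  have S: "?S = {z. L * norm (P z) < z \<bullet> e}" by (simp add: P_def)
  have ee: "e \<bullet> e = 1" using e by (simp add: dot_square_norm)
  have "open ?S"
    by (intro open_Collect_less continuous_intros)
  moreover have "convex ?S"
    unfolding S
  proof (rule convexI)
    fix y z and a b :: real
    assume yz: "y \<in> {z. L * norm (P z) < z \<bullet> e}" "z \<in> {z. L * norm (P z) < z \<bullet> e}"
      and ab: "0 \<le> a" "0 \<le> b" "a + b = 1"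
    have "L * norm (P (a *\<^sub>R y + b *\<^sub>R z)) \<le> L * (a * norm (P y) + b * norm (P z))"
      unfolding P using ab L by (intro mult_left_mono norm_triangle_le) auto
    also have "\<dots> = a * (L * norm (P y)) + b * (L * norm (P z))"
      by (simp add: algebra_simps)
    also have "\<dots> < a * (y \<bullet> e) + b * (z \<bullet> e)"
    proof (cases "a = 0")
      case False
      then show ?thesis using yz ab by (intro add_less_le_mono mult_strict_left_mono mult_left_mono) auto
    qed (use yz ab in auto)
    finally show "a *\<^sub>R y + b *\<^sub>R z \<in> {z. L * norm (P z) < z \<bullet> e}"
      by (simp add: inner_add_left)
  qed
  moreover have "(r / 2) *\<^sub>R e \<in> ball 0 r \<inter> ?S"
    using e r ee by simp
  moreover have "t *\<^sub>R b \<in> ?S" if "0 < t" "t \<le> 1" "b \<in> ?S" for t b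
    using that by (simp add: S P mult.left_commute[of L])
  ultimately show ?thesis
    using r unfolding cone_at_0_def
    by (auto simp: norm_scaleR_less simp del: norm_scaleR intro!: convex_Int simp flip: S)
qed

text \<open>
If $\Omega$ lies above the graph of an $L$-Lipschitz function, moving from a point of $\Omega$ in a direction
that rises by more than $L$ times its horizontal displacement stays above the graph. At an interior
point a small ball serves as the cone.
\<close>

lemma lipschitz_boundary_uniform_cone:
  fixes \<Omega> :: "'a::euclidean_space set"
  assumes "open \<Omega>" "lipschitz_boundary \<Omega>" "x \<in> closure \<Omega>"
  obtains r and B :: "'a set" where "0 < r" "cone_at_0 B" "\<And>y b. y \<in> \<Omega> \<inter> ball x r \<Longrightarrow> b \<in> B \<Longrightarrow> y + b \<in> \<Omega>"
proof (cases "x \<in> \<Omega>")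
  case True
  then obtain s where s: "0 < s" "ball x s \<subseteq> \<Omega>"
    using \<open>open \<Omega>\<close> openE by blast
  show thesis
  proof (rule that[of "s / 2" "ball 0 (min 1 (s / 2))"])
    fix y b :: 'a assume "y \<in> \<Omega> \<inter> ball x (s / 2)" "b \<in> ball 0 (min 1 (s / 2))"
    then have "norm (y - x) < s / 2" "norm b < s / 2" by (auto simp: dist_norm norm_minus_commute)
    then have "norm (y + b - x) < s"
      using norm_triangle_ineq[of "y - x" b] by (simp add: algebra_simps)
    then show "y + b \<in> \<Omega>" using s by (auto simp: dist_norm norm_minus_commute)
  qed (use s in \<open>auto intro!: cone_at_0_ball\<close>)
next
  case False
  then have "x \<in> frontier \<Omega>"
    using assms by (simp add: frontier_def interior_open)
  from bspec[OF assms(2)[unfolded lipschitz_boundary_def] this]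
  obtain U e and g :: "'a \<Rightarrow> real" and L where U: "open U" "x \<in> U" and e: "norm e = 1"
    and g: "L-lipschitz_on {y. y \<bullet> e = 0} g"
    and graph: "\<Omega> \<inter> U = {y \<in> U. g (y - (y \<bullet> e) *\<^sub>R e) < y \<bullet> e}"
    by (elim exE conjE) (rule that)
  obtain s where s: "0 < s" "ball x s \<subseteq> U" using U openE by blast
  have ee: "e \<bullet> e = 1" using e by (simp add: dot_square_norm)
  define P where "P z = z - (z \<bullet> e) *\<^sub>R e" for z
  define B where "B = ball 0 (min 1 (s / 2)) \<inter> {z. L * norm (z - (z \<bullet> e) *\<^sub>R e) < z \<bullet> e}"
  show thesis
  proof (rule that[of "s / 2" B])
    show "cone_at_0 B"
      unfolding B_def using e s lipschitz_on_nonneg[OF g] by (intro cone_at_0_aperture) auto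
    fix y b assume y: "y \<in> \<Omega> \<inter> ball x (s / 2)" and b: "b \<in> B"
    then have n: "norm (y - x) < s / 2" "norm b < s / 2"
      by (auto simp: dist_norm norm_minus_commute B_def)
    then have "norm (y + b - x) < s"
      using norm_triangle_ineq[of "y - x" b] by (simp add: algebra_simps)
    moreover have "norm (y - x) < s" using n s by linarith
    ultimately have "y \<in> ball x s" "y + b \<in> ball x s"
      by (simp_all add: dist_norm norm_minus_commute)
    then have U: "y \<in> U" "y + b \<in> U" using s by auto
    have "g (P (y + b)) \<le> g (P y) + L * norm (P b)"
    proof -
      have "P z \<bullet> e = 0" for z by (simp add: P_def ee inner_diff_left)
      then have "dist (g (P (y + b))) (g (P y)) \<le> L * dist (P (y + b)) (P y)"
        by (intro lipschitz_onD[OF g]) auto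
      moreover have "P (y + b) - P y = P b" by (simp add: P_def algebra_simps inner_add_left)
      ultimately show ?thesis by (simp add: dist_norm abs_le_iff)
    qed
    moreover have "g (P y) < y \<bullet> e" using y U graph by (auto simp: P_def)
    moreover have "L * norm (P b) < b \<bullet> e" using b by (simp add: B_def P_def)
    ultimately have "g (P (y + b)) < (y + b) \<bullet> e" by (simp add: inner_add_left)
    then show "y + b \<in> \<Omega>" using U graph by (auto simp: P_def)
  qed (use s in auto)
qed

lemma lipschitz_boundary_cone_cover:
  fixes \<Omega> :: "'a::euclidean_space set"
  assumes "open \<Omega>" "bounded \<Omega>" "lipschitz_boundary \<Omega>"
  obtains F :: "('a set \<times> 'a set) set" where "finite F" "\<Omega> = \<Union> (fst ` F)"
    "\<And>W B. (W, B) \<in> F \<Longrightarrow> open W \<and> cone_at_0 B \<and> (\<forall>x\<in>W. \<forall>b\<in>B. x + b \<in> \<Omega>)"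
proof -
  have "\<forall>x\<in>closure \<Omega>. \<exists>r B. 0 < r \<and> cone_at_0 B \<and> (\<forall>y\<in>\<Omega> \<inter> ball x r. \<forall>b\<in>B. y + b \<in> \<Omega>)"
    using lipschitz_boundary_uniform_cone[OF assms(1,3)] by metis
  then obtain r B where rB: "\<And>x. x \<in> closure \<Omega> \<Longrightarrow>
      0 < r x \<and> cone_at_0 (B x) \<and> (\<forall>y\<in>\<Omega> \<inter> ball x (r x). \<forall>b\<in>B x. y + b \<in> \<Omega>)"
    by metis
  have "compact (closure \<Omega>)" using \<open>bounded \<Omega>\<close> by (simp add: compact_closure)
  moreover have "closure \<Omega> \<subseteq> (\<Union>x\<in>closure \<Omega>. ball x (r x))"
    using rB by (meson UN_I centre_in_ball subsetI)
  ultimately obtain D where D: "D \<subseteq> closure \<Omega>" "finite D" "closure \<Omega> \<subseteq> (\<Union>x\<in>D. ball x (r x))"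
    using compactE_image[of "closure \<Omega>" "closure \<Omega>" "\<lambda>x. ball x (r x)"] by (metis open_ball)
  show thesis
  proof (rule that[of "(\<lambda>x. (\<Omega> \<inter> ball x (r x), B x)) ` D"])
    show "\<Omega> = \<Union> (fst ` (\<lambda>x. (\<Omega> \<inter> ball x (r x), B x)) ` D)"
      using D closure_subset[of \<Omega>] by (auto simp: image_image)
  qed (use D rB \<open>open \<Omega>\<close> in auto)
qed

text \<open>
A normalised tent function over a ball contained in $B$.
\<close>

lemma lipschitz_density_in_open_set:
  fixes B :: "'a::euclidean_space set"
  assumes "open B" "B \<noteq> {}"
  obtains \<phi> :: "'a \<Rightarrow> real" and C L where "\<And>b. 0 \<le> \<phi> b" "\<And>b. \<phi> b \<le> C * indicator B b"
    "L-lipschitz_on UNIV \<phi>" "(\<integral>\<^sup>+ b. ennreal (\<phi> b) \<partial>lborel) = 1" "0 \<le> C"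
proof -
  obtain c r where r: "0 < r" "ball c r \<subseteq> B"
    using assms openE by blast
  define \<psi> where "\<psi> b = max 0 (r - norm (b - c))" for b
  have [measurable]: "\<psi> \<in> borel_measurable borel"
    unfolding \<psi>_def by measurable
  define k where "k = (\<integral>\<^sup>+ b. ennreal (\<psi> b) \<partial>lborel)"
  have \<psi>B: "\<psi> b \<le> r * indicator (ball c r) b" for b
    using r(1) by (auto simp: \<psi>_def indicator_def dist_norm norm_minus_commute)
  have "k \<le> (\<integral>\<^sup>+ b. ennreal r * indicator (ball c r) b \<partial>lborel)"
    unfolding k_def
  proof (rule nn_integral_mono)
    show "ennreal (\<psi> b) \<le> ennreal r * indicator (ball c r) b" for b
      using ennreal_leI[OF \<psi>B[of b]] by (cases "b \<in> ball c r") (auto simp: ennreal_neg)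
  qed
  also have "\<dots> < \<infinity>"
    using emeasure_lborel_ball_finite[of c r]
    by (simp add: nn_integral_cmult_indicator ennreal_mult_less_top)
  finally have fin: "k < \<infinity>" .
  have "0 < ennreal (r / 2) * emeasure lborel (ball c (r / 2))"
    using r content_ball_pos[of "r / 2" c] by (simp add: ennreal_zero_less_mult_iff measure_def enn2real_positive_iff)
  also have "\<dots> = (\<integral>\<^sup>+ b. ennreal (r / 2) * indicator (ball c (r / 2)) b \<partial>lborel)"
    by (simp add: nn_integral_cmult_indicator)
  also have "\<dots> \<le> k"
    unfolding k_def
    by (intro nn_integral_mono)
       (auto simp: \<psi>_def dist_norm norm_minus_commute split: split_indicator intro!: ennreal_leI)
  finally have "0 < enn2real k" using fin by (simp add: enn2real_positive_iff)
  moreover have k: "k = ennreal (enn2real k)" using fin by simp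
  ultimately obtain K where K: "0 < K" "k = ennreal K" by blast
  show thesis
  proof (rule that[of "\<lambda>b. \<psi> b / K" "r / K" "1 / K"])
    show "0 \<le> \<psi> b / K" for b using K by (simp add: \<psi>_def)
    show "\<psi> b / K \<le> r / K * indicator B b" for b
    proof -
      have "\<psi> b \<le> r * indicator B b"
        using \<psi>B[of b] r by (cases "b \<in> ball c r") (auto simp: indicator_def)
      from divide_right_mono[OF this, of K] K show ?thesis by simp
    qed
    show "(1 / K)-lipschitz_on UNIV (\<lambda>b. \<psi> b / K)"
    proof (rule lipschitz_onI)
      fix x y
      have "\<bar>\<psi> x - \<psi> y\<bar> \<le> norm (x - y)"
        using norm_triangle_ineq3[of "x - c" "y - c"] by (auto simp: \<psi>_def)
      then show "dist (\<psi> x / K) (\<psi> y / K) \<le> 1 / K * dist x y"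
        using K by (simp add: dist_norm diff_divide_distrib[symmetric] divide_right_mono)
    qed (use K in simp)
    have "(\<integral>\<^sup>+ b. ennreal (\<psi> b / K) \<partial>lborel) = (\<integral>\<^sup>+ b. ennreal (1 / K) * ennreal (\<psi> b) \<partial>lborel)"
      using K by (simp add: ennreal_mult'[symmetric])
    also have "\<dots> = ennreal (1 / K) * k"
      by (simp add: nn_integral_cmult k_def)
    also have "\<dots> = 1" using K by (simp add: ennreal_mult'[symmetric])
    finally show "(\<integral>\<^sup>+ b. ennreal (\<psi> b / K) \<partial>lborel) = 1" .
  qed (use r K in auto)
qed

section \<open>Convergence of averages at a fixed scale\<close>

lemma integral_lborel_affine:
  fixes f :: "'a::euclidean_space \<Rightarrow> real"
  assumes [measurable]: "f \<in> borel_measurable borel" and "0 < c"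
  shows "(\<integral>x. f x \<partial>lborel) = c ^ DIM('a) * (\<integral>x. f (t + c *\<^sub>R x) \<partial>lborel)"
proof -
  have "(\<integral>x. f x \<partial>lborel)
      = (\<integral>x. f x \<partial>density (distr lborel borel (\<lambda>x. t + c *\<^sub>R x)) (\<lambda>_. ennreal (c ^ DIM('a))))"
    using assms(2) lborel_affine[of c t] by simp
  also have "\<dots> = (\<integral>x. c ^ DIM('a) *\<^sub>R f x \<partial>distr lborel borel (\<lambda>x. t + c *\<^sub>R x))"
    using assms(2) by (intro integral_density) auto
  also have "\<dots> = c ^ DIM('a) * (\<integral>x. f (t + c *\<^sub>R x) \<partial>lborel)"
    by (subst integral_distr) auto
  finally show ?thesis .
qed

context cone_kernel
begin

lemma \<phi>_le_C: "\<phi> b \<le> C"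
  using \<phi>_le[of b] C_nonneg by (cases "b \<in> B") auto

text \<open>
Moves the dependence on $x$ from the function to the kernel, where regularity is available.
\<close>

lemma avg_eq_convolution:
  assumes [measurable]: "v \<in> borel_measurable borel" and "0 < s"
  shows "avg v s x = (\<integral>y. \<phi> ((1 / s) *\<^sub>R (y - x)) * v y \<partial>lborel) / s ^ DIM('a)"
proof -
  have "avg v s x = (\<integral>b. \<phi> b * v (x + s *\<^sub>R b) \<partial>lborel)"
    unfolding avg_def M_def using \<phi>_nonneg by (subst integral_density) auto
  moreover have "(\<integral>y. \<phi> ((1 / s) *\<^sub>R (y - x)) * v y \<partial>lborel)
      = s ^ DIM('a) * (\<integral>b. \<phi> ((1 / s) *\<^sub>R (x + s *\<^sub>R b - x)) * v (x + s *\<^sub>R b) \<partial>lborel)"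
    by (rule integral_lborel_affine) (use \<open>0 < s\<close> in measurable)
  ultimately show ?thesis using \<open>0 < s\<close> by simp
qed

lemma integrable_kernel_times:
  assumes v: "integrable lborel v"
  shows "integrable lborel (\<lambda>y. \<phi> ((1 / s) *\<^sub>R (y - x)) * v y)"
proof (rule Bochner_Integration.integrable_bound)
  show "integrable lborel (\<lambda>y. C * v y)" using v by simp
  have [measurable]: "v \<in> borel_measurable borel" using v by auto
  show "(\<lambda>y. \<phi> ((1 / s) *\<^sub>R (y - x)) * v y) \<in> borel_measurable lborel" by measurable
  show "AE y in lborel. norm (\<phi> ((1 / s) *\<^sub>R (y - x)) * v y) \<le> norm (C * v y)"
    using \<phi>_le_C \<phi>_nonneg C_nonneg by (auto simp: abs_mult intro!: mult_right_mono)
qed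

lemma abs_avg_le:
  assumes v: "integrable lborel v" and N: "(\<integral>y. \<bar>v y\<bar> \<partial>lborel) \<le> N" and s: "0 < s"
  shows "\<bar>avg v s x\<bar> \<le> C / s ^ DIM('a) * N"
proof -
  have "\<bar>\<integral>y. \<phi> ((1 / s) *\<^sub>R (y - x)) * v y \<partial>lborel\<bar> \<le> (\<integral>y. C * \<bar>v y\<bar> \<partial>lborel)"
    using integrable_abs[OF integrable_kernel_times[OF v]] v \<phi>_le_C \<phi>_nonneg
    by (intro order_trans[OF integral_abs_bound] integral_mono)
       (auto simp: abs_mult simp del: integrable_abs_iff intro!: mult_right_mono)
  also have "\<dots> \<le> C * N" using N C_nonneg by (simp add: mult_left_mono)
  finally show ?thesis
    using s v by (subst avg_eq_convolution) (auto simp: field_simps)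
qed

lemma avg_lipschitz:
  assumes v: "integrable lborel v" and N: "(\<integral>y. \<bar>v y\<bar> \<partial>lborel) \<le> N" and s: "0 < s"
  shows "\<bar>avg v s x - avg v s x'\<bar> \<le> L * N / s ^ Suc DIM('a) * norm (x - x')"
proof -
  let ?k = "\<lambda>x y. \<phi> ((1 / s) *\<^sub>R (y - x))"
  have L: "0 \<le> L" by (rule lipschitz_on_nonneg[OF \<phi>_lipschitz])
  have k: "\<bar>?k x y - ?k x' y\<bar> \<le> L * norm (x - x') / s" for y
  proof -
    have "\<bar>?k x y - ?k x' y\<bar> \<le> L * norm ((1 / s) *\<^sub>R (y - x) - (1 / s) *\<^sub>R (y - x'))"
      using lipschitz_onD[OF \<phi>_lipschitz, of "(1 / s) *\<^sub>R (y - x)" "(1 / s) *\<^sub>R (y - x')"]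
      by (simp add: dist_norm)
    also have "(1 / s) *\<^sub>R (y - x) - (1 / s) *\<^sub>R (y - x') = (1 / s) *\<^sub>R (x' - x)"
      by (simp add: algebra_simps)
    finally show ?thesis using s by (simp add: norm_minus_commute)
  qed
  have "\<bar>(\<integral>y. ?k x y * v y \<partial>lborel) - (\<integral>y. ?k x' y * v y \<partial>lborel)\<bar>
      = \<bar>\<integral>y. (?k x y - ?k x' y) * v y \<partial>lborel\<bar>"
    using integrable_kernel_times[OF v] by (simp add: left_diff_distrib)
  also have "\<dots> \<le> (\<integral>y. L * norm (x - x') / s * \<bar>v y\<bar> \<partial>lborel)"
  proof (rule order_trans[OF integral_abs_bound], rule integral_mono)
    show "integrable lborel (\<lambda>y. \<bar>(?k x y - ?k x' y) * v y\<bar>)"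
      using integrable_kernel_times[OF v] by (intro integrable_abs) (simp add: left_diff_distrib)
    show "\<bar>(?k x y - ?k x' y) * v y\<bar> \<le> L * norm (x - x') / s * \<bar>v y\<bar>" for y
      unfolding abs_mult by (intro mult_right_mono k) auto
  qed (use v in simp)
  also have "\<dots> \<le> L * norm (x - x') / s * N"
    using N L s by (simp add: mult_left_mono divide_right_mono)
  finally have "\<bar>(\<integral>y. ?k x y * v y \<partial>lborel) - (\<integral>y. ?k x' y * v y \<partial>lborel)\<bar> / s ^ DIM('a)
      \<le> L * norm (x - x') / s * N / s ^ DIM('a)"
    using s by (intro divide_right_mono) auto
  moreover have "avg v s x - avg v s x'
      = ((\<integral>y. ?k x y * v y \<partial>lborel) - (\<integral>y. ?k x' y * v y \<partial>lborel)) / s ^ DIM('a)"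
    using s v by (simp add: avg_eq_convolution diff_divide_distrib)
  ultimately show ?thesis
    using s by (simp add: abs_divide mult_ac)
qed

end

text \<open>
A diagonal argument over the countable set of indices and a countable dense set of points, extended to
all points by the Lipschitz bounds. The functions are rescaled to make the bounds uniform in the index.
\<close>

lemma equilipschitz_pointwise_subsequence:
  fixes f :: "'i \<Rightarrow> nat \<Rightarrow> 'a::euclidean_space \<Rightarrow> real"
  assumes "countable I" and bd: "\<And>i n x. i \<in> I \<Longrightarrow> \<bar>f i n x\<bar> \<le> m i"
    and lip: "\<And>i n x y. i \<in> I \<Longrightarrow> \<bar>f i n x - f i n y\<bar> \<le> K i * norm (x - y)"
  obtains r :: "nat \<Rightarrow> nat" where "strict_mono r" "\<And>i x. i \<in> I \<Longrightarrow> convergent (\<lambda>n. f i (r n) x)"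
proof -
  obtain D :: "'a set" where D: "countable D" "\<And>U. open U \<Longrightarrow> U \<noteq> {} \<Longrightarrow> \<exists>d\<in>D. d \<in> U"
    by (rule countable_dense_setE) blast
  define h where "h n = (\<lambda>(i, x). f i n x / (1 + \<bar>m i\<bar>))" for n
  obtain r :: "nat \<Rightarrow> nat" where r: "strict_mono r"
    "\<And>z. z \<in> I \<times> D \<Longrightarrow> \<exists>l. (\<lambda>n. h (r n) z) \<longlonglongrightarrow> l"
  proof (rule function_convergent_subsequence[of "I \<times> D" h 1])
    show "countable (I \<times> D)" using \<open>countable I\<close> D by simp
    show "norm (h n z) \<le> 1" if "z \<in> I \<times> D" for n z
    proof (cases z)
      case (Pair i x)
      with that bd[of i n x] show ?thesis by (auto simp: h_def)
    qed
  qed auto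
  show thesis
  proof (rule that[OF r(1)])
    fix i x assume i: "i \<in> I"
    have "Cauchy (\<lambda>n. f i (r n) x)"
    proof (rule CauchyI)
      fix e :: real assume "0 < e"
      define t where "t = e / (3 * (1 + \<bar>K i\<bar>))"
      have "0 < t" using \<open>0 < e\<close> by (simp add: t_def)
      then obtain d where d: "d \<in> D" "norm (x - d) < t"
        using D(2)[of "ball x t"] by (auto simp: dist_norm)
      have near: "\<bar>f i n x - f i n d\<bar> \<le> e / 3" for n
      proof -
        have "\<bar>f i n x - f i n d\<bar> \<le> (1 + \<bar>K i\<bar>) * t"
          using lip[OF i, of n x d] d(2) by (intro order_trans[OF lip[OF i]] mult_mono) auto
        also have "(1 + \<bar>K i\<bar>) * t = e / 3"
        proof -
          have "1 + \<bar>K i\<bar> \<noteq> 0" by linarith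
          moreover have "c * (e / (3 * c)) = e / 3" if "c \<noteq> 0" for c
            using that by (simp add: divide_simps)
          ultimately show ?thesis unfolding t_def by blast
        qed
        finally show ?thesis .
      qed
      obtain l where "(\<lambda>n. h (r n) (i, d)) \<longlonglongrightarrow> l" using r(2)[of "(i, d)"] i d by auto
      then have "(\<lambda>n. (1 + \<bar>m i\<bar>) * h (r n) (i, d)) \<longlonglongrightarrow> (1 + \<bar>m i\<bar>) * l"
        by (intro tendsto_mult tendsto_const)
      moreover have "(1 + \<bar>m i\<bar>) * h n (i, d) = f i n d" for n
        by (simp add: h_def)
      ultimately have "Cauchy (\<lambda>n. f i (r n) d)"
        by (simp add: LIMSEQ_imp_Cauchy)
      then obtain N where N: "\<And>n n'. N \<le> n \<Longrightarrow> N \<le> n' \<Longrightarrow> norm (f i (r n) d - f i (r n') d) < e / 3"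
        using CauchyD[of "\<lambda>n. f i (r n) d" "e / 3"] \<open>0 < e\<close> by auto
      have "norm (f i (r n) x - f i (r n') x) < e" if "N \<le> n" "N \<le> n'" for n n'
        using N[OF that] near[of "r n"] near[of "r n'"] unfolding real_norm_def by linarith
      then show "\<exists>N. \<forall>n\<ge>N. \<forall>n'\<ge>N. norm (f i (r n) x - f i (r n') x) < e" by blast
    qed
    then show "convergent (\<lambda>n. f i (r n) x)" by (rule Cauchy_convergent)
  qed
qed

section \<open>Cauchy sequences in Lq\<close>

lemma nn_integral_powr_tendsto_0_bounded:
  fixes f :: "nat \<Rightarrow> 'a \<Rightarrow> real"
  assumes [measurable]: "\<And>n. f n \<in> borel_measurable N" "g \<in> borel_measurable N" "W \<in> sets N"
    and W: "emeasure N W < \<infinity>" and q: "0 < q" and bd: "\<And>n x. \<bar>f n x\<bar> \<le> m"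
    and lim: "\<And>x. (\<lambda>n. f n x) \<longlonglongrightarrow> g x"
  shows "(\<lambda>n. \<integral>\<^sup>+ x. ennreal (\<bar>f n x - g x\<bar> powr q) * indicator W x \<partial>N) \<longlonglongrightarrow> 0"
proof -
  have g: "\<bar>g x\<bar> \<le> m" for x
    by (rule LIMSEQ_le_const2[OF tendsto_rabs[OF lim]]) (use bd in auto)
  have "(\<lambda>n. \<integral>\<^sup>+ x. ennreal (\<bar>f n x - g x\<bar> powr q) * indicator W x \<partial>N) \<longlonglongrightarrow> (\<integral>\<^sup>+ x. 0 \<partial>N)"
  proof (rule nn_integral_dominated_convergence[where w = "\<lambda>x. ennreal ((2 * m) powr q) * indicator W x"])
    show "(\<integral>\<^sup>+ x. ennreal ((2 * m) powr q) * indicator W x \<partial>N) < \<infinity>"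
      using W by (simp add: nn_integral_cmult ennreal_mult_less_top)
    show "AE x in N. ennreal (\<bar>f n x - g x\<bar> powr q) * indicator W x \<le> ennreal ((2 * m) powr q) * indicator W x" for n
    proof (rule AE_I2, rule mult_right_mono, rule ennreal_leI, rule powr_mono2)
      show "\<bar>f n x - g x\<bar> \<le> 2 * m" for x using bd[of n x] g[of x] by linarith
    qed (use q in auto)
    show "AE x in N. (\<lambda>n. ennreal (\<bar>f n x - g x\<bar> powr q) * indicator W x) \<longlonglongrightarrow> 0"
    proof (rule AE_I2)
      fix x
      have "(\<lambda>n. \<bar>f n x - g x\<bar>) \<longlonglongrightarrow> 0"
        using lim[of x] by (simp add: LIM_zero_iff tendsto_rabs_zero)
      then have "(\<lambda>n. \<bar>f n x - g x\<bar> powr q) \<longlonglongrightarrow> 0 powr q"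
        using q by (intro tendsto_powr2) auto
      then have "(\<lambda>n. ennreal (\<bar>f n x - g x\<bar> powr q)) \<longlonglongrightarrow> 0"
        by (metis powr_0 tendsto_ennrealI ennreal_0)
      then show "(\<lambda>n. ennreal (\<bar>f n x - g x\<bar> powr q) * indicator W x) \<longlonglongrightarrow> 0"
        by (cases "x \<in> W") auto
    qed
  qed measurable
  then show ?thesis by simp
qed

text \<open>
The approximating sequence and its limit may depend on the error; a limit of the sequence itself is not at hand
at this point, which is why the conclusion is the Cauchy property.
\<close>

lemma Lq_cauchy_if_near_convergent:
  fixes f :: "nat \<Rightarrow> 'a \<Rightarrow> real"
  assumes [measurable]: "\<And>n. f n \<in> borel_measurable N" "W \<in> sets N" and q: "1 \<le> q"
    and approx: "\<And>e. 0 < e \<Longrightarrow> \<exists>a g. (\<forall>n. a n \<in> borel_measurable N) \<and> g \<in> borel_measurable N \<and>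
      (\<forall>\<^sub>F n in sequentially. (\<integral>\<^sup>+ x. ennreal (\<bar>f n x - a n x\<bar> powr q) * indicator W x \<partial>N) \<le> ennreal e) \<and>
      (\<lambda>n. \<integral>\<^sup>+ x. ennreal (\<bar>a n x - g x\<bar> powr q) * indicator W x \<partial>N) \<longlonglongrightarrow> 0"
    and "0 < e"
  shows "\<forall>\<^sub>F (n, n') in sequentially \<times>\<^sub>F sequentially.
    (\<integral>\<^sup>+ x. ennreal (\<bar>f n x - f n' x\<bar> powr q) * indicator W x \<partial>N) \<le> ennreal e"
proof -
  define k where "k = (1 / 2 :: real) powr (1 - q)"
  have k: "0 < k" by (simp add: k_def)
  have tri: "(\<integral>\<^sup>+ x. ennreal (\<bar>f x - h x\<bar> powr q) * indicator W x \<partial>N) \<le> ennreal (2 * k * d)"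
    if [measurable]: "f \<in> borel_measurable N" "g \<in> borel_measurable N" "h \<in> borel_measurable N"
      and "(\<integral>\<^sup>+ x. ennreal (\<bar>f x - g x\<bar> powr q) * indicator W x \<partial>N) \<le> ennreal d"
      "(\<integral>\<^sup>+ x. ennreal (\<bar>g x - h x\<bar> powr q) * indicator W x \<partial>N) \<le> ennreal d" "0 \<le> d" for f g h d
  proof -
    have "(\<integral>\<^sup>+ x. ennreal (\<bar>f x - h x\<bar> powr q) * indicator W x \<partial>N)
      \<le> ennreal ((1 - 1 / 2) powr (1 - q)) * (\<integral>\<^sup>+ x. ennreal (\<bar>f x - g x\<bar> powr q) * indicator W x \<partial>N)
      + ennreal ((1 / 2) powr (1 - q)) * (\<integral>\<^sup>+ x. ennreal (\<bar>g x - h x\<bar> powr q) * indicator W x \<partial>N)"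
      using q by (intro nn_integral_abs_diff_powr_triangle) auto
    also have "\<dots> \<le> ennreal k * ennreal d + ennreal k * ennreal d"
      using that by (intro add_mono mult_mono) (auto simp: k_def)
    also have "\<dots> = ennreal (2 * k * d)"
      using k \<open>0 \<le> d\<close> by (simp add: ennreal_mult'[symmetric] ennreal_plus[symmetric] del: ennreal_plus)
    finally show ?thesis .
  qed
  define d where "d = e / (2 * k * (2 * k))"
  have d: "0 < d" "2 * k * (2 * k * d) = e" using \<open>0 < e\<close> k by (auto simp: d_def)
  obtain a g where [measurable]: "\<And>n. a n \<in> borel_measurable N" "g \<in> borel_measurable N"
    and a: "\<forall>\<^sub>F n in sequentially. (\<integral>\<^sup>+ x. ennreal (\<bar>f n x - a n x\<bar> powr q) * indicator W x \<partial>N) \<le> ennreal d"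
    and g: "(\<lambda>n. \<integral>\<^sup>+ x. ennreal (\<bar>a n x - g x\<bar> powr q) * indicator W x \<partial>N) \<longlonglongrightarrow> 0"
    using approx[OF d(1)] by blast
  have "\<forall>\<^sub>F n in sequentially. (\<integral>\<^sup>+ x. ennreal (\<bar>a n x - g x\<bar> powr q) * indicator W x \<partial>N) < ennreal d"
    using order_tendstoD(2)[OF g] d by simp
  with a have "\<forall>\<^sub>F n in sequentially. (\<integral>\<^sup>+ x. ennreal (\<bar>f n x - g x\<bar> powr q) * indicator W x \<partial>N) \<le> ennreal (2 * k * d)"
    by eventually_elim (rule tri[where g = "a _"], use d in auto)
  then have "\<forall>\<^sub>F z in sequentially \<times>\<^sub>F sequentially.
      (\<integral>\<^sup>+ x. ennreal (\<bar>f (fst z) x - g x\<bar> powr q) * indicator W x \<partial>N) \<le> ennreal (2 * k * d) \<and>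
      (\<integral>\<^sup>+ x. ennreal (\<bar>f (snd z) x - g x\<bar> powr q) * indicator W x \<partial>N) \<le> ennreal (2 * k * d)"
    by (auto simp: eventually_prod_sequentially eventually_sequentially)
  then show ?thesis
  proof eventually_elim
    case (elim z)
    then have "(\<integral>\<^sup>+ x. ennreal (\<bar>f (fst z) x - f (snd z) x\<bar> powr q) * indicator W x \<partial>N) \<le> ennreal (2 * k * (2 * k * d))"
      using d k by (intro tri[where g = g and d = "2 * k * d"]) (auto simp: abs_minus_commute)
    then show ?case by (auto simp: d(2) split: prod.split)
  qed
qed

text \<open>
Riesz-Fischer. On a finite measure space, $|a| \le t + t^{1-q}|a|^q$ for every $t > 0$ turns the Cauchy
property in $L^q$ into the one in $L^1$, which provides an almost everywhere convergent subsequence;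
Fatou's lemma transfers the $L^q$ estimate to its limit.
\<close>

lemma (in finite_measure) Lq_cauchy_converges:
  fixes f :: "nat \<Rightarrow> 'a \<Rightarrow> real"
  assumes f [measurable]: "\<And>n. f n \<in> borel_measurable M" and q: "1 \<le> q"
    and fin: "\<And>n. (\<integral>\<^sup>+ x. ennreal (\<bar>f n x\<bar> powr q) \<partial>M) < \<infinity>"
    and cauchy: "\<And>e. 0 < e \<Longrightarrow> \<forall>\<^sub>F (n, n') in sequentially \<times>\<^sub>F sequentially.
      (\<integral>\<^sup>+ x. ennreal (\<bar>f n x - f n' x\<bar> powr q) \<partial>M) \<le> ennreal e"
  obtains g where "g \<in> borel_measurable M" "(\<integral>\<^sup>+ x. ennreal (\<bar>g x\<bar> powr q) \<partial>M) < \<infinity>"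
    "(\<lambda>n. \<integral>\<^sup>+ x. ennreal (\<bar>f n x - g x\<bar> powr q) \<partial>M) \<longlonglongrightarrow> 0"
proof -
  have young: "\<bar>a\<bar> \<le> t + t powr (1 - q) * \<bar>a\<bar> powr q" if "0 < t" for a t :: real
  proof (cases "\<bar>a\<bar> \<le> t")
    case False
    have "\<bar>a\<bar> = \<bar>a\<bar> powr (1 - q) * \<bar>a\<bar> powr q"
      using False that by (simp add: powr_add[symmetric])
    also have "\<dots> \<le> t powr (1 - q) * \<bar>a\<bar> powr q"
      using False that q by (intro mult_right_mono powr_mono2') auto
    finally show ?thesis using that by simp
  qed (use that in \<open>auto intro: add_increasing2\<close>)
  have L1: "(\<integral>\<^sup>+ x. ennreal \<bar>h x\<bar> \<partial>M) \<le> ennreal (t * measure M (space M)) + ennreal (t powr (1 - q)) * (\<integral>\<^sup>+ x. ennreal (\<bar>h x\<bar> powr q) \<partial>M)"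
    if [measurable]: "h \<in> borel_measurable M" and "0 < t" for h t
  proof -
    have "(\<integral>\<^sup>+ x. ennreal \<bar>h x\<bar> \<partial>M) \<le> (\<integral>\<^sup>+ x. ennreal t + ennreal (t powr (1 - q)) * ennreal (\<bar>h x\<bar> powr q) \<partial>M)"
      using young[OF \<open>0 < t\<close>] \<open>0 < t\<close>
      by (intro nn_integral_mono) (auto simp: ennreal_mult'[symmetric] ennreal_plus[symmetric] intro!: ennreal_leI simp del: ennreal_plus)
    also have "\<dots> = ennreal (t * measure M (space M)) + ennreal (t powr (1 - q)) * (\<integral>\<^sup>+ x. ennreal (\<bar>h x\<bar> powr q) \<partial>M)"
      using \<open>0 < t\<close> by (simp add: nn_integral_add nn_integral_cmult emeasure_eq_measure ennreal_mult')
    finally show ?thesis .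
  qed
  have int: "integrable M (f n)" for n
  proof (rule integrableI_bounded)
    have "(\<integral>\<^sup>+ x. ennreal \<bar>f n x\<bar> \<partial>M) < \<infinity>"
      by (rule le_less_trans[OF L1[where t = 1]]) (use fin[of n] in \<open>auto simp: ennreal_mult_less_top\<close>)
    then show "(\<integral>\<^sup>+ x. ennreal (norm (f n x)) \<partial>M) < \<infinity>" by simp
  qed simp
  have "\<exists>N. \<forall>i\<ge>N. \<forall>j\<ge>N. LINT x|M. norm (f i x - f j x) < e" if "0 < e" for e
  proof -
    define t where "t = e / (3 * (measure M (space M) + 1))"
    have t: "0 < t" using that by (simp add: t_def add_nonneg_pos)
    have tm: "t * measure M (space M) \<le> e / 3"
    proof -
      have "t * measure M (space M) \<le> t * (measure M (space M) + 1)"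
        using t by (intro mult_left_mono) auto
      also have "\<dots> = e / 3"
      proof -
        have "measure M (space M) + 1 \<noteq> 0" using measure_nonneg[of M "space M"] by linarith
        moreover have "e / (3 * c) * c = e / 3" if "c \<noteq> 0" for c
          using that by (simp add: divide_simps)
        ultimately show ?thesis unfolding t_def by blast
      qed
      finally show ?thesis .
    qed
    define d where "d = e / 3 / t powr (1 - q)"
    have d: "0 < d" "t powr (1 - q) * d = e / 3" using that t by (auto simp: d_def)
    obtain N where N: "\<And>i j. N \<le> i \<Longrightarrow> N \<le> j \<Longrightarrow> (\<integral>\<^sup>+ x. ennreal (\<bar>f i x - f j x\<bar> powr q) \<partial>M) \<le> ennreal d"
      using cauchy[OF d(1)] unfolding eventually_prod_sequentially by auto
    have "(LINT x|M. norm (f i x - f j x)) < e" if "N \<le> i" "N \<le> j" for i j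
    proof -
      have "(\<integral>\<^sup>+ x. ennreal \<bar>f i x - f j x\<bar> \<partial>M) \<le> ennreal (e / 3) + ennreal (t powr (1 - q)) * ennreal d"
        by (rule order_trans[OF L1[OF _ t]], measurable, intro add_mono mult_left_mono N that ennreal_leI tm) auto
      also have "\<dots> = ennreal (2 * e / 3)"
        using d \<open>0 < e\<close> by (simp add: ennreal_mult'[symmetric] ennreal_plus[symmetric] del: ennreal_plus)
      finally have "ennreal (LINT x|M. norm (f i x - f j x)) \<le> ennreal (2 * e / 3)"
        using int by (subst (asm) nn_integral_eq_integral) auto
      then show ?thesis using \<open>0 < e\<close> by (simp add: ennreal_le_iff)
    qed
    then show ?thesis by blast
  qed
  with int obtain r where r: "strict_mono r" "AE x in M. Cauchy (\<lambda>i. f (r i) x)"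
    by (rule cauchy_L1_AE_cauchy_subseq)
  define g where "g x = lim (\<lambda>i. f (r i) x)" for x
  have g [measurable]: "g \<in> borel_measurable M"
    unfolding g_def by measurable
  have lim: "AE x in M. (\<lambda>i. f (r i) x) \<longlonglongrightarrow> g x"
    using r(2) by eventually_elim (simp add: g_def Cauchy_convergent_iff convergent_LIMSEQ_iff)
  have conv: "\<forall>\<^sub>F n in sequentially. (\<integral>\<^sup>+ x. ennreal (\<bar>f n x - g x\<bar> powr q) \<partial>M) \<le> ennreal e" if "0 < e" for e
  proof -
    obtain N where N: "\<And>i j. N \<le> i \<Longrightarrow> N \<le> j \<Longrightarrow> (\<integral>\<^sup>+ x. ennreal (\<bar>f i x - f j x\<bar> powr q) \<partial>M) \<le> ennreal e"
      using cauchy[OF \<open>0 < e\<close>] unfolding eventually_prod_sequentially by auto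
    have "(\<integral>\<^sup>+ x. ennreal (\<bar>f n x - g x\<bar> powr q) \<partial>M) \<le> ennreal e" if "N \<le> n" for n
    proof -
      have "(\<integral>\<^sup>+ x. ennreal (\<bar>f n x - g x\<bar> powr q) \<partial>M)
          = (\<integral>\<^sup>+ x. liminf (\<lambda>i. ennreal (\<bar>f n x - f (r i) x\<bar> powr q)) \<partial>M)"
      proof (rule nn_integral_cong_AE)
        show "AE x in M. ennreal (\<bar>f n x - g x\<bar> powr q) = liminf (\<lambda>i. ennreal (\<bar>f n x - f (r i) x\<bar> powr q))"
          using lim
        proof eventually_elim
          case (elim x)
          then have "(\<lambda>i. \<bar>f n x - f (r i) x\<bar> powr q) \<longlonglongrightarrow> \<bar>f n x - g x\<bar> powr q"
            using q by (intro tendsto_powr2 tendsto_intros) auto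
          then show ?case by (intro lim_imp_Liminf[symmetric] tendsto_ennrealI) auto
        qed
      qed
      also have "\<dots> \<le> liminf (\<lambda>i. \<integral>\<^sup>+ x. ennreal (\<bar>f n x - f (r i) x\<bar> powr q) \<partial>M)"
        by (rule nn_integral_liminf) measurable
      also have "\<dots> \<le> liminf (\<lambda>i. ennreal e)"
      proof (rule Liminf_mono)
        have "N \<le> r i" if "N \<le> i" for i using seq_suble[OF r(1), of i] that by linarith
        then show "\<forall>\<^sub>F i in sequentially. (\<integral>\<^sup>+ x. ennreal (\<bar>f n x - f (r i) x\<bar> powr q) \<partial>M) \<le> ennreal e"
          using N \<open>N \<le> n\<close> unfolding eventually_sequentially by blast
      qed
      finally show ?thesis by (simp add: Liminf_const)
    qed
    then show ?thesis unfolding eventually_sequentially by blast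
  qed
  show thesis
  proof (rule that[OF g])
    obtain n where n: "(\<integral>\<^sup>+ x. ennreal (\<bar>f n x - g x\<bar> powr q) \<partial>M) \<le> ennreal 1"
      using conv[of 1] by (auto simp: eventually_sequentially)
    have "(\<integral>\<^sup>+ x. ennreal (\<bar>g x - 0\<bar> powr q) * indicator (space M) x \<partial>M)
      \<le> ennreal ((1 - 1 / 2) powr (1 - q)) * (\<integral>\<^sup>+ x. ennreal (\<bar>g x - f n x\<bar> powr q) * indicator (space M) x \<partial>M)
      + ennreal ((1 / 2) powr (1 - q)) * (\<integral>\<^sup>+ x. ennreal (\<bar>f n x - 0\<bar> powr q) * indicator (space M) x \<partial>M)"
      using q by (intro nn_integral_abs_diff_powr_triangle) auto
    moreover have "(\<integral>\<^sup>+ x. h x * indicator (space M) x \<partial>M) = (\<integral>\<^sup>+ x. h x \<partial>M)" for h :: "'a \<Rightarrow> ennreal"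
      by (intro nn_integral_cong) simp
    ultimately show "(\<integral>\<^sup>+ x. ennreal (\<bar>g x\<bar> powr q) \<partial>M) < \<infinity>"
      using le_less_trans[OF n ennreal_less_top] fin[of n]
      by (auto simp: abs_minus_commute ennreal_mult_less_top elim!: le_less_trans)
    show "(\<lambda>n. \<integral>\<^sup>+ x. ennreal (\<bar>f n x - g x\<bar> powr q) \<partial>M) \<longlonglongrightarrow> 0"
    proof (rule order_tendstoI)
      fix a :: ennreal assume "0 < a"
      then obtain b where b: "0 < b" "b < a" using dense by blast
      then obtain e where "b = ennreal e" by (cases b) auto
      with b have "0 < e" "ennreal e < a" by auto
      then show "\<forall>\<^sub>F n in sequentially. (\<integral>\<^sup>+ x. ennreal (\<bar>f n x - g x\<bar> powr q) \<partial>M) < a"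
        using conv[of e] by (auto elim: eventually_mono)
    qed auto
  qed
qed

section \<open>Compactness for bounded nonlocal energy\<close>

text \<open>
A nonlocal Rellich-Kondrachov theorem. One subsequence serves all pieces of the cover and all dyadic scales.
On each piece, a scale $2^{-j}$ is chosen so fine that the averages approximate the functions up to a prescribed
error for all large $n$, and the averages at this scale converge.
\<close>

lemma nonlocal_compactness_Lq:
  fixes \<Omega> :: "'a::euclidean_space set" and v :: "nat \<Rightarrow> 'a \<Rightarrow> real" and p q A :: real
  assumes \<Omega>: "open \<Omega>" "bounded \<Omega>" "lipschitz_boundary \<Omega>"
    and p: "1 \<le> p" "p \<le> q" and \<theta>: "0 < 1 - DIM('a) / p + DIM('a) / q" and A: "0 \<le> A"
    and v [measurable]: "\<And>n. v n \<in> borel_measurable borel"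
    and bd: "\<And>n y. \<bar>v n y\<bar> \<le> m n" and out: "\<And>n y. y \<notin> \<Omega> \<Longrightarrow> v n y = 0"
    and Lp: "\<And>n. (\<integral>\<^sup>+ y. ennreal (\<bar>v n y\<bar> powr p) \<partial>lborel) \<le> ennreal A"
    and \<delta>: "\<And>n. 0 < \<delta> n" "\<delta> \<longlonglongrightarrow> 0" and \<Lambda>: "\<And>n. 0 < \<Lambda> n"
    and small: "(\<lambda>n. \<delta> n powr q * \<Lambda> n powr ((p - q) / p)) \<longlonglongrightarrow> 0"
    and energy: "\<And>n. (\<integral>\<^sup>+ y. local_energy p (\<delta> n) \<Omega> (v n) y * indicator \<Omega> y \<partial>lborel)
          \<le> ennreal (A * \<delta> n powr (p + DIM('a)))"
    and sup_energy: "\<And>n x. x \<in> \<Omega> \<Longrightarrow>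
          local_energy p (\<delta> n) \<Omega> (v n) x \<le> ennreal (A * \<delta> n powr (p + DIM('a)) / \<Lambda> n)"
  obtains r :: "nat \<Rightarrow> nat" where "strict_mono r"
    "\<And>e. 0 < e \<Longrightarrow> \<forall>\<^sub>F (n, n') in sequentially \<times>\<^sub>F sequentially.
       (\<integral>\<^sup>+ x. ennreal (\<bar>v (r n) x - v (r n') x\<bar> powr q) * indicator \<Omega> x \<partial>lborel) \<le> ennreal e"
proof -
  have [measurable]: "\<Omega> \<in> sets borel" using \<Omega> by simp
  have fin_\<Omega>: "emeasure lborel \<Omega> < \<infinity>" using \<Omega>(2) by (rule emeasure_bounded_finite)
  define N where "N = measure lborel \<Omega> + A"
  have L1: "(\<integral>\<^sup>+ y. ennreal \<bar>v n y\<bar> \<partial>lborel) \<le> ennreal N" for n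
  proof -
    have "ennreal \<bar>v n y\<bar> \<le> indicator \<Omega> y + ennreal (\<bar>v n y\<bar> powr p)" for y
    proof (cases "y \<in> \<Omega>")
      case True
      have "\<bar>v n y\<bar> \<le> 1 + \<bar>v n y\<bar> powr p"
        using p powr_mono[of 1 p "\<bar>v n y\<bar>"] by (cases "\<bar>v n y\<bar> \<le> 1") (auto intro: add_increasing2)
      from ennreal_leI[OF this] True show ?thesis by simp
    qed (simp add: out)
    then have "(\<integral>\<^sup>+ y. ennreal \<bar>v n y\<bar> \<partial>lborel) \<le> (\<integral>\<^sup>+ y. indicator \<Omega> y + ennreal (\<bar>v n y\<bar> powr p) \<partial>lborel)"
      by (intro nn_integral_mono)
    also have "\<dots> = emeasure lborel \<Omega> + (\<integral>\<^sup>+ y. ennreal (\<bar>v n y\<bar> powr p) \<partial>lborel)"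
      by (subst nn_integral_add) auto
    also have "\<dots> \<le> ennreal (measure lborel \<Omega>) + ennreal A"
      using fin_\<Omega> Lp by (intro add_mono) (auto simp: emeasure_eq_ennreal_measure)
    finally show ?thesis using A by (simp add: N_def)
  qed
  have int: "integrable lborel (v n)" for n
    using le_less_trans[OF L1[of n] ennreal_less_top] by (intro integrableI_bounded) auto
  have N: "(\<integral>y. \<bar>v n y\<bar> \<partial>lborel) \<le> N" for n
  proof -
    have "ennreal (\<integral>y. \<bar>v n y\<bar> \<partial>lborel) \<le> ennreal N"
      using L1[of n] int[of n] by (subst (asm) nn_integral_eq_integral) auto
    moreover have "0 \<le> N" using A by (simp add: N_def)
    ultimately show ?thesis by simp
  qed
  obtain F :: "('a set \<times> 'a set) set" where F: "finite F" "\<Omega> = \<Union> (fst ` F)"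
    "\<And>W B. (W, B) \<in> F \<Longrightarrow> open W \<and> cone_at_0 B \<and> (\<forall>x\<in>W. \<forall>b\<in>B. x + b \<in> \<Omega>)"
    using lipschitz_boundary_cone_cover[OF \<Omega>] by metis
  have "\<exists>\<phi> C L. cone_kernel (snd c) \<phi> C L" if "c \<in> F" for c
  proof -
    have B: "cone_at_0 (snd c)" using F(3)[of "fst c" "snd c"] that by simp
    then have "open (snd c)" "snd c \<noteq> {}" by (auto simp: cone_at_0_def)
    from lipschitz_density_in_open_set[OF this] obtain \<phi> C L where "\<And>b. 0 \<le> \<phi> b" "\<And>b. \<phi> b \<le> C * indicator (snd c) b"
      "L-lipschitz_on UNIV \<phi>" "(\<integral>\<^sup>+ b. ennreal (\<phi> b) \<partial>lborel) = 1" "0 \<le> C" by metis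
    with B have "cone_kernel (snd c) \<phi> C L"
      by (unfold_locales) (auto simp: cone_at_0_def)
    then show ?thesis by blast
  qed
  then obtain \<phi> C L where ker: "\<And>c. c \<in> F \<Longrightarrow> cone_kernel (snd c) (\<phi> c) (C c) (L c)" by metis
  define a where "a = (\<lambda>(c, j) n. cone_kernel.avg (\<phi> c) (v n) ((1 / 2) ^ j))"
  obtain r where r: "strict_mono r" "\<And>i x. i \<in> F \<times> (UNIV :: nat set) \<Longrightarrow> convergent (\<lambda>n. a i (r n) x)"
  proof (rule equilipschitz_pointwise_subsequence[where f = a and I = "F \<times> (UNIV :: nat set)"])
    show "countable (F \<times> (UNIV :: nat set))" using F(1) by (simp add: countable_finite)
    fix i n x y assume i: "i \<in> F \<times> (UNIV :: nat set)"
    then interpret K: cone_kernel "snd (fst i)" "\<phi> (fst i)" "C (fst i)" "L (fst i)"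
      by (intro ker) auto
    have a_eq: "a i n = K.avg (v n) ((1 / 2) ^ snd i)" for n
      by (simp add: a_def split_beta)
    show "\<bar>a i n x\<bar> \<le> C (fst i) / ((1 / 2) ^ snd i) ^ DIM('a) * N"
      unfolding a_eq by (rule K.abs_avg_le[OF int N]) simp
    show "\<bar>a i n x - a i n y\<bar> \<le> L (fst i) * N / ((1 / 2) ^ snd i) ^ Suc DIM('a) * norm (x - y)"
      unfolding a_eq by (rule K.avg_lipschitz[OF int N]) simp
  qed blast
  have cauchy: "\<forall>\<^sub>F (n, n') in sequentially \<times>\<^sub>F sequentially.
      (\<integral>\<^sup>+ x. ennreal (\<bar>v (r n) x - v (r n') x\<bar> powr q) * indicator (fst c) x \<partial>lborel) \<le> ennreal e"
    if c: "c \<in> F" and e: "0 < e" for c e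
  proof -
    interpret K: cone_kernel "snd c" "\<phi> c" "C c" "L c" by (rule ker[OF c])
    have W: "open (fst c)" "fst c \<subseteq> \<Omega>" "\<And>x. x \<in> fst c \<Longrightarrow> K.piece x 1 \<subseteq> \<Omega>"
    proof -
      have "open (fst c) \<and> (\<forall>x\<in>fst c. \<forall>b\<in>snd c. x + b \<in> \<Omega>)"
        using F(3)[of "fst c" "snd c"] c by simp
      then show "open (fst c)" "fst c \<subseteq> \<Omega>" "\<And>x. x \<in> fst c \<Longrightarrow> K.piece x 1 \<subseteq> \<Omega>"
        using F(2) c by (force simp: K.piece_def)+
    qed
    have W_fin: "emeasure lborel (fst c) < \<infinity>"
      using le_less_trans[OF emeasure_mono[OF W(2), of lborel] fin_\<Omega>] by simp
    have [measurable]: "fst c \<in> sets borel" using W by simp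
    obtain K where K: "0 \<le> K"
      "\<And>v \<Omega> W m \<delta> \<Lambda> j. v \<in> borel_measurable borel \<Longrightarrow> \<Omega> \<in> sets borel \<Longrightarrow> W \<in> sets borel \<Longrightarrow> (\<And>y. \<bar>v y\<bar> \<le> m) \<Longrightarrow>
        0 < \<delta> \<Longrightarrow> \<delta> \<le> (1 / 2) ^ j \<Longrightarrow> 0 < \<Lambda> \<Longrightarrow> W \<subseteq> \<Omega> \<Longrightarrow> (\<And>x. x \<in> W \<Longrightarrow> K.piece x 1 \<subseteq> \<Omega>) \<Longrightarrow>
        (\<integral>\<^sup>+ y. local_energy p \<delta> \<Omega> v y * indicator \<Omega> y \<partial>lborel) \<le> ennreal (A * \<delta> powr (p + DIM('a))) \<Longrightarrow>
        (\<And>x. x \<in> \<Omega> \<Longrightarrow> local_energy p \<delta> \<Omega> v x \<le> ennreal (A * \<delta> powr (p + DIM('a)) / \<Lambda>)) \<Longrightarrow>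
        (\<integral>\<^sup>+ x. ennreal (\<bar>v x - K.avg v ((1 / 2) ^ j) x\<bar> powr q) * indicator W x \<partial>lborel)
          \<le> ennreal (K * (\<delta> powr q * \<Lambda> powr ((p - q) / p) +
                2 powr (- (q * (1 - DIM('a) / p + DIM('a) / q) * j))))"
      using K.minus_avg_Lq_multiscale[OF p \<theta> A] by blast
    show ?thesis
    proof (rule Lq_cauchy_if_near_convergent[where f = "\<lambda>n. v (r n)"])
      fix e :: real assume e: "0 < e"
      define t where "t = q * (1 - DIM('a) / p + DIM('a) / q)"
      have t: "0 < t" using \<theta> p by (simp add: t_def)
      have "(\<lambda>j. K * 2 powr (- (t * real j))) \<longlonglongrightarrow> K * 0"
      proof (intro tendsto_mult tendsto_const)
        have "(\<lambda>j. (2 powr (- t)) ^ j) \<longlonglongrightarrow> 0"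
          using t by (intro LIMSEQ_realpow_zero) (auto simp: powr_less_one)
        moreover have "(2 powr (- t)) ^ j = 2 powr (- (t * real j))" for j
          by (simp add: powr_realpow[symmetric] powr_powr)
        ultimately show "(\<lambda>j. 2 powr (- (t * real j))) \<longlonglongrightarrow> 0" by simp
      qed
      then have "\<forall>\<^sub>F j in sequentially. K * 2 powr (- (t * real j)) < e / 2"
        using e by (intro order_tendstoD(2)) auto
      then obtain j where j: "K * 2 powr (- (t * real j)) < e / 2"
        by (auto simp: eventually_sequentially)
      have "(\<lambda>n. K * (\<delta> n powr q * \<Lambda> n powr ((p - q) / p))) \<longlonglongrightarrow> K * 0"
        by (intro tendsto_mult tendsto_const small)
      then have "\<forall>\<^sub>F n in sequentially. K * (\<delta> n powr q * \<Lambda> n powr ((p - q) / p)) < e / 2"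
        using e by (intro order_tendstoD(2)) auto
      moreover have "\<forall>\<^sub>F n in sequentially. \<delta> n < (1 / 2) ^ j"
        using \<delta>(2) by (rule order_tendstoD(2)) simp
      ultimately have near: "\<forall>\<^sub>F n in sequentially.
          (\<integral>\<^sup>+ x. ennreal (\<bar>v n x - a (c, j) n x\<bar> powr q) * indicator (fst c) x \<partial>lborel) \<le> ennreal e"
      proof eventually_elim
        case (elim n)
        have "(\<integral>\<^sup>+ x. ennreal (\<bar>v n x - K.avg (v n) ((1 / 2) ^ j) x\<bar> powr q) * indicator (fst c) x \<partial>lborel)
            \<le> ennreal (K * (\<delta> n powr q * \<Lambda> n powr ((p - q) / p) + 2 powr (- (t * real j))))"
          unfolding t_def
          using elim
          by (intro K(2)[OF v[of n] _ _ bd \<delta>(1)[of n] _ \<Lambda>[of n] W(2) W(3) energy sup_energy]) auto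
        also have "\<dots> \<le> ennreal e"
          using elim j by (intro ennreal_leI) (simp add: distrib_left)
        finally show ?case by (simp add: a_def)
      qed
      define g where "g x = lim (\<lambda>n. a (c, j) (r n) x)" for x
      have [measurable]: "a (c, j) n \<in> borel_measurable borel" for n
        by (simp add: a_def)
      have [measurable]: "g \<in> borel_measurable borel"
        unfolding g_def by measurable
      have g: "(\<lambda>n. a (c, j) (r n) x) \<longlonglongrightarrow> g x" for x
        unfolding g_def using r(2)[of "(c, j)" x] c by (simp add: convergent_LIMSEQ_iff)
      have conv: "(\<lambda>n. \<integral>\<^sup>+ x. ennreal (\<bar>a (c, j) (r n) x - g x\<bar> powr q) * indicator (fst c) x \<partial>lborel) \<longlonglongrightarrow> 0"
      proof (rule nn_integral_powr_tendsto_0_bounded)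
        show "\<bar>a (c, j) (r n) x\<bar> \<le> C c / ((1 / 2) ^ j) ^ DIM('a) * N" for n x
          unfolding a_def split_conv by (rule K.abs_avg_le[OF int N]) simp
      qed (use g W_fin p in auto)
      show "\<exists>a g. (\<forall>n. a n \<in> borel_measurable lborel) \<and> g \<in> borel_measurable lborel \<and>
          (\<forall>\<^sub>F n in sequentially. (\<integral>\<^sup>+ x. ennreal (\<bar>v (r n) x - a n x\<bar> powr q) * indicator (fst c) x \<partial>lborel) \<le> ennreal e) \<and>
          (\<lambda>n. \<integral>\<^sup>+ x. ennreal (\<bar>a n x - g x\<bar> powr q) * indicator (fst c) x \<partial>lborel) \<longlonglongrightarrow> 0"
        using conv eventually_subseq[OF r(1) near]
        by (intro exI[of _ "\<lambda>n. a (c, j) (r n)"] exI[of _ g]) auto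
    qed (use p e in auto)
  qed
  show thesis
  proof (rule that[OF r(1)])
    fix e :: real assume e: "0 < e"
    define e' where "e' = e / (real (card F) + 1)"
    have e': "0 < e'" "real (card F) * e' \<le> e"
      using e by (auto simp: e'_def field_simps add_nonneg_pos)
    have "\<forall>\<^sub>F z in sequentially \<times>\<^sub>F sequentially. \<forall>c\<in>F.
      (\<integral>\<^sup>+ x. ennreal (\<bar>v (r (fst z)) x - v (r (snd z)) x\<bar> powr q) * indicator (fst c) x \<partial>lborel) \<le> ennreal e'"
      using cauchy[OF _ e'(1)] F(1)
      by (intro eventually_ball_finite ballI) (simp_all only: case_prod_unfold)
    then show "\<forall>\<^sub>F (n, n') in sequentially \<times>\<^sub>F sequentially.
       (\<integral>\<^sup>+ x. ennreal (\<bar>v (r n) x - v (r n') x\<bar> powr q) * indicator \<Omega> x \<partial>lborel) \<le> ennreal e"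
    proof eventually_elim
      case (elim z)
      let ?h = "\<lambda>x. ennreal (\<bar>v (r (fst z)) x - v (r (snd z)) x\<bar> powr q)"
      have meas: "fst c \<in> sets borel" if "c \<in> F" for c
        using F(3)[of "fst c" "snd c"] that by simp
      have "(\<integral>\<^sup>+ x. ?h x * indicator \<Omega> x \<partial>lborel) \<le> (\<integral>\<^sup>+ x. (\<Sum>c\<in>F. ?h x * indicator (fst c) x) \<partial>lborel)"
      proof (rule nn_integral_mono)
        fix x
        show "?h x * indicator \<Omega> x \<le> (\<Sum>c\<in>F. ?h x * indicator (fst c) x)"
        proof (cases "x \<in> \<Omega>")
          case True
          then obtain c where c: "c \<in> F" "x \<in> fst c" using F(2) by auto
          have "?h x * indicator (fst c) x \<le> (\<Sum>c\<in>F. ?h x * indicator (fst c) x)"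
            using F(1) c(1) by (intro member_le_sum) auto
          with c True show ?thesis by simp
        qed simp
      qed
      also have "\<dots> = (\<Sum>c\<in>F. \<integral>\<^sup>+ x. ?h x * indicator (fst c) x \<partial>lborel)"
        using meas by (intro nn_integral_sum) auto
      also have "\<dots> \<le> (\<Sum>c\<in>F. ennreal e')"
        using elim by (intro sum_mono) auto
      also have "\<dots> = ennreal (real (card F) * e')"
        using e' by (simp add: ennreal_mult' ennreal_of_nat_eq_real_of_nat)
      also have "\<dots> \<le> ennreal e" using e' by (intro ennreal_leI)
      finally show ?case by (simp add: split_beta)
    qed
  qed
qed

section \<open>From the graph to the domain\<close>

lemma sets_prob_measures_on: "\<nu> \<in> prob_measures_on \<Omega> \<Longrightarrow> sets \<nu> = sets (restrict_space borel \<Omega>)"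
  by (simp add: prob_measures_on_def)

lemma space_prob_measures_on: "\<nu> \<in> prob_measures_on \<Omega> \<Longrightarrow> space \<nu> = \<Omega>"
  using sets_eq_imp_space_eq[of \<nu> "restrict_space borel \<Omega>"] sets_prob_measures_on[of \<nu> \<Omega>]
  by (simp add: space_restrict_space)

lemma borel_measurable_prob_measures_on:
  assumes "\<nu> \<in> prob_measures_on \<Omega>" "f \<in> borel_measurable borel"
  shows "f \<in> borel_measurable \<nu>"
  using measurable_restrict_space1[OF assms(2), of \<Omega>] sets_prob_measures_on[OF assms(1)]
  by (simp cong: measurable_cong_sets)

lemma singleton_in_sets_prob_measures_on:
  assumes "\<nu> \<in> prob_measures_on \<Omega>" "open \<Omega>" "a \<in> \<Omega>"
  shows "{a} \<in> sets \<nu>"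
  using assms by (simp add: sets_prob_measures_on sets_restrict_space_iff)

lemma nn_integral_density_comparable:
  fixes \<Omega> :: "'a::euclidean_space set"
  assumes \<Omega>: "open \<Omega>" and \<rho>: "continuous_on \<Omega> \<rho>" and D: "0 < D" "\<And>x. x \<in> \<Omega> \<Longrightarrow> 1 / D \<le> \<rho> x \<and> \<rho> x \<le> D"
    and \<mu>: "\<mu> = density (restrict_space lborel \<Omega>) (\<lambda>x. ennreal (\<rho> x))"
    and f [measurable]: "f \<in> borel_measurable borel"
  shows "(\<integral>\<^sup>+ x. f x * indicator \<Omega> x \<partial>lborel) \<le> ennreal D * (\<integral>\<^sup>+ x. f x \<partial>\<mu>)"
    and "(\<integral>\<^sup>+ x. f x \<partial>\<mu>) \<le> ennreal D * (\<integral>\<^sup>+ x. f x * indicator \<Omega> x \<partial>lborel)"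
proof -
  have [measurable]: "\<Omega> \<in> sets borel" using \<Omega> by simp
  have [measurable]: "\<rho> \<in> borel_measurable (restrict_space lborel \<Omega>)"
    using borel_measurable_continuous_on_restrict[OF \<rho>] by (simp cong: measurable_cong_sets sets_restrict_space_cong)
  have [measurable]: "f \<in> borel_measurable (restrict_space lborel \<Omega>)"
    by (intro measurable_restrict_space1) simp
  have \<mu>_eq: "(\<integral>\<^sup>+ x. f x \<partial>\<mu>) = (\<integral>\<^sup>+ x. ennreal (\<rho> x) * f x \<partial>restrict_space lborel \<Omega>)"
    unfolding \<mu> by (rule nn_integral_density) measurable
  have f_eq: "(\<integral>\<^sup>+ x. f x * indicator \<Omega> x \<partial>lborel) = (\<integral>\<^sup>+ x. f x \<partial>restrict_space lborel \<Omega>)"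
    by (subst nn_integral_restrict_space) auto
  have sp: "space (restrict_space lborel \<Omega>) = \<Omega>" by (simp add: space_restrict_space)
  have "(\<integral>\<^sup>+ x. f x \<partial>restrict_space lborel \<Omega>) \<le> (\<integral>\<^sup>+ x. ennreal D * (ennreal (\<rho> x) * f x) \<partial>restrict_space lborel \<Omega>)"
  proof (rule nn_integral_mono)
    fix x assume "x \<in> space (restrict_space lborel \<Omega>)"
    then have "1 / D \<le> \<rho> x" using D sp by auto
    then have "1 \<le> D * \<rho> x" using D(1) by (simp add: field_simps)
    then have "1 \<le> ennreal D * ennreal (\<rho> x)"
      using D(1) by (simp add: ennreal_mult'[symmetric] ennreal_leI flip: ennreal_1)
    from mult_right_mono[OF this, of "f x"] show "f x \<le> ennreal D * (ennreal (\<rho> x) * f x)"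
      by (simp add: mult.assoc)
  qed
  also have "\<dots> = ennreal D * (\<integral>\<^sup>+ x. ennreal (\<rho> x) * f x \<partial>restrict_space lborel \<Omega>)"
    by (rule nn_integral_cmult) measurable
  finally show "(\<integral>\<^sup>+ x. f x * indicator \<Omega> x \<partial>lborel) \<le> ennreal D * (\<integral>\<^sup>+ x. f x \<partial>\<mu>)"
    by (simp add: \<mu>_eq f_eq)
  have "(\<integral>\<^sup>+ x. ennreal (\<rho> x) * f x \<partial>restrict_space lborel \<Omega>) \<le> (\<integral>\<^sup>+ x. ennreal D * f x \<partial>restrict_space lborel \<Omega>)"
    using D sp by (intro nn_integral_mono mult_right_mono ennreal_leI) auto
  also have "\<dots> = ennreal D * (\<integral>\<^sup>+ x. f x \<partial>restrict_space lborel \<Omega>)"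
    by (rule nn_integral_cmult) measurable
  finally show "(\<integral>\<^sup>+ x. f x \<partial>\<mu>) \<le> ennreal D * (\<integral>\<^sup>+ x. f x * indicator \<Omega> x \<partial>lborel)"
    by (simp add: \<mu>_eq f_eq)
qed

text \<open>
The situation for a single $n$: a transport map from $\mu$ to a measure $\nu$ on a finite set $V$.
\<close>

locale discrete_transport =
  fixes \<Omega> :: "'a::euclidean_space set" and \<mu> \<nu> :: "'a measure" and V :: "'a set" and T :: "'a \<Rightarrow> 'a"
  assumes open_\<Omega>: "open \<Omega>" and \<mu>: "\<mu> \<in> prob_measures_on \<Omega>" and \<nu>: "\<nu> \<in> prob_measures_on \<Omega>"
    and V: "finite V" "V \<subseteq> \<Omega>"
    and T: "T \<in> restrict_space borel \<Omega> \<rightarrow>\<^sub>M restrict_space borel V"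
    and push: "distr \<mu> (restrict_space borel \<Omega>) T = \<nu>"
begin

lemma T_in_V: "x \<in> \<Omega> \<Longrightarrow> T x \<in> V"
  using measurable_space[OF T, of x] by (simp add: space_restrict_space)

lemma T_measurable: "T \<in> \<mu> \<rightarrow>\<^sub>M restrict_space borel \<Omega>"
proof -
  have "T \<in> \<mu> \<rightarrow>\<^sub>M restrict_space borel V"
    using T sets_prob_measures_on[OF \<mu>] by (simp cong: measurable_cong_sets)
  then show ?thesis
    using V T_in_V space_prob_measures_on[OF \<mu>] by (auto simp: measurable_restrict_space2_iff)
qed

lemma T_borel: "T \<in> borel_measurable \<mu>"
  using T_measurable by (simp add: measurable_restrict_space2_iff)

lemma cell_borel: "a \<in> V \<Longrightarrow> T -` {a} \<inter> \<Omega> \<in> sets borel"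
proof -
  assume "a \<in> V"
  then have "{a} \<in> sets (restrict_space borel V)"
    using V by (simp add: sets_restrict_space_iff finite_imp_closed borel_closed)
  then have "T -` {a} \<inter> \<Omega> \<in> sets (restrict_space borel \<Omega>)"
    using measurable_sets[OF T] by (simp add: space_restrict_space)
  then show ?thesis using open_\<Omega> by (simp add: sets_restrict_space_iff)
qed

lemma nn_integral_comp_T: "(\<integral>\<^sup>+ x. F (T x) \<partial>\<mu>) = (\<Sum>a\<in>V. F a * ennreal (measure \<nu> {a}))"
proof -
  interpret \<nu>: prob_space \<nu> using \<nu> by (simp add: prob_measures_on_def)
  have sp: "space \<mu> = \<Omega>" by (rule space_prob_measures_on[OF \<mu>])
  have cell: "T -` {a} \<inter> \<Omega> \<in> sets \<mu>" if "a \<in> V" for a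
    using cell_borel[OF that] open_\<Omega> by (simp add: sets_prob_measures_on[OF \<mu>] sets_restrict_space_iff)
  have "(\<integral>\<^sup>+ x. F (T x) \<partial>\<mu>) = (\<integral>\<^sup>+ x. (\<Sum>a\<in>V. F a * indicator (T -` {a} \<inter> \<Omega>) x) \<partial>\<mu>)"
  proof (rule nn_integral_cong)
    fix x assume "x \<in> space \<mu>"
    then have x: "x \<in> \<Omega>" using sp by simp
    have "(\<Sum>a\<in>V. F a * indicator (T -` {a} \<inter> \<Omega>) x) = (\<Sum>a\<in>V. if T x = a then F a else 0)"
      using x by (intro sum.cong) (auto simp: indicator_def)
    then show "F (T x) = (\<Sum>a\<in>V. F a * indicator (T -` {a} \<inter> \<Omega>) x)"
      using V T_in_V[OF x] by simp
  qed
  also have "\<dots> = (\<Sum>a\<in>V. F a * emeasure \<mu> (T -` {a} \<inter> \<Omega>))"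
    using cell by (subst nn_integral_sum) (auto simp: nn_integral_cmult_indicator)
  also have "\<dots> = (\<Sum>a\<in>V. F a * ennreal (measure \<nu> {a}))"
  proof (rule sum.cong[OF refl])
    fix a assume a: "a \<in> V"
    have "emeasure \<nu> {a} = emeasure \<mu> (T -` {a} \<inter> space \<mu>)"
      unfolding push[symmetric]
      using a V open_\<Omega> by (intro emeasure_distr T_measurable) (auto simp: sets_restrict_space_iff)
    then show "F a * emeasure \<mu> (T -` {a} \<inter> \<Omega>) = F a * ennreal (measure \<nu> {a})"
      by (simp add: sp \<nu>.emeasure_eq_measure)
  qed
  finally show ?thesis .
qed

text \<open>
Extension by zero makes the pullback a Borel function on the whole space, so that averages and
translations need no care about the domain.
\<close>

definition pullback :: "('a \<Rightarrow> real) \<Rightarrow> 'a \<Rightarrow> real" where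
  "pullback u x = (if x \<in> \<Omega> then u (T x) else 0)"

lemma measurable_pullback [measurable]: "pullback u \<in> borel_measurable borel"
proof -
  have "pullback u = (\<lambda>x. \<Sum>a\<in>V. u a * indicator (T -` {a} \<inter> \<Omega>) x)"
  proof
    fix x
    have "(\<Sum>a\<in>V. u a * indicator (T -` {a} \<inter> \<Omega>) x) = (\<Sum>a\<in>V. if x \<in> \<Omega> \<and> T x = a then u a else 0)"
      by (intro sum.cong) (auto simp: indicator_def)
    then show "pullback u x = (\<Sum>a\<in>V. u a * indicator (T -` {a} \<inter> \<Omega>) x)"
      using V T_in_V[of x] by (simp add: pullback_def)
  qed
  then show ?thesis using cell_borel by simp
qed

lemma abs_pullback_le: "\<bar>pullback u x\<bar> \<le> (\<Sum>a\<in>V. \<bar>u a\<bar>)"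
  using V T_in_V[of x] member_le_sum[of "T x" V "\<lambda>a. \<bar>u a\<bar>"] by (auto simp: pullback_def sum_nonneg)

lemma pullback_Lp:
  assumes p: "1 \<le> p" and M: "Lp_norm_on p V \<nu> u \<le> M"
    and \<rho>: "continuous_on \<Omega> \<rho>" and D: "0 < D" "\<And>x. x \<in> \<Omega> \<Longrightarrow> 1 / D \<le> \<rho> x \<and> \<rho> x \<le> D"
    and \<mu>\<rho>: "\<mu> = density (restrict_space lborel \<Omega>) (\<lambda>x. ennreal (\<rho> x))"
  shows "(\<integral>\<^sup>+ y. ennreal (\<bar>pullback u y\<bar> powr p) \<partial>lborel) \<le> ennreal (D * M powr p)"
proof -
  let ?s = "\<Sum>a\<in>V. \<bar>u a\<bar> powr p * measure \<nu> {a}"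
  have s0: "0 \<le> ?s" by (intro sum_nonneg) auto
  have "(\<integral>\<^sup>+ y. ennreal (\<bar>pullback u y\<bar> powr p) \<partial>lborel)
      = (\<integral>\<^sup>+ y. ennreal (\<bar>pullback u y\<bar> powr p) * indicator \<Omega> y \<partial>lborel)"
    using p by (intro nn_integral_cong) (auto simp: pullback_def indicator_def)
  also have "\<dots> \<le> ennreal D * (\<integral>\<^sup>+ y. ennreal (\<bar>pullback u y\<bar> powr p) \<partial>\<mu>)"
    by (rule nn_integral_density_comparable(1)[OF open_\<Omega> \<rho> D \<mu>\<rho>]) auto
  also have "(\<integral>\<^sup>+ y. ennreal (\<bar>pullback u y\<bar> powr p) \<partial>\<mu>) = (\<integral>\<^sup>+ y. ennreal (\<bar>u (T y)\<bar> powr p) \<partial>\<mu>)"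
    using space_prob_measures_on[OF \<mu>] by (intro nn_integral_cong) (auto simp: pullback_def)
  also have "\<dots> = ennreal ?s"
    by (subst nn_integral_comp_T[where F = "\<lambda>a. ennreal (\<bar>u a\<bar> powr p)"])
       (simp add: ennreal_mult'[symmetric] sum_ennreal)
  also have "?s = Lp_norm_on p V \<nu> u powr p"
    using s0 p by (simp add: Lp_norm_on_def powr_powr)
  also have "ennreal D * ennreal (Lp_norm_on p V \<nu> u powr p) \<le> ennreal D * ennreal (M powr p)"
    using M p by (intro mult_left_mono ennreal_leI powr_mono2) (auto simp: Lp_norm_on_def)
  finally show ?thesis using D by (simp add: ennreal_mult')
qed

text \<open>
The contribution of the single vertex $a$ to the graph energy of the kernel that is one on $[0,s]$ and zero
beyond, with neither the weight of $a$ nor any power of $s$.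
\<close>

definition vertex_energy :: "real \<Rightarrow> real \<Rightarrow> ('a \<Rightarrow> real) \<Rightarrow> 'a \<Rightarrow> real" where
  "vertex_energy p s u a =
     (\<Sum>b\<in>V. \<bar>u a - u b\<bar> powr p * indicator {0..s} (norm (a - b)) * measure \<nu> {b})"

lemma vertex_energy_nonneg: "0 \<le> vertex_energy p s u a"
  unfolding vertex_energy_def by (intro sum_nonneg) auto

text \<open>
At distance at most $R\varepsilon$ the scaled kernel is at least $\kappa/\varepsilon^d$, and it is nonnegative beyond.
\<close>

lemma sum_vertex_energy_le:
  assumes \<epsilon>: "0 < \<epsilon>" and \<kappa>: "0 < \<kappa>" and \<eta>: "\<And>r. 0 \<le> r \<Longrightarrow> 0 \<le> \<eta> r" "\<And>r. 0 \<le> r \<Longrightarrow> r \<le> R \<Longrightarrow> \<kappa> \<le> \<eta> r"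
    and E: "graph_energy \<eta> p \<epsilon> V \<nu> u \<le> E"
  shows "(\<Sum>a\<in>V. vertex_energy p (R * \<epsilon>) u a * measure \<nu> {a}) \<le> E / \<kappa> * \<epsilon> powr (p + DIM('a))"
proof -
  let ?c = "\<epsilon> powr (p + DIM('a)) / \<kappa>"
  have "(\<Sum>a\<in>V. vertex_energy p (R * \<epsilon>) u a * measure \<nu> {a})
      = (\<Sum>a\<in>V. \<Sum>b\<in>V. \<bar>u a - u b\<bar> powr p * indicator {0..R * \<epsilon>} (norm (a - b)) * measure \<nu> {b} * measure \<nu> {a})"
    by (simp add: vertex_energy_def sum_distrib_right)
  also have "\<dots> \<le> (\<Sum>a\<in>V. \<Sum>b\<in>V. ?c * (1 / \<epsilon> powr p * (scaled_kernel DIM('a) \<eta> \<epsilon> (norm (a - b)) *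
      \<bar>u a - u b\<bar> powr p * measure \<nu> {a} * measure \<nu> {b})))"
  proof (intro sum_mono)
    fix a b :: 'a
    have i: "indicator {0..R * \<epsilon>} (norm (a - b)) \<le> \<eta> (norm (a - b) / \<epsilon>) / \<kappa>"
    proof (cases "norm (a - b) \<le> R * \<epsilon>")
      case True
      then have "\<kappa> \<le> \<eta> (norm (a - b) / \<epsilon>)" using \<epsilon> by (intro \<eta>) (auto simp: field_simps)
      with \<kappa> show ?thesis by (simp add: indicator_def)
    next
      case False
      have "0 \<le> \<eta> (norm (a - b) / \<epsilon>)" using \<epsilon> by (intro \<eta>) auto
      with False \<kappa> show ?thesis by simp
    qed
    have "\<bar>u a - u b\<bar> powr p * indicator {0..R * \<epsilon>} (norm (a - b)) * measure \<nu> {b} * measure \<nu> {a}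
        \<le> \<bar>u a - u b\<bar> powr p * (\<eta> (norm (a - b) / \<epsilon>) / \<kappa>) * measure \<nu> {b} * measure \<nu> {a}"
      by (intro mult_right_mono mult_left_mono i) auto
    also have "\<dots> = ?c * (1 / \<epsilon> powr p * (scaled_kernel DIM('a) \<eta> \<epsilon> (norm (a - b)) *
      \<bar>u a - u b\<bar> powr p * measure \<nu> {a} * measure \<nu> {b}))"
      using \<epsilon> by (simp add: scaled_kernel_def powr_add powr_realpow)
    finally show "\<bar>u a - u b\<bar> powr p * indicator {0..R * \<epsilon>} (norm (a - b)) * measure \<nu> {b} * measure \<nu> {a}
        \<le> ?c * (1 / \<epsilon> powr p * (scaled_kernel DIM('a) \<eta> \<epsilon> (norm (a - b)) *
      \<bar>u a - u b\<bar> powr p * measure \<nu> {a} * measure \<nu> {b}))" .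
  qed
  also have "\<dots> = ?c * graph_energy \<eta> p \<epsilon> V \<nu> u"
    by (simp only: graph_energy_def sum_distrib_left)
  also have "\<dots> \<le> ?c * E"
    using E \<kappa> by (intro mult_left_mono) auto
  finally show ?thesis by (simp add: mult.commute)
qed

text \<open>
Points at distance at most $\delta$ have images at distance at most $\delta + 2t \le s$, so the integral over $y$
becomes a sum over the vertices within distance $s$ of $T(x)$.
\<close>

lemma local_energy_pullback_le:
  assumes \<rho>: "continuous_on \<Omega> \<rho>" and D: "0 < D" "\<And>x. x \<in> \<Omega> \<Longrightarrow> 1 / D \<le> \<rho> x \<and> \<rho> x \<le> D"
    and \<mu>\<rho>: "\<mu> = density (restrict_space lborel \<Omega>) (\<lambda>x. ennreal (\<rho> x))"
    and disp: "\<And>x. x \<in> \<Omega> \<Longrightarrow> norm (T x - x) \<le> t" and s: "\<delta> + 2 * t \<le> s" and x: "x \<in> \<Omega>"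
  shows "local_energy p \<delta> \<Omega> (pullback u) x \<le> ennreal (D * vertex_energy p s u (T x))"
proof -
  have "local_energy p \<delta> \<Omega> (pullback u) x \<le> ennreal D *
      (\<integral>\<^sup>+ y. ennreal (\<bar>pullback u x - pullback u y\<bar> powr p) * indicator {0..\<delta>} (norm (x - y)) \<partial>\<mu>)"
    unfolding local_energy_def
    by (rule nn_integral_density_comparable(1)[OF open_\<Omega> \<rho> D \<mu>\<rho>]) auto
  also have "\<dots> \<le> ennreal D *
      (\<integral>\<^sup>+ y. ennreal (\<bar>u (T x) - u (T y)\<bar> powr p * indicator {0..s} (norm (T x - T y))) \<partial>\<mu>)"
  proof (intro mult_left_mono nn_integral_mono)
    fix y assume "y \<in> space \<mu>"
    then have y: "y \<in> \<Omega>" using space_prob_measures_on[OF \<mu>] by simp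
    have "norm (T x - T y) \<le> s" if "norm (x - y) \<le> \<delta>"
    proof -
      have "norm (T x - T y) \<le> norm ((T x - x) + (x - y)) + norm (T y - y)"
        using norm_triangle_ineq4[of "(T x - x) + (x - y)" "T y - y"] by simp
      with norm_triangle_ineq[of "T x - x" "x - y"] disp[OF x] disp[OF y] that s
      show ?thesis by linarith
    qed
    then show "ennreal (\<bar>pullback u x - pullback u y\<bar> powr p) * indicator {0..\<delta>} (norm (x - y))
        \<le> ennreal (\<bar>u (T x) - u (T y)\<bar> powr p * indicator {0..s} (norm (T x - T y)))"
      using x y by (auto simp: pullback_def indicator_def)
  qed auto
  also have "\<dots> = ennreal D * ennreal (vertex_energy p s u (T x))"
    unfolding vertex_energy_def
    by (subst nn_integral_comp_T[where F = "\<lambda>b. ennreal (\<bar>u (T x) - u b\<bar> powr p * indicator {0..s} (norm (T x - b)))"])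
       (simp add: ennreal_mult'[symmetric] sum_ennreal)
  finally show ?thesis using D by (simp add: ennreal_mult')
qed

lemma nn_integral_local_energy_pullback_le:
  assumes \<rho>: "continuous_on \<Omega> \<rho>" and D: "0 < D" "\<And>x. x \<in> \<Omega> \<Longrightarrow> 1 / D \<le> \<rho> x \<and> \<rho> x \<le> D"
    and \<mu>\<rho>: "\<mu> = density (restrict_space lborel \<Omega>) (\<lambda>x. ennreal (\<rho> x))"
    and disp: "\<And>x. x \<in> \<Omega> \<Longrightarrow> norm (T x - x) \<le> t" and s: "\<delta> + 2 * t \<le> s"
  shows "(\<integral>\<^sup>+ x. local_energy p \<delta> \<Omega> (pullback u) x * indicator \<Omega> x \<partial>lborel)
    \<le> ennreal (D\<^sup>2 * (\<Sum>a\<in>V. vertex_energy p s u a * measure \<nu> {a}))"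
proof -
  have [measurable]: "\<Omega> \<in> sets borel" using open_\<Omega> by simp
  have "(\<integral>\<^sup>+ x. local_energy p \<delta> \<Omega> (pullback u) x * indicator \<Omega> x \<partial>lborel)
      \<le> ennreal D * (\<integral>\<^sup>+ x. local_energy p \<delta> \<Omega> (pullback u) x \<partial>\<mu>)"
    by (rule nn_integral_density_comparable(1)[OF open_\<Omega> \<rho> D \<mu>\<rho>]) auto
  also have "\<dots> \<le> ennreal D * (\<integral>\<^sup>+ x. ennreal (D * vertex_energy p s u (T x)) \<partial>\<mu>)"
    using space_prob_measures_on[OF \<mu>]
    by (intro mult_left_mono nn_integral_mono local_energy_pullback_le[OF \<rho> D \<mu>\<rho> disp s]) auto
  also have "\<dots> = ennreal (D\<^sup>2 * (\<Sum>a\<in>V. vertex_energy p s u a * measure \<nu> {a}))"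
    using D vertex_energy_nonneg[of p s u]
    by (subst nn_integral_comp_T[where F = "\<lambda>a. ennreal (D * vertex_energy p s u a)"])
       (simp add: ennreal_mult'[symmetric] sum_ennreal power2_eq_square sum_distrib_left mult.assoc)
  finally show ?thesis .
qed

end

section \<open>The metric on function-measure pairs\<close>

lemma TL_dist_nonneg:
  assumes "couplings \<nu> \<kappa> \<noteq> {}"
  shows "0 \<le> TL_dist q (f, \<nu>) (g, \<kappa>)"
  using assms unfolding TL_dist_def by (auto intro!: cINF_greatest)

lemma borel_measurable_extend_by_zero:
  assumes "finite V" "\<nu> \<in> prob_measures_on \<Omega>"
  shows "extend_by_zero V u \<in> borel_measurable \<nu>"
proof (rule borel_measurable_prob_measures_on[OF assms(2)])
  have "extend_by_zero V u = (\<lambda>x. \<Sum>a\<in>V. u a * indicator {a} x)"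
  proof
    fix x
    have "(\<Sum>a\<in>V. u a * indicator {a} x) = (\<Sum>a\<in>V. if x = a then u a else 0)"
      by (intro sum.cong) (auto simp: indicator_def)
    then show "extend_by_zero V u x = (\<Sum>a\<in>V. u a * indicator {a} x)"
      using assms(1) by (simp add: extend_by_zero_def)
  qed
  then show "extend_by_zero V u \<in> borel_measurable borel" by simp
qed

lemma integrable_norm_powr_prob_measures_on:
  assumes "bounded \<Omega>" and \<nu>: "\<nu> \<in> prob_measures_on \<Omega>" and "0 \<le> q"
  shows "integrable \<nu> (\<lambda>x. norm x powr q)"
proof -
  interpret \<nu>: prob_space \<nu> using \<nu> by (simp add: prob_measures_on_def)
  obtain b where b: "\<And>x. x \<in> \<Omega> \<Longrightarrow> norm x \<le> b"
    using \<open>bounded \<Omega>\<close> by (auto simp: bounded_iff)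
  have "AE x in \<nu>. norm (norm x powr q) \<le> b powr q"
    using b \<open>0 \<le> q\<close> space_prob_measures_on[OF \<nu>] by (intro AE_I2) (auto intro!: powr_mono2)
  moreover have "(\<lambda>x. norm x powr q) \<in> borel_measurable \<nu>"
    by (rule borel_measurable_prob_measures_on[OF \<nu>]) measurable
  ultimately show ?thesis by (rule \<nu>.integrable_const_bound)
qed

lemma extend_by_zero_in_TL:
  assumes "bounded \<Omega>" "finite V" and \<nu>: "\<nu> \<in> prob_measures_on \<Omega>" and "0 \<le> q"
  shows "(extend_by_zero V u, \<nu>) \<in> TL q \<Omega>"
proof -
  interpret \<nu>: prob_space \<nu> using \<nu> by (simp add: prob_measures_on_def)
  have [measurable]: "extend_by_zero V u \<in> borel_measurable \<nu>"
    by (rule borel_measurable_extend_by_zero[OF assms(2) \<nu>])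
  have "\<bar>extend_by_zero V u x\<bar> \<le> (\<Sum>a\<in>V. \<bar>u a\<bar>)" for x
    using assms(2) member_le_sum[of x V "\<lambda>a. \<bar>u a\<bar>"] by (auto simp: extend_by_zero_def sum_nonneg)
  then have "\<bar>extend_by_zero V u x\<bar> powr q \<le> (\<Sum>a\<in>V. \<bar>u a\<bar>) powr q" for x
    using \<open>0 \<le> q\<close> by (intro powr_mono2) auto
  then have "integrable \<nu> (\<lambda>x. \<bar>extend_by_zero V u x\<bar> powr q)"
    by (intro \<nu>.integrable_const_bound[where B = "(\<Sum>a\<in>V. \<bar>u a\<bar>) powr q"]) auto
  then show ?thesis
    using \<nu> integrable_norm_powr_prob_measures_on[OF assms(1) \<nu> \<open>0 \<le> q\<close>] by (simp add: TL_def)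
qed

context discrete_transport
begin

lemma transport_coupling: "distr \<mu> (\<nu> \<Otimes>\<^sub>M \<mu>) (\<lambda>x. (T x, x)) \<in> couplings \<nu> \<mu>"
proof -
  have T\<nu>: "T \<in> \<mu> \<rightarrow>\<^sub>M \<nu>"
    using T_measurable sets_prob_measures_on[OF \<nu>] by (simp cong: measurable_cong_sets)
  then have [measurable]: "(\<lambda>x. (T x, x)) \<in> \<mu> \<rightarrow>\<^sub>M \<nu> \<Otimes>\<^sub>M \<mu>"
    by simp
  have "distr \<mu> \<nu> T = \<nu>"
    using push sets_prob_measures_on[OF \<nu>] by (metis distr_cong)
  then show ?thesis
    by (simp add: couplings_def distr_distr comp_def distr_id2)
qed

text \<open>
The infimum over couplings is bounded by its value at the coupling induced by $T$. It is
stated with a nonnegative integral, which can be bounded before integrability is known.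
\<close>

lemma TL_dist_transport_le:
  assumes f [measurable]: "f \<in> borel_measurable \<mu>"
  shows "TL_dist q (extend_by_zero V u, \<nu>) (f, \<mu>)
    \<le> enn2real (\<integral>\<^sup>+ x. ennreal (norm (T x - x) powr q + \<bar>pullback u x - f x\<bar> powr q) \<partial>\<mu>) powr (1 / q)"
proof -
  have T\<nu> [measurable]: "T \<in> \<mu> \<rightarrow>\<^sub>M \<nu>"
    using T_measurable sets_prob_measures_on[OF \<nu>] by (simp cong: measurable_cong_sets)
  have [measurable]: "T \<in> borel_measurable \<mu>" by (rule T_borel)
  have [measurable]: "(\<lambda>x. x) \<in> borel_measurable \<mu>" "(\<lambda>x. x) \<in> borel_measurable \<nu>"
    by (auto intro!: borel_measurable_prob_measures_on[OF \<mu>] borel_measurable_prob_measures_on[OF \<nu>])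
  have [measurable]: "extend_by_zero V u \<in> borel_measurable \<nu>"
    by (rule borel_measurable_extend_by_zero[OF V(1) \<nu>])
  have [measurable]: "pullback u \<in> borel_measurable \<mu>"
    by (rule borel_measurable_prob_measures_on[OF \<mu>]) measurable
  let ?\<gamma> = "distr \<mu> (\<nu> \<Otimes>\<^sub>M \<mu>) (\<lambda>x. (T x, x))"
  let ?c = "\<lambda>(x, y). norm (x - y) powr q + \<bar>extend_by_zero V u x - f y\<bar> powr q"
  have "TL_dist q (extend_by_zero V u, \<nu>) (f, \<mu>) \<le> (\<integral>z. ?c z \<partial>?\<gamma>) powr (1 / q)"
    unfolding TL_dist_def split_conv
    by (rule cINF_lower[OF _ transport_coupling]) (auto intro!: bdd_belowI[of _ 0])
  also have "(\<integral>z. ?c z \<partial>?\<gamma>) = (\<integral>x. norm (T x - x) powr q + \<bar>extend_by_zero V u (T x) - f x\<bar> powr q \<partial>\<mu>)"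
    by (subst integral_distr) auto
  also have "\<dots> = (\<integral>x. norm (T x - x) powr q + \<bar>pullback u x - f x\<bar> powr q \<partial>\<mu>)"
    using T_in_V space_prob_measures_on[OF \<mu>]
    by (intro Bochner_Integration.integral_cong) (auto simp: extend_by_zero_def pullback_def)
  also have "\<dots> = enn2real (\<integral>\<^sup>+ x. ennreal (norm (T x - x) powr q + \<bar>pullback u x - f x\<bar> powr q) \<partial>\<mu>)"
    by (rule integral_eq_nn_integral) auto
  finally show ?thesis .
qed

end

section \<open>The exponents and the weights\<close>

lemma sobolev_exponent_pos:
  fixes p q d :: real
  assumes "1 \<le> p" "p < d" "p \<le> q" "q < d * p / (d - p)"
  shows "0 < 1 - d / p + d / q"
proof -
  have "q * (d - p) < d * p" using assms by (simp add: pos_less_divide_eq)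
  then have "0 < p * q - d * q + d * p" by (simp add: algebra_simps)
  then have "0 < (p * q - d * q + d * p) / (p * q)" using assms by simp
  also have "(p * q - d * q + d * p) / (p * q) = 1 - d / p + d / q"
    using assms by (simp add: field_simps)
  finally show ?thesis .
qed

text \<open>
Replacing the largest weight by the smallest one can only decrease the quotient, and
$1/q + 1/p - 2/p = 1/q - 1/p$; the second claim is the $q$-th power of the resulting limit. The first one holds
because the quotient is infinite whenever the smallest weight vanishes.
\<close>

lemma weight_condition:
  fixes \<epsilon> \<Lambda> \<Lambda>' :: "nat \<Rightarrow> real"
  assumes p: "1 \<le> p" "p \<le> q" and \<epsilon>: "\<And>n. 0 < \<epsilon> n" and w: "\<And>n. 0 \<le> \<Lambda> n" "\<And>n. \<Lambda> n \<le> \<Lambda>' n" "\<And>n. 0 < \<Lambda>' n"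
    and lim: "(\<lambda>n. ennreal (\<epsilon> n * \<Lambda>' n powr (1 / q + 1 / p)) / ennreal (\<Lambda> n powr (2 / p))) \<longlonglongrightarrow> 0"
  shows "\<forall>\<^sub>F n in sequentially. 0 < \<Lambda> n" and "(\<lambda>n. \<epsilon> n powr q * \<Lambda> n powr ((p - q) / p)) \<longlonglongrightarrow> 0"
proof -
  show pos: "\<forall>\<^sub>F n in sequentially. 0 < \<Lambda> n"
    using order_tendstoD(2)[OF lim, of 1]
  proof (simp, elim eventually_mono)
    fix n
    assume *: "ennreal (\<epsilon> n * \<Lambda>' n powr (1 / q + 1 / p)) / ennreal (\<Lambda> n powr (2 / p)) < 1"
    show "0 < \<Lambda> n"
    proof (rule ccontr)
      assume "\<not> 0 < \<Lambda> n"
      then have "\<Lambda> n = 0" using w(1)[of n] by simp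
      moreover have "0 < \<epsilon> n * \<Lambda>' n powr (1 / q + 1 / p)" using \<epsilon>[of n] w(3)[of n] by simp
      ultimately show False
        using * \<epsilon>[of n] w(3)[of n] by (auto simp: ennreal_divide_zero split: if_splits)
    qed
  qed
  have le: "\<forall>\<^sub>F n in sequentially. ennreal (\<epsilon> n * \<Lambda> n powr (1 / q - 1 / p))
      \<le> ennreal (\<epsilon> n * \<Lambda>' n powr (1 / q + 1 / p)) / ennreal (\<Lambda> n powr (2 / p))"
    using pos
  proof eventually_elim
    case (elim n)
    have "\<epsilon> n * \<Lambda> n powr (1 / q - 1 / p) = \<epsilon> n * \<Lambda> n powr (1 / q + 1 / p) / \<Lambda> n powr (2 / p)"
    proof -
      have e: "1 / q - 1 / p = (1 / q + 1 / p) - 2 / p" by (simp add: divide_inverse)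
      show ?thesis unfolding e powr_diff by simp
    qed
    also have "\<dots> \<le> \<epsilon> n * \<Lambda>' n powr (1 / q + 1 / p) / \<Lambda> n powr (2 / p)"
      using \<epsilon>[of n] w[of n] p elim by (intro divide_right_mono mult_left_mono powr_mono2) auto
    finally show ?case
      using \<epsilon>[of n] elim by (simp add: divide_ennreal ennreal_leI)
  qed
  have nonneg: "0 \<le> \<epsilon> n * \<Lambda> n powr (1 / q - 1 / p)" for n
    using \<epsilon>[of n] by simp
  have "(\<lambda>n. ennreal (\<epsilon> n * \<Lambda> n powr (1 / q - 1 / p))) \<longlonglongrightarrow> ennreal 0"
    using tendsto_sandwich[OF _ le tendsto_const lim] by simp
  then have "(\<lambda>n. \<epsilon> n * \<Lambda> n powr (1 / q - 1 / p)) \<longlonglongrightarrow> 0"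
    using nonneg by (subst (asm) tendsto_ennreal_iff) auto
  then have "(\<lambda>n. (\<epsilon> n * \<Lambda> n powr (1 / q - 1 / p)) powr q) \<longlonglongrightarrow> 0 powr q"
    using p nonneg by (intro tendsto_powr2) auto
  moreover have "(\<epsilon> n * \<Lambda> n powr (1 / q - 1 / p)) powr q = \<epsilon> n powr q * \<Lambda> n powr ((p - q) / p)" for n
  proof -
    have "(1 / q - 1 / p) * q = (p - q) / p" using p by (simp add: field_simps)
    then show ?thesis using \<epsilon>[of n] by (simp add: powr_mult powr_powr)
  qed
  ultimately show "(\<lambda>n. \<epsilon> n powr q * \<Lambda> n powr ((p - q) / p)) \<longlonglongrightarrow> 0" by simp
qed

lemma weight_bounds:
  assumes \<nu>: "\<nu> \<in> prob_measures_on \<Omega>" and "open \<Omega>" and V: "finite V" "V \<subseteq> \<Omega>" "measure \<nu> V = 1"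
  shows "0 \<le> min_weight V \<nu>" "min_weight V \<nu> \<le> max_weight V \<nu>" "0 < max_weight V \<nu>"
    and "\<And>a. a \<in> V \<Longrightarrow> min_weight V \<nu> \<le> measure \<nu> {a}"
proof -
  interpret \<nu>: prob_space \<nu> using \<nu> by (simp add: prob_measures_on_def)
  have ne: "V \<noteq> {}" using V by auto
  show m: "min_weight V \<nu> \<le> measure \<nu> {a}" if "a \<in> V" for a
    unfolding min_weight_def using V that by (intro Min_le) auto
  have M: "measure \<nu> {a} \<le> max_weight V \<nu>" if "a \<in> V" for a
    unfolding max_weight_def using V that by (intro Max_ge) auto
  show "0 \<le> min_weight V \<nu>"
    unfolding min_weight_def using V ne by (subst Min_ge_iff) auto
  obtain a where "a \<in> V" using ne by blast
  then show "min_weight V \<nu> \<le> max_weight V \<nu>" using m[of a] M[of a] by simp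
  have "measure \<nu> V = (\<Sum>a\<in>V. measure \<nu> {a})"
    using V singleton_in_sets_prob_measures_on[OF \<nu> \<open>open \<Omega>\<close>]
    by (intro \<nu>.finite_measure_eq_sum_singleton) auto
  also have "\<dots> \<le> (\<Sum>a\<in>V. max_weight V \<nu>)" by (intro sum_mono M)
  finally have "1 \<le> real (card V) * max_weight V \<nu>" using V by simp
  then show "0 < max_weight V \<nu>"
    by (metis mult_nonneg_nonpos not_less not_one_le_zero of_nat_0_le_iff order_trans)
qed

section \<open>Relative compactness\<close>

theorem proposition5p14:
  fixes \<Omega> :: "'a::euclidean_space set" and \<eta> :: "real \<Rightarrow> real"
  assumes "open \<Omega>" and "bounded \<Omega>" and "lipschitz_boundary \<Omega>"
    and "\<And>r. 0 \<le> r \<Longrightarrow> 0 \<le> \<eta> r"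
  shows "\<exists>S>0. \<forall>(p::real) (q::real) (\<mu>::'a measure) (\<rho>::'a \<Rightarrow> real)
      (V::nat \<Rightarrow> 'a set) (\<mu>n::nat \<Rightarrow> 'a measure) (\<epsilon>::nat \<Rightarrow> real) (u::nat \<Rightarrow> 'a \<Rightarrow> real).
    1 \<le> p \<and> p < DIM('a) \<and> p \<le> q \<and> q < DIM('a) * p / (DIM('a) - p) \<and>
    \<mu> \<in> prob_measures_on \<Omega> \<and> continuous_on \<Omega> \<rho> \<and>
    \<mu> = density (restrict_space lborel \<Omega>) (\<lambda>x. ennreal (\<rho> x)) \<and>
    (\<forall>n. finite (V n) \<and> V n \<subseteq> \<Omega>) \<and>
    (\<forall>n. \<mu>n n \<in> prob_measures_on \<Omega> \<and> measure (\<mu>n n) (V n) = 1) \<and>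
    (\<forall>n. 0 < \<epsilon> n) \<and> \<epsilon> \<longlonglongrightarrow> 0 \<and>
    (\<exists>K>0. K \<le> S \<and>
      (\<exists>T. \<forall>n. T n \<in> restrict_space borel \<Omega> \<rightarrow>\<^sub>M restrict_space borel (V n) \<and>
               distr \<mu> (restrict_space borel \<Omega>) (T n) = \<mu>n n \<and>
               (\<forall>x\<in>\<Omega>. norm (T n x - x) \<le> K * \<epsilon> n))) \<and>
    continuous (at 0 within {0..}) \<eta> \<and> antimono_on {0..} \<eta> \<and> 0 < \<eta> 0 \<and>
    (\<exists>D>0. \<forall>x\<in>\<Omega>. 1 / D \<le> \<rho> x \<and> \<rho> x \<le> D) \<and>
    (\<exists>t>q. kernel_moment DIM('a) \<eta> t < \<infinity>) \<and>
    (\<lambda>n. ennreal (\<epsilon> n * max_weight (V n) (\<mu>n n) powr (1 / q + 1 / p)) /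
          ennreal (min_weight (V n) (\<mu>n n) powr (2 / p))) \<longlonglongrightarrow> 0 \<and>
    bounded (range (\<lambda>n. Lp_norm_on p (V n) (\<mu>n n) (u n))) \<and>
    bounded (range (\<lambda>n. graph_energy \<eta> p (\<epsilon> n) (V n) (\<mu>n n) (u n)))
    \<longrightarrow> TL_relatively_compact q \<Omega> (\<lambda>n. (extend_by_zero (V n) (u n), \<mu>n n))"
proof -
  define near where "near R \<longleftrightarrow> 0 < R \<and> (\<forall>r. 0 \<le> r \<and> r \<le> R \<longrightarrow> \<eta> 0 / 2 \<le> \<eta> r)" for R
  \<comment> \<open>the constant must be named before continuity and positivity of the kernel are assumed; 1 is a default value\<close>
  define R where "R = (if \<exists>R. near R then SOME R. near R else 1)"
  have near_R: "near R" if "\<exists>R. near R"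
    using someI_ex[OF that] that by (simp add: R_def)
  then have R: "0 < R" by (cases "\<exists>R. near R") (auto simp: R_def near_def)
  show ?thesis
  proof (intro exI[of _ "R / 4"] conjI allI impI; (elim conjE exE)?)
    show "0 < R / 4" using R by simp
  next
    fix p q :: real and \<mu> :: "'a measure" and \<rho> :: "'a \<Rightarrow> real" and V :: "nat \<Rightarrow> 'a set"
      and \<nu> :: "nat \<Rightarrow> 'a measure" and \<epsilon> :: "nat \<Rightarrow> real" and u :: "nat \<Rightarrow> 'a \<Rightarrow> real"
      and K :: real and T :: "nat \<Rightarrow> 'a \<Rightarrow> 'a" and D t :: real
    assume p: "1 \<le> p" "p < DIM('a)" "p \<le> q" "q < DIM('a) * p / (DIM('a) - p)"
      and \<mu>: "\<mu> \<in> prob_measures_on \<Omega>" and \<rho>: "continuous_on \<Omega> \<rho>"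
      and \<mu>\<rho>: "\<mu> = density (restrict_space lborel \<Omega>) (\<lambda>x. ennreal (\<rho> x))"
      and V: "\<forall>n. finite (V n) \<and> V n \<subseteq> \<Omega>"
      and \<nu>: "\<forall>n. \<nu> n \<in> prob_measures_on \<Omega> \<and> measure (\<nu> n) (V n) = 1"
      and \<epsilon>: "\<forall>n. 0 < \<epsilon> n" "\<epsilon> \<longlonglongrightarrow> 0"
      and K: "0 < K" "K \<le> R / 4"
      and T: "\<forall>n. T n \<in> restrict_space borel \<Omega> \<rightarrow>\<^sub>M restrict_space borel (V n) \<and>
               distr \<mu> (restrict_space borel \<Omega>) (T n) = \<nu> n \<and>
               (\<forall>x\<in>\<Omega>. norm (T n x - x) \<le> K * \<epsilon> n)"
      and \<eta>: "continuous (at 0 within {0..}) \<eta>" "0 < \<eta> 0"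
      and D: "0 < D" "\<forall>x\<in>\<Omega>. 1 / D \<le> \<rho> x \<and> \<rho> x \<le> D"
      and weights: "(\<lambda>n. ennreal (\<epsilon> n * max_weight (V n) (\<nu> n) powr (1 / q + 1 / p)) /
          ennreal (min_weight (V n) (\<nu> n) powr (2 / p))) \<longlonglongrightarrow> 0"
      and bounds: "bounded (range (\<lambda>n. Lp_norm_on p (V n) (\<nu> n) (u n)))"
        "bounded (range (\<lambda>n. graph_energy \<eta> p (\<epsilon> n) (V n) (\<nu> n) (u n)))"
    have "near R"
    proof (rule near_R)
      have "\<forall>\<^sub>F r in at 0 within {0..}. \<eta> 0 / 2 < \<eta> r"
        using \<eta> by (intro order_tendstoD(1)[of \<eta> "\<eta> 0"]) (auto simp: continuous_within)
      then obtain s where s: "0 < s" "\<And>r. 0 \<le> r \<Longrightarrow> r \<noteq> 0 \<Longrightarrow> r < s \<Longrightarrow> \<eta> 0 / 2 < \<eta> r"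
        by (auto simp: eventually_at dist_real_def)
      have "\<eta> 0 / 2 \<le> \<eta> r" if "0 \<le> r" "r \<le> s / 2" for r
        using s(2)[of r] s(1) that \<eta>(2) by (cases "r = 0") auto
      with s(1) have "near (s / 2)" by (simp add: near_def)
      then show "\<exists>R. near R" ..
    qed
    then have \<eta>R: "\<And>r. 0 \<le> r \<Longrightarrow> r \<le> R \<Longrightarrow> \<eta> 0 / 2 \<le> \<eta> r" by (auto simp: near_def)
    have transport: "discrete_transport \<Omega> \<mu> (\<nu> n) (V n) (T n)" for n
      using \<open>open \<Omega>\<close> \<mu> \<nu> V T by unfold_locales auto
    interpret \<mu>: prob_space \<mu> using \<mu> by (simp add: prob_measures_on_def)
    obtain M where "\<forall>x\<in>range (\<lambda>n. Lp_norm_on p (V n) (\<nu> n) (u n)). norm x \<le> M"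
      using bounds(1) unfolding bounded_iff by blast
    then have M: "\<And>n. Lp_norm_on p (V n) (\<nu> n) (u n) \<le> M"
      by (simp add: abs_le_iff)
    obtain E where "\<forall>x\<in>range (\<lambda>n. graph_energy \<eta> p (\<epsilon> n) (V n) (\<nu> n) (u n)). norm x \<le> E"
      using bounds(2) unfolding bounded_iff by blast
    then have E: "\<And>n. graph_energy \<eta> p (\<epsilon> n) (V n) (\<nu> n) (u n) \<le> E"
      by (simp add: abs_le_iff)
    have q: "1 \<le> q" using p by simp
    define \<Lambda> where "\<Lambda> n = min_weight (V n) (\<nu> n)" for n
    have wb: "0 \<le> \<Lambda> n" "\<Lambda> n \<le> max_weight (V n) (\<nu> n)" "0 < max_weight (V n) (\<nu> n)"
      "\<And>a. a \<in> V n \<Longrightarrow> \<Lambda> n \<le> measure (\<nu> n) {a}" for n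
      unfolding \<Lambda>_def using weight_bounds[of "\<nu> n" \<Omega> "V n"] \<nu> V \<open>open \<Omega>\<close> by auto
    have \<Lambda>: "\<forall>\<^sub>F n in sequentially. 0 < \<Lambda> n" "(\<lambda>n. \<epsilon> n powr q * \<Lambda> n powr ((p - q) / p)) \<longlonglongrightarrow> 0"
      using weight_condition[of p q \<epsilon> \<Lambda> "\<lambda>n. max_weight (V n) (\<nu> n)"] p \<epsilon>(1) wb weights
      by (auto simp: \<Lambda>_def)
    obtain N where N: "\<And>n. N \<le> n \<Longrightarrow> 0 < \<Lambda> n"
      using \<Lambda>(1) by (auto simp: eventually_sequentially)
    define v where "v n = discrete_transport.pullback \<Omega> (T n) (u n)" for n
    define \<delta> where "\<delta> n = R / 2 * \<epsilon> n" for n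
    have \<delta>: "0 < \<delta> n" for n using R \<epsilon> by (simp add: \<delta>_def)
    define B where "B = max E 0 / (\<eta> 0 / 2) * (2 / R) powr (p + DIM('a))"
    have B: "0 \<le> B" using \<eta>(2) by (simp add: B_def)
    define A where "A = D * M powr p + D * B + D\<^sup>2 * B"
    have A: "0 \<le> A" "D * M powr p \<le> A" "D * B \<le> A" "D\<^sup>2 * B \<le> A"
      using B D(1) by (auto simp: A_def)
    have disp: "\<And>x. x \<in> \<Omega> \<Longrightarrow> norm (T n x - x) \<le> K * \<epsilon> n" "\<delta> n + 2 * (K * \<epsilon> n) \<le> R * \<epsilon> n" for n
    proof -
      show "norm (T n x - x) \<le> K * \<epsilon> n" if "x \<in> \<Omega>" for x using T that by blast
      have "K * \<epsilon> n \<le> R / 4 * \<epsilon> n" using K \<epsilon> by (intro mult_right_mono) (auto intro: less_imp_le)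
      then show "\<delta> n + 2 * (K * \<epsilon> n) \<le> R * \<epsilon> n" by (simp add: \<delta>_def)
    qed
    have D': "\<And>x. x \<in> \<Omega> \<Longrightarrow> 1 / D \<le> \<rho> x \<and> \<rho> x \<le> D" using D(2) by blast
    have vertex: "(\<Sum>a\<in>V n. discrete_transport.vertex_energy (\<nu> n) (V n) p (R * \<epsilon> n) (u n) a * measure (\<nu> n) {a})
        \<le> B * \<delta> n powr (p + DIM('a))" for n
    proof -
      interpret P: discrete_transport \<Omega> \<mu> "\<nu> n" "V n" "T n" by (rule transport)
      have "(\<Sum>a\<in>V n. P.vertex_energy p (R * \<epsilon> n) (u n) a * measure (\<nu> n) {a})
          \<le> max E 0 / (\<eta> 0 / 2) * \<epsilon> n powr (p + DIM('a))"
        using \<epsilon>(1) \<eta>(2) \<eta>R assms(4) E[of n] by (intro P.sum_vertex_energy_le[where \<eta> = \<eta>]) auto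
      also have "\<epsilon> n = 2 / R * \<delta> n" using R by (simp add: \<delta>_def)
      then have "\<epsilon> n powr (p + DIM('a)) = (2 / R) powr (p + DIM('a)) * \<delta> n powr (p + DIM('a))"
        using powr_mult[of "2 / R" "\<delta> n" "p + DIM('a)"] by (simp only:)
      finally show ?thesis by (simp add: B_def mult.assoc)
    qed
    have energy: "(\<integral>\<^sup>+ y. local_energy p (\<delta> n) \<Omega> (v n) y * indicator \<Omega> y \<partial>lborel)
        \<le> ennreal (A * \<delta> n powr (p + DIM('a)))" for n
    proof -
      interpret P: discrete_transport \<Omega> \<mu> "\<nu> n" "V n" "T n" by (rule transport)
      have "D\<^sup>2 * (\<Sum>a\<in>V n. P.vertex_energy p (R * \<epsilon> n) (u n) a * measure (\<nu> n) {a})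
          \<le> D\<^sup>2 * (B * \<delta> n powr (p + DIM('a)))"
        by (intro mult_left_mono vertex) auto
      also have "\<dots> \<le> A * \<delta> n powr (p + DIM('a))"
        using mult_right_mono[OF A(4)] by (simp add: mult.assoc)
      finally show ?thesis
        unfolding v_def
        by (intro order_trans[OF P.nn_integral_local_energy_pullback_le[OF \<rho> D(1) D' \<mu>\<rho> disp] ennreal_leI])
    qed
    have sup_energy: "local_energy p (\<delta> n) \<Omega> (v n) x \<le> ennreal (A * \<delta> n powr (p + DIM('a)) / \<Lambda> n)"
      if "x \<in> \<Omega>" "0 < \<Lambda> n" for n x
    proof -
      interpret P: discrete_transport \<Omega> \<mu> "\<nu> n" "V n" "T n" by (rule transport)
      let ?h = "P.vertex_energy p (R * \<epsilon> n) (u n)"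
      have Tx: "T n x \<in> V n" by (rule P.T_in_V[OF that(1)])
      have "?h (T n x) * \<Lambda> n \<le> ?h (T n x) * measure (\<nu> n) {T n x}"
        by (intro mult_left_mono wb Tx P.vertex_energy_nonneg)
      also have "\<dots> \<le> (\<Sum>a\<in>V n. ?h a * measure (\<nu> n) {a})"
        using Tx P.V P.vertex_energy_nonneg
        by (intro member_le_sum[of "T n x" "V n" "\<lambda>a. ?h a * measure (\<nu> n) {a}"]) auto
      also note vertex
      finally have "?h (T n x) \<le> B * \<delta> n powr (p + DIM('a)) / \<Lambda> n"
        using that(2) by (simp add: pos_le_divide_eq)
      then have "D * ?h (T n x) \<le> D * (B * \<delta> n powr (p + DIM('a)) / \<Lambda> n)"
        using D(1) by (intro mult_left_mono) auto
      also have "\<dots> = D * B * (\<delta> n powr (p + DIM('a)) / \<Lambda> n)" by simp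
      also have "\<dots> \<le> A * (\<delta> n powr (p + DIM('a)) / \<Lambda> n)"
        using that(2) by (intro mult_right_mono A) auto
      finally have "D * ?h (T n x) \<le> A * \<delta> n powr (p + DIM('a)) / \<Lambda> n"
        by (simp only: times_divide_eq_right)
      then show ?thesis
        unfolding v_def
        by (intro order_trans[OF P.local_energy_pullback_le[OF \<rho> D(1) D' \<mu>\<rho> disp that(1)] ennreal_leI])
    qed
    have v_Lp: "(\<integral>\<^sup>+ y. ennreal (\<bar>v n y\<bar> powr p) \<partial>lborel) \<le> ennreal A" for n
    proof -
      interpret P: discrete_transport \<Omega> \<mu> "\<nu> n" "V n" "T n" by (rule transport)
      show ?thesis
        unfolding v_def
        by (rule order_trans[OF P.pullback_Lp[OF p(1) M \<rho> D(1) D' \<mu>\<rho>] ennreal_leI[OF A(2)]])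
    qed
    have v_props: "v n \<in> borel_measurable borel" "\<bar>v n y\<bar> \<le> (\<Sum>a\<in>V n. \<bar>u n a\<bar>)" "y \<notin> \<Omega> \<Longrightarrow> v n y = 0" for n y
    proof -
      interpret P: discrete_transport \<Omega> \<mu> "\<nu> n" "V n" "T n" by (rule transport)
      show "v n \<in> borel_measurable borel" "\<bar>v n y\<bar> \<le> (\<Sum>a\<in>V n. \<bar>u n a\<bar>)" "y \<notin> \<Omega> \<Longrightarrow> v n y = 0"
        unfolding v_def by (rule P.measurable_pullback, rule P.abs_pullback_le, simp add: P.pullback_def)
    qed
    have \<delta>_lim: "\<delta> \<longlonglongrightarrow> 0"
      unfolding \<delta>_def using tendsto_mult[OF tendsto_const \<epsilon>(2), of "R / 2"] by simp
    have small: "(\<lambda>n. \<delta> n powr q * \<Lambda> n powr ((p - q) / p)) \<longlonglongrightarrow> 0"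
    proof -
      have "\<delta> n powr q * \<Lambda> n powr ((p - q) / p) = (R / 2) powr q * (\<epsilon> n powr q * \<Lambda> n powr ((p - q) / p))" for n
        unfolding \<delta>_def powr_mult by (simp only: mult.assoc)
      then show ?thesis
        using tendsto_mult[OF tendsto_const \<Lambda>(2), of "(R / 2) powr q"] by (simp only: mult_zero_right)
    qed
    have subsequence: "\<exists>s. strict_mono (s :: nat \<Rightarrow> nat) \<and> (\<exists>l\<in>TL q \<Omega>.
        (\<lambda>k. TL_dist q (extend_by_zero (V (r (s k))) (u (r (s k))), \<nu> (r (s k))) l) \<longlonglongrightarrow> 0)"
      if r: "strict_mono r" for r :: "nat \<Rightarrow> nat"
    proof -
      \<comment> \<open>the smallest weight is positive only from N on; skipping N terms makes it positive throughout\<close>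
      define r' where "r' n = r (n + N)" for n
      have r': "strict_mono r'" using r by (auto simp: r'_def strict_mono_def)
      have "N \<le> r' n" for n
        using seq_suble[OF r, of "n + N"] by (simp add: r'_def)
      then have \<Lambda>r': "0 < \<Lambda> (r' n)" for n by (rule N)
      obtain s where s: "strict_mono s" and cauchy:
        "\<And>e. 0 < e \<Longrightarrow> \<forall>\<^sub>F (n, n') in sequentially \<times>\<^sub>F sequentially.
           (\<integral>\<^sup>+ x. ennreal (\<bar>v (r' (s n)) x - v (r' (s n')) x\<bar> powr q) * indicator \<Omega> x \<partial>lborel) \<le> ennreal e"
      proof (rule nonlocal_compactness_Lq[OF assms(1-3) p(1,3) sobolev_exponent_pos[OF p] A(1),
            where v = "\<lambda>n. v (r' n)" and \<delta> = "\<lambda>n. \<delta> (r' n)" and \<Lambda> = "\<lambda>n. \<Lambda> (r' n)"])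
        show "(\<lambda>n. \<delta> (r' n)) \<longlonglongrightarrow> 0" "(\<lambda>n. \<delta> (r' n) powr q * \<Lambda> (r' n) powr ((p - q) / p)) \<longlonglongrightarrow> 0"
          using LIMSEQ_subseq_LIMSEQ[OF \<delta>_lim r'] LIMSEQ_subseq_LIMSEQ[OF small r'] by (auto simp: comp_def)
      qed (use v_props v_Lp \<delta> \<Lambda>r' energy sup_energy in \<open>auto simp del: ennreal_mult''\<close>)
      define f where "f n = v (r' (s n))" for n
      have f_borel [measurable]: "f n \<in> borel_measurable borel" for n
        unfolding f_def by (rule v_props)
      have f_meas: "f n \<in> borel_measurable \<mu>" for n
        by (rule borel_measurable_prob_measures_on[OF \<mu>]) measurable
      obtain g where g: "g \<in> borel_measurable \<mu>" "(\<integral>\<^sup>+ x. ennreal (\<bar>g x\<bar> powr q) \<partial>\<mu>) < \<infinity>"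
        "(\<lambda>n. \<integral>\<^sup>+ x. ennreal (\<bar>f n x - g x\<bar> powr q) \<partial>\<mu>) \<longlonglongrightarrow> 0"
      proof (rule \<mu>.Lq_cauchy_converges[of f q])
        show "(\<integral>\<^sup>+ x. ennreal (\<bar>f n x\<bar> powr q) \<partial>\<mu>) < \<infinity>" for n
        proof -
          let ?c = "(\<Sum>a\<in>V (r' (s n)). \<bar>u (r' (s n)) a\<bar>) powr q"
          have "(\<integral>\<^sup>+ x. ennreal (\<bar>f n x\<bar> powr q) \<partial>\<mu>) \<le> (\<integral>\<^sup>+ x. ennreal ?c \<partial>\<mu>)"
            unfolding f_def using q
            by (intro nn_integral_mono ennreal_leI powr_mono2 v_props) auto
          also have "\<dots> < \<infinity>" by (simp add: \<mu>.emeasure_space_1)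
          finally show ?thesis .
        qed
        fix e :: real assume "0 < e"
        then have "0 < e / D" using D(1) by simp
        from cauchy[OF this] show "\<forall>\<^sub>F (n, n') in sequentially \<times>\<^sub>F sequentially.
            (\<integral>\<^sup>+ x. ennreal (\<bar>f n x - f n' x\<bar> powr q) \<partial>\<mu>) \<le> ennreal e"
        proof (rule eventually_mono, clarify)
          fix n n'
          assume *: "(\<integral>\<^sup>+ x. ennreal (\<bar>v (r' (s n)) x - v (r' (s n')) x\<bar> powr q) * indicator \<Omega> x \<partial>lborel) \<le> ennreal (e / D)"
          have "(\<integral>\<^sup>+ x. ennreal (\<bar>f n x - f n' x\<bar> powr q) \<partial>\<mu>)
              \<le> ennreal D * (\<integral>\<^sup>+ x. ennreal (\<bar>f n x - f n' x\<bar> powr q) * indicator \<Omega> x \<partial>lborel)"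
            by (rule nn_integral_density_comparable(2)[OF \<open>open \<Omega>\<close> \<rho> D(1) D' \<mu>\<rho>]) measurable
          also have "\<dots> \<le> ennreal D * ennreal (e / D)"
            using * by (intro mult_left_mono) (auto simp: f_def)
          also have "\<dots> = ennreal e"
            using D(1) \<open>0 < e\<close> by (simp add: ennreal_mult'[symmetric])
          finally show "(\<integral>\<^sup>+ x. ennreal (\<bar>f n x - f n' x\<bar> powr q) \<partial>\<mu>) \<le> ennreal e" .
        qed
      qed (use f_meas q in auto)
      have "integrable \<mu> (\<lambda>x. \<bar>g x\<bar> powr q)"
        using g(1,2) by (intro integrableI_bounded) auto
      then have l: "(g, \<mu>) \<in> TL q \<Omega>"
        using \<mu> g(1) integrable_norm_powr_prob_measures_on[OF \<open>bounded \<Omega>\<close> \<mu>, of q] q by (simp add: TL_def)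
      define X where "X n = (\<integral>\<^sup>+ x. ennreal (norm (T (r' (s n)) x - x) powr q + \<bar>f n x - g x\<bar> powr q) \<partial>\<mu>)" for n
      have X_le: "X n \<le> ennreal ((K * \<epsilon> (r' (s n))) powr q) + (\<integral>\<^sup>+ x. ennreal (\<bar>f n x - g x\<bar> powr q) \<partial>\<mu>)" for n
      proof -
        have "X n \<le> (\<integral>\<^sup>+ x. ennreal ((K * \<epsilon> (r' (s n))) powr q) + ennreal (\<bar>f n x - g x\<bar> powr q) \<partial>\<mu>)"
          unfolding X_def using disp(1) q space_prob_measures_on[OF \<mu>]
          by (intro nn_integral_mono) (auto simp flip: ennreal_plus intro!: ennreal_leI powr_mono2)
        also have "\<dots> = ennreal ((K * \<epsilon> (r' (s n))) powr q) + (\<integral>\<^sup>+ x. ennreal (\<bar>f n x - g x\<bar> powr q) \<partial>\<mu>)"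
          using f_meas g(1) by (simp add: nn_integral_add \<mu>.emeasure_space_1)
        finally show ?thesis .
      qed
      have "(\<lambda>n. \<epsilon> (r' (s n))) \<longlonglongrightarrow> 0"
        using LIMSEQ_subseq_LIMSEQ[OF \<epsilon>(2) strict_mono_o[OF r' s]] by (simp add: comp_def)
      then have "(\<lambda>n. K * \<epsilon> (r' (s n))) \<longlonglongrightarrow> 0"
        using tendsto_mult[OF tendsto_const, of "\<lambda>n. \<epsilon> (r' (s n))" 0 sequentially K] by simp
      then have "(\<lambda>n. (K * \<epsilon> (r' (s n))) powr q) \<longlonglongrightarrow> 0 powr q"
        using q K \<epsilon>(1) by (intro tendsto_powr2) (auto simp: less_imp_le)
      then have "(\<lambda>n. ennreal ((K * \<epsilon> (r' (s n))) powr q)) \<longlonglongrightarrow> ennreal 0"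
        by (intro tendsto_ennrealI) simp
      from tendsto_add[OF this g(3)]
      have lim: "(\<lambda>n. ennreal ((K * \<epsilon> (r' (s n))) powr q) + (\<integral>\<^sup>+ x. ennreal (\<bar>f n x - g x\<bar> powr q) \<partial>\<mu>)) \<longlonglongrightarrow> 0"
        by simp
      have "X \<longlonglongrightarrow> 0"
        by (rule tendsto_sandwich[OF _ _ tendsto_const lim]) (use X_le in auto)
      then have "X \<longlonglongrightarrow> ennreal 0" by simp
      then have "(\<lambda>n. enn2real (X n)) \<longlonglongrightarrow> 0"
        by (rule tendsto_enn2real) simp
      then have "(\<lambda>n. enn2real (X n) powr (1 / q)) \<longlonglongrightarrow> 0 powr (1 / q)"
        using q by (intro tendsto_powr2) auto
      then have X: "(\<lambda>n. enn2real (X n) powr (1 / q)) \<longlonglongrightarrow> 0" by simp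
      let ?d = "\<lambda>n. TL_dist q (extend_by_zero (V (r' (s n))) (u (r' (s n))), \<nu> (r' (s n))) (g, \<mu>)"
      have d: "0 \<le> ?d n" "?d n \<le> enn2real (X n) powr (1 / q)" for n
      proof -
        interpret P: discrete_transport \<Omega> \<mu> "\<nu> (r' (s n))" "V (r' (s n))" "T (r' (s n))" by (rule transport)
        show "0 \<le> ?d n" by (rule TL_dist_nonneg) (use P.transport_coupling in blast)
        show "?d n \<le> enn2real (X n) powr (1 / q)"
          unfolding X_def f_def v_def by (rule P.TL_dist_transport_le[OF g(1)])
      qed
      have "?d \<longlonglongrightarrow> 0"
        by (rule tendsto_sandwich[OF _ _ tendsto_const X]) (use d in auto)
      moreover have "strict_mono (\<lambda>n. s n + N)" using s by (auto simp: strict_mono_def)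
      ultimately show ?thesis
        using l by (intro exI[of _ "\<lambda>n. s n + N"] conjI bexI[of _ "(g, \<mu>)"]) (auto simp: r'_def)
    qed
    show "TL_relatively_compact q \<Omega> (\<lambda>n. (extend_by_zero (V n) (u n), \<nu> n))"
      unfolding TL_relatively_compact_def
      using subsequence extend_by_zero_in_TL[OF \<open>bounded \<Omega>\<close>] V \<nu> q by auto
  qed
qed

end
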